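(* Let $\varepsilon>0$ and consider the Euler-Bernoulli beam $$\frac{\partial^2w}{\partial t^2}(\zeta,t)=-\frac{\partial^4w}{\partial\zeta^4}(\zeta,t),\quad \zeta\in(0,1),\ t\ge0,\qquad w(0,t)=\frac{\partial w}{\partial\zeta}(0,t)=\frac{\partial^2w}{\partial\zeta^2}(1,t)=0,$$ $$u(t)=\frac{\partial^3w}{\partial\zeta^3}(1,t),\qquad y(t)=-\frac{\partial w}{\partial t}(1,t)+\varepsilon\frac{\partial^3w}{\partial\zeta^3}(1,t).$$ The unique optimal input $u^{\mathrm{opt}}$ that minimizes the cost $J(x_0,u)=\int_0^\infty|u(t)|^2+|y(t)|^2\,\mathrm{d}t$ under these dynamics is given by $$u^{\mathrm{opt}}(t)=-\mu\left[\varepsilon\frac{\partial^3w^{\mathrm{opt}}}{\partial\zeta^3}(1,t)-\frac{\partial w^{\mathrm{opt}}}{\partial t}(1,t)\right],\qquad \mu:=\left(\sqrt{1+\varepsilon^2}-\varepsilon\right)^{-1},$$ where $w^{\mathrm{opt}}$ satisfies $$\frac{\partial^2w^{\mathrm{opt}}}{\partial t^2}(\zeta,t)=-\frac{\partial^4w^{\mathrm{opt}}}{\partial\zeta^4}(\zeta,t),\qquad w^{\mathrm{opt}}(0,t)=\frac{\partial w^{\mathrm{opt}}}{\partial\zeta}(0,t)=\frac{\partial^2w^{\mathrm{opt}}}{\partial\zeta^2}(1,t)=0,$$ $$\frac{\partial w^{\mathrm{opt}}}{\partial t}(1,t)=\sqrt{1+\varepsilon^2}\,\frac{\partial^3w^{\mathrm{opt}}}{\partial\zeta^3}(1,t).$$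 Moreover, the optimal cost is $J(x_0,u^{\mathrm{opt}})=\mu^{-1}\|x_0\|_X^2$, where $x_0(\zeta)=\left(w^{\mathrm{opt}}(\zeta,0),\frac{\partial w^{\mathrm{opt}}}{\partial t}(\zeta,0)\right)^\top$, $\zeta\in(0,1)$.
   Context: State space: with $x=(x_1,x_2)^\top=(w,\partial w/\partial t)^\top$, $X=\{x\in H^2(0,1;\mathbb{C})\times L^2(0,1;\mathbb{C}): x_1(0)=\frac{\mathrm{d}x_1}{\mathrm{d}\zeta}(0)=0\}$ with inner product $\langle f,g\rangle_X=\int_0^1\frac{\mathrm{d}^2f_1}{\mathrm{d}\zeta^2}\overline{\frac{\mathrm{d}^2g_1}{\mathrm{d}\zeta^2}}+f_2\overline{g_2}\,\mathrm{d}\zeta$. The beam is understood as the system $\begin{bmatrix}\dot x(t)\\ y(t)\end{bmatrix}=S\begin{bmatrix}x(t)\\ u(t)\end{bmatrix}$, $x(0)=x_0\in X$, with the system node $S=\begin{bmatrix}A\&B\\ C\&D\end{bmatrix}$ on $(\mathbb{C},X,\mathbb{C})$ given by $A\&B\begin{bmatrix}x\\ u\end{bmatrix}=\begin{bmatrix}x_2\\ -\frac{\mathrm{d}^4x_1}{\mathrm{d}\zeta^4}\end{bmatrix}$, $C\&D\begin{bmatrix}x\\ u\end{bmatrix}=-x_2(1)+\varepsilon\frac{\mathrm{d}^3x_1}{\mathrm{d}\zeta^3}(1)$, and $D(S)=\{(x,u)^\top\in(X\cap(H^4(0,1;\mathbb{C})\times H^2(0,1;\mathbb{C})))\times\mathbb{C}: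 x_2(0)=\frac{\mathrm{d}x_2}{\mathrm{d}\zeta}(0)=0,\ \frac{\mathrm{d}^2x_1}{\mathrm{d}\zeta^2}(1)=0,\ \frac{\mathrm{d}^3x_1}{\mathrm{d}\zeta^3}(1)=u\}$. Solutions: $(x,u,y)$ is a classical solution if $x\in C^1([0,\infty);X)$, $u,y\in C([0,\infty);\mathbb{C})$, $(x(t),u(t))^\top\in D(S)$ and the system equation holds for all $t\ge0$. A generalized solution is $(x,u,y)$ with $x\in C([0,\infty);X)$, $u,y\in L^2_{\mathrm{loc}}(0,\infty;\mathbb{C})$ which is a limit of classical solutions $(x_k,u_k,y_k)$, with $x_k\to x$ in $X$ uniformly on bounded intervals and $u_k\to u$, $y_k\to y$ in $L^2$ on every $[0,\tau]$. The cost $J$ is evaluated along generalized solutions, and boundary traces in the formulas for $u^{\mathrm{opt}}$, $w^{\mathrm{opt}}$ are understood in this sense. *)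

theory Defs
  imports "HOL-Analysis.Analysis"
begin

definition square_integrable :: "real set \<Rightarrow> (real \<Rightarrow> complex) \<Rightarrow> bool" where
  "square_integrable S f \<longleftrightarrow>
     f \<in> borel_measurable (lebesgue_on S) \<and> integrable (lebesgue_on S) (\<lambda>s. (cmod (f s))\<^sup>2)"

(* f is (on [0,1]) the absolutely continuous representative of an H^1 function whose
   weak derivative is the L^2 function g. *)
definition has_weak_deriv :: "(real \<Rightarrow> complex) \<Rightarrow> (real \<Rightarrow> complex) \<Rightarrow> bool" where
  "has_weak_deriv f g \<longleftrightarrow> square_integrable {0..1} g \<and>
     (\<forall>\<zeta>\<in>{0..1}. f \<zeta> = f 0 + (LINT s|lebesgue_on {0..\<zeta>}. g s))"

(* H^k(0,1;C): elements of L^2 are arbitrary representatives, whereas for k > 0 an element is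
   given by its continuous representative on [0,1], so that boundary values are point values.
   Function values outside [0,1] are irrelevant. *)
primrec sobolev :: "nat \<Rightarrow> (real \<Rightarrow> complex) set" where
  "sobolev 0 = {f. square_integrable {0..1} f}"
| "sobolev (Suc k) = {f. \<exists>g\<in>sobolev k. has_weak_deriv f g}"

(* The weak derivative, unique up to null sets. When it has a continuous representative on [0,1]
   (as for every f in H^2), that one is chosen; it is then unique on all of [0,1] and its
   values at 0 and 1 are the traces. *)
definition wderiv :: "(real \<Rightarrow> complex) \<Rightarrow> real \<Rightarrow> complex" where
  "wderiv f = (SOME g. has_weak_deriv f g \<and>
     ((\<exists>h. has_weak_deriv f h \<and> continuous_on {0..1} h) \<longrightarrow> continuous_on {0..1} g))"

type_synonym state = "(real \<Rightarrow> complex) \<times> (real \<Rightarrow> complex)"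

definition state_space :: "state set" where
  "state_space = {(f1, f2). f1 \<in> sobolev 2 \<and> f2 \<in> sobolev 0 \<and> f1 0 = 0 \<and> wderiv f1 0 = 0}"

definition state_inner :: "state \<Rightarrow> state \<Rightarrow> complex" where
  "state_inner f g = (LINT \<zeta>|lebesgue_on {0..1}.
     (wderiv ^^ 2) (fst f) \<zeta> * cnj ((wderiv ^^ 2) (fst g) \<zeta>) + snd f \<zeta> * cnj (snd g \<zeta>))"

definition state_norm :: "state \<Rightarrow> real" where
  "state_norm f = sqrt (Re (state_inner f f))"

definition state_diff :: "state \<Rightarrow> state \<Rightarrow> state" where
  "state_diff f g = (\<lambda>\<zeta>. fst f \<zeta> - fst g \<zeta>, \<lambda>\<zeta>. snd f \<zeta> - snd g \<zeta>)"

definition state_scale :: "real \<Rightarrow> state \<Rightarrow> state" where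
  "state_scale c f = (\<lambda>\<zeta>. of_real c * fst f \<zeta>, \<lambda>\<zeta>. of_real c * snd f \<zeta>)"

(* Equality of two representatives as elements of the state space. *)
definition state_eq :: "state \<Rightarrow> state \<Rightarrow> bool" where
  "state_eq f g \<longleftrightarrow> state_norm (state_diff f g) = 0"

definition state_continuous :: "(real \<Rightarrow> state) \<Rightarrow> bool" where
  "state_continuous x \<longleftrightarrow> (\<forall>t\<ge>0. x t \<in> state_space \<and>
     ((\<lambda>s. state_norm (state_diff (x s) (x t))) \<longlongrightarrow> 0) (at t within {0..}))"

(* x is in C^1([0,\<infinity>); X) with derivative x' *)
definition state_C1 :: "(real \<Rightarrow> state) \<Rightarrow> (real \<Rightarrow> state) \<Rightarrow> bool" where
  "state_C1 x x' \<longleftrightarrow> state_continuous x \<and> state_continuous x' \<and>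
     (\<forall>t\<ge>0. ((\<lambda>s. state_norm (state_diff
                (state_scale (1 / (s - t)) (state_diff (x s) (x t))) (x' t))) \<longlongrightarrow> 0)
             (at t within {0..}))"

definition beam_domain :: "(state \<times> complex) set" where
  "beam_domain = {(x, u). x \<in> state_space \<and> fst x \<in> sobolev 4 \<and> snd x \<in> sobolev 2 \<and>
     snd x 0 = 0 \<and> wderiv (snd x) 0 = 0 \<and>
     (wderiv ^^ 2) (fst x) 1 = 0 \<and> (wderiv ^^ 3) (fst x) 1 = u}"

definition beam_AB :: "state \<Rightarrow> complex \<Rightarrow> state" where
  "beam_AB x u = (snd x, \<lambda>\<zeta>. - (wderiv ^^ 4) (fst x) \<zeta>)"

definition beam_CD :: "real \<Rightarrow> state \<Rightarrow> complex \<Rightarrow> complex" where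
  "beam_CD \<epsilon> x u = - snd x 1 + of_real \<epsilon> * (wderiv ^^ 3) (fst x) 1"

definition classical_solution ::
  "real \<Rightarrow> (real \<Rightarrow> state) \<Rightarrow> (real \<Rightarrow> complex) \<Rightarrow> (real \<Rightarrow> complex) \<Rightarrow> bool" where
  "classical_solution \<epsilon> x u y \<longleftrightarrow>
     state_C1 x (\<lambda>t. beam_AB (x t) (u t)) \<and>
     continuous_on {0..} u \<and> continuous_on {0..} y \<and>
     (\<forall>t\<ge>0. (x t, u t) \<in> beam_domain \<and> y t = beam_CD \<epsilon> (x t) (u t))"

definition L2_loc :: "(real \<Rightarrow> complex) \<Rightarrow> bool" where
  "L2_loc u \<longleftrightarrow> (\<forall>\<tau>>0. square_integrable {0..\<tau>} u)"

definition L2_loc_limit :: "(nat \<Rightarrow> real \<Rightarrow> complex) \<Rightarrow> (real \<Rightarrow> complex) \<Rightarrow> bool" where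
  "L2_loc_limit u\<^sub>k u \<longleftrightarrow> (\<forall>k. L2_loc (u\<^sub>k k)) \<and> L2_loc u \<and>
     (\<forall>\<tau>>0. (\<lambda>k. LINT t|lebesgue_on {0..\<tau>}. (cmod (u\<^sub>k k t - u t))\<^sup>2) \<longlonglongrightarrow> 0)"

definition classical_approximation ::
  "real \<Rightarrow> (nat \<Rightarrow> real \<Rightarrow> state) \<Rightarrow> (nat \<Rightarrow> real \<Rightarrow> complex) \<Rightarrow> (nat \<Rightarrow> real \<Rightarrow> complex)
     \<Rightarrow> (real \<Rightarrow> state) \<Rightarrow> (real \<Rightarrow> complex) \<Rightarrow> (real \<Rightarrow> complex) \<Rightarrow> bool" where
  "classical_approximation \<epsilon> x\<^sub>k u\<^sub>k y\<^sub>k x u y \<longleftrightarrow>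
     (\<forall>k. classical_solution \<epsilon> (x\<^sub>k k) (u\<^sub>k k) (y\<^sub>k k)) \<and>
     (\<forall>\<tau>>0. uniform_limit {0..\<tau>} (\<lambda>k t. state_norm (state_diff (x\<^sub>k k t) (x t))) (\<lambda>t. 0)
               sequentially) \<and>
     L2_loc_limit u\<^sub>k u \<and> L2_loc_limit y\<^sub>k y"

definition generalized_solution ::
  "real \<Rightarrow> (real \<Rightarrow> state) \<Rightarrow> (real \<Rightarrow> complex) \<Rightarrow> (real \<Rightarrow> complex) \<Rightarrow> bool" where
  "generalized_solution \<epsilon> x u y \<longleftrightarrow> state_continuous x \<and> L2_loc u \<and> L2_loc y \<and>
     (\<exists>x\<^sub>k u\<^sub>k y\<^sub>k. classical_approximation \<epsilon> x\<^sub>k u\<^sub>k y\<^sub>k x u y)"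

(* Along a generalized solution with x = (w, w_t), the boundary traces q = w_zzz(1, .) and
   v = w_t(1, .) are the L^2 limits of the pointwise traces of approximating classical solutions. *)
definition boundary_traces ::
  "real \<Rightarrow> (real \<Rightarrow> state) \<Rightarrow> (real \<Rightarrow> complex) \<Rightarrow> (real \<Rightarrow> complex)
     \<Rightarrow> (real \<Rightarrow> complex) \<Rightarrow> (real \<Rightarrow> complex) \<Rightarrow> bool" where
  "boundary_traces \<epsilon> x u y q v \<longleftrightarrow>
     (\<exists>x\<^sub>k u\<^sub>k y\<^sub>k. classical_approximation \<epsilon> x\<^sub>k u\<^sub>k y\<^sub>k x u y \<and>
        L2_loc_limit (\<lambda>k t. (wderiv ^^ 3) (fst (x\<^sub>k k t)) 1) q \<and>
        L2_loc_limit (\<lambda>k t. snd (x\<^sub>k k t) 1) v)"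

definition solution_from ::
  "real \<Rightarrow> state \<Rightarrow> (real \<Rightarrow> state) \<Rightarrow> (real \<Rightarrow> complex) \<Rightarrow> (real \<Rightarrow> complex) \<Rightarrow> bool" where
  "solution_from \<epsilon> x\<^sub>0 x u y \<longleftrightarrow> generalized_solution \<epsilon> x u y \<and> state_eq (x 0) x\<^sub>0"

definition cost :: "(real \<Rightarrow> complex) \<Rightarrow> (real \<Rightarrow> complex) \<Rightarrow> ennreal" where
  "cost u y = (\<integral>\<^sup>+ t. ennreal ((cmod (u t))\<^sup>2 + (cmod (y t))\<^sup>2) \<partial>lebesgue_on {0..})"

definition optimal_input :: "real \<Rightarrow> state \<Rightarrow> (real \<Rightarrow> complex) \<Rightarrow> bool" where
  "optimal_input \<epsilon> x\<^sub>0 u \<longleftrightarrow> (\<exists>x y. solution_from \<epsilon> x\<^sub>0 x u y \<and>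
     (\<forall>x' u' y'. solution_from \<epsilon> x\<^sub>0 x' u' y' \<longrightarrow> cost u y \<le> cost u' y'))"

end

theory Submission
  imports Defs
begin

text \<open>Put \<open>\<nu> = sqrt (1 + \<epsilon>\<^sup>2) - \<epsilon> = 1/\<mu>\<close>, so \<open>\<nu>\<^sup>2 + 2 \<epsilon> \<nu> = 1\<close>, and \<open>v = w\<^sub>t(1) = \<epsilon> u - y\<close>.
  Since \<open>d/dt |x|\<^sup>2 = - 2 Re (u cnj v)\<close>, completing the square gives
  \<open>|u|\<^sup>2 + |y|\<^sup>2 = - \<nu> d/dt |x|\<^sup>2 + |\<nu> u + y|\<^sup>2\<close>. The multiplier \<open>\<zeta> w\<^sub>\<zeta>\<close> bounds
  \<open>\<integral> |x|\<^sup>2\<close> by the energies at the end points and \<open>\<integral> |u|\<^sup>2 + |v|\<^sup>2\<close>, so finite cost forces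
  the energy to come arbitrarily close to zero, and the cost is at least \<open>\<nu> |x\<^sub>0|\<^sup>2\<close>, with
  equality iff \<open>y = - \<nu> u\<close>, that is iff \<open>v = sqrt (1 + \<epsilon>\<^sup>2) u\<close>. All these relations survive the limit
  from classical to generalized solutions. That feedback is dissipative: in the coordinates
  \<open>(w\<^sub>\<zeta>\<^sub>\<zeta>, w\<^sub>t) \<in> L\<^sup>2 \<times> L\<^sup>2\<close> the inverse of the closed-loop generator is an injective bounded
  operator \<open>K\<close> with \<open>K z \<bullet> z \<le> 0\<close>, so Yosida approximation yields the optimal trajectory.\<close>

section \<open>Contraction semigroups on Hilbert spaces\<close>

text \<open>The generator of the beam is unbounded and has the boundary conditions in its domain.
  Everything is therefore phrased through its inverse: a solution obeys X =
  \<open>beam_state X' u\<close> with X' the time derivative, where \<open>beam_state\<close>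
  consists of Volterra integrals and has the boundary conditions wired in. Dissipation and
  multiplier identities thus become algebra of bounded operators on a Hilbert space. The number
  \<nu> is the positive root of the scalar Riccati equation that the ansatz \<nu> |x|^2 for the
  optimal cost produces; \<epsilon> + \<nu> = sqrt (1 + \<epsilon>^2) is then the damping
  coefficient of the closed loop. Traces of generalized solutions exist only as L^2 limits, so the
  energy balance is written with square integrals of u, v and u - v, which are continuous under such
  limits. The multiplier is used a second time, to bound v by the state and u: hence initial state
  and input determine the output. This matters because optimality of u speaks of some output, while
  the claim is about a given one.\<close>

lemma at_within_atLeast_Icc:
  fixes t :: real
  assumes "a \<le> t" "t < T"
  shows "at t within {a..} = at t within {a..T}"
  by (rule at_within_nhd[of t "{..<T}"]) (use assms in auto)

text \<open>The limit is taken in the integrated equation, where pointwise convergence of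
  \<open>y n\<close> is enough; the limit \<open>z'\<close> is continuous, so the fundamental
  theorem of calculus gives the derivative back.\<close>

lemma uniform_limit_has_vector_derivative:
  fixes y :: "nat \<Rightarrow> real \<Rightarrow> 'a::banach"
  assumes der: "\<And>n t. 0 \<le> t \<Longrightarrow> (y n has_vector_derivative z n t) (at t within {0..})"
    and cont: "\<And>n. continuous_on {0..} (z n)"
    and unif: "\<And>T. 0 < T \<Longrightarrow> uniform_limit {0..T} z z' sequentially"
    and lim: "\<And>t. 0 \<le> t \<Longrightarrow> (\<lambda>n. y n t) \<longlonglongrightarrow> y' t"
  shows "continuous_on {0..} z'"
    and "0 \<le> t \<Longrightarrow> (y' has_vector_derivative z' t) (at t within {0..})"
proof -
  have cT: "continuous_on {0..T} (z n)" for n T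
    using cont by (rule continuous_on_subset) auto
  have contT: "continuous_on {0..T} z'" if "0 < T" for T
    by (rule uniform_limit_theorem[OF _ unif[OF that]]) (use cT in auto)
  show "continuous_on {0..} z'"
    unfolding continuous_on_def
  proof
    fix t :: real assume "t \<in> {0..}"
    then have t: "0 \<le> t" by simp
    have "(z' \<longlongrightarrow> z' t) (at t within {0..t+1})"
      using contT[of "t+1"] t by (auto simp: continuous_on_def)
    then show "(z' \<longlongrightarrow> z' t) (at t within {0..})"
      using at_within_atLeast_Icc[of 0 t "t+1"] t by simp
  qed
  have int: "integral {0..t} z' = y' t - y' 0" if t: "0 \<le> t" for t
  proof (cases "t = 0")
    case False
    then have "0 < t" using t by simp
    have "(z n has_integral (y n t - y n 0)) {0..t}" for n
      by (rule fundamental_theorem_of_calculus[OF t])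
        (auto intro!: has_vector_derivative_within_subset[OF der])
    moreover obtain I J where "\<And>n. (z n has_integral I n) {0..t}"
      and J: "(z' has_integral J) {0..t}" "I \<longlonglongrightarrow> J"
      using uniform_limit_integral[OF unif[OF \<open>0 < t\<close>] cT] by auto
    ultimately have "I = (\<lambda>n. y n t - y n 0)"
      by (auto intro: has_integral_unique)
    have "(\<lambda>n. y n t - y n 0) \<longlonglongrightarrow> y' t - y' 0"
      using lim t by (intro tendsto_diff) auto
    with J \<open>I = _\<close> show ?thesis by (metis LIMSEQ_unique integral_unique)
  qed simp
  show "(y' has_vector_derivative z' t) (at t within {0..})" if t: "0 \<le> t"
  proof -
    have "((\<lambda>s. integral {0..s} z') has_vector_derivative z' t) (at t within {0..t+1})"
      by (rule integral_has_vector_derivative) (use contT[of "t+1"] t in auto)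
    then have "((\<lambda>s. integral {0..s} z' + y' 0) has_vector_derivative z' t) (at t within {0..})"
      using at_within_atLeast_Icc[of 0 t "t+1"] t by (auto intro!: derivative_eq_intros)
    then show ?thesis
      by (rule has_vector_derivative_transform[rotated 2]) (use t int in auto)
  qed
qed

lemma uniform_limit_if_Cauchy_bound:
  fixes f :: "nat \<Rightarrow> 'b \<Rightarrow> 'a::complete_space" and S :: "'b set"
  assumes "\<And>n m x. x \<in> S \<Longrightarrow> dist (f n x) (f m x) \<le> b n + b m" and "b \<longlonglongrightarrow> (0::real)"
  shows "\<exists>l. uniform_limit S f l sequentially"
proof -
  have "uniformly_Cauchy_on S f"
    unfolding uniformly_Cauchy_on_def
  proof (intro allI impI)
    fix e :: real assume "0 < e"
    then have "\<forall>\<^sub>F n in sequentially. b n < e / 2"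
      using assms(2) by (intro order_tendstoD) auto
    then obtain N where N: "\<And>n. n \<ge> N \<Longrightarrow> b n < e / 2" by (auto simp: eventually_sequentially)
    show "\<exists>M. \<forall>x\<in>S. \<forall>m\<ge>M. \<forall>n\<ge>M. dist (f m x) (f n x) < e"
    proof (intro exI ballI allI impI)
      fix x m n assume "x \<in> S" "m \<ge> N" "n \<ge> N"
      then show "dist (f m x) (f n x) < e"
        using assms(1)[of x m n] N[of m] N[of n] by linarith
    qed
  qed
  then show ?thesis
    using uniformly_convergent_eq_Cauchy by (auto simp: uniformly_convergent_on_def Cauchy_uniformly_convergent)
qed

text \<open>The exponential series of \<open>B\<close>, applied to \<open>x\<close> term by term and
  differentiated termwise on compact time intervals.\<close>

lemma bounded_linear_ode_exists:
  fixes B :: "'a::banach \<Rightarrow> 'a"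
  assumes "bounded_linear B"
  shows "\<exists>y. y 0 = x \<and> (\<forall>t\<ge>0. (y has_vector_derivative B (y t)) (at t within {0..}))"
proof -
  interpret B: bounded_linear B by fact
  obtain L where L: "L \<ge> 0" "\<And>x. norm (B x) \<le> norm x * L" using B.nonneg_bounded by blast
  define c where "c k = (B ^^ k) x /\<^sub>R fact k" for k
  have nc: "norm (c k) \<le> L ^ k / fact k * norm x" for k
  proof -
    have "norm ((B ^^ k) x) \<le> L ^ k * norm x"
    proof (induction k)
      case (Suc k)
      have "norm ((B ^^ Suc k) x) \<le> norm ((B ^^ k) x) * L" using L(2) by simp
      also have "\<dots> \<le> (L ^ k * norm x) * L" using Suc L(1) by (intro mult_right_mono)
      finally show ?case by (simp add: ac_simps)
    qed simp
    then show ?thesis by (simp add: c_def divide_simps)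
  qed
  have Bc: "B (c k) = Suc k *\<^sub>R c (Suc k)" for k
    by (simp add: c_def B.scaleR field_simps del: of_nat_Suc)
  define S where "S n t = (\<Sum>k<n. t ^ k *\<^sub>R c k)" for n and t :: real
  define y where "y t = (\<Sum>k. t ^ k *\<^sub>R c k)" for t :: real
  have unif: "uniform_limit {0..T} S y sequentially" if "0 < T" for T
    unfolding S_def y_def
  proof (rule Weierstrass_m_test)
    show "norm (t ^ n *\<^sub>R c n) \<le> inverse (fact n) * (T * L) ^ n * norm x" if "t \<in> {0..T}" for n t
    proof -
      have "norm (t ^ n *\<^sub>R c n) \<le> T ^ n * (L ^ n / fact n * norm x)"
        unfolding norm_scaleR using that nc[of n] L(1)
          by (intro mult_mono) (auto intro!: power_mono)
      then show ?thesis by (simp add: power_mult_distrib field_simps)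
    qed
    show "summable (\<lambda>n. inverse (fact n) * (T * L) ^ n * norm x)"
      by (intro summable_mult2 summable_exp)
  qed
  have lim: "(\<lambda>n. S n t) \<longlonglongrightarrow> y t" if "0 \<le> t" for t
    by (rule tendsto_uniform_limitI[OF unif[of "t + 1"]]) (use that in auto)
  \<comment> \<open>Differentiation lowers the degree by one: the sum of n + 1 terms has as
    derivative \<open>B\<close> of the sum of n terms, hence the shift to
    \<open>S (Suc n)\<close>.\<close>
  have derS: "(S (Suc n) has_vector_derivative B (S n t)) (at t within {0..})" for n t
  proof -
    have "(S (Suc n) has_vector_derivative (\<Sum>k<Suc n. (k * t ^ (k - 1)) *\<^sub>R c k)) (at t within {0..})"
      unfolding S_def by (auto intro!: derivative_eq_intros simp del: sum.lessThan_Suc)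
    also have "(\<Sum>k<Suc n. (k * t ^ (k - 1)) *\<^sub>R c k) = B (S n t)"
      unfolding S_def B.sum by (subst sum.lessThan_Suc_shift) (simp add: B.scaleR Bc ac_simps)
    finally show ?thesis .
  qed
  have "(y has_vector_derivative B (y t)) (at t within {0..})" if "0 \<le> t" for t
  proof (rule uniform_limit_has_vector_derivative(2)[where y="\<lambda>n. S (Suc n)" and z="\<lambda>n t. B (S n t)"])
    show "continuous_on {0..} (\<lambda>t. B (S n t))" for n
      unfolding S_def by (intro B.continuous_on continuous_intros)
    show "uniform_limit {0..T} (\<lambda>n t. B (S n t)) (\<lambda>t. B (y t)) sequentially" if "0 < T" for T
      by (intro bounded_linear.uniform_limit[OF assms] unif that)
    show "(\<lambda>n. S (Suc n) s) \<longlonglongrightarrow> y s" if "0 \<le> s" for s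
      using lim[OF that] by (rule LIMSEQ_Suc)
  qed (use derS that in auto)
  moreover have "y 0 = x"
  proof -
    have "(\<lambda>n. S (Suc n) 0) \<longlonglongrightarrow> y 0" using lim[of 0] by (auto dest: LIMSEQ_Suc)
    moreover have "S (Suc n) 0 = x" for n
      unfolding S_def by (subst sum.lessThan_Suc_shift) (simp add: c_def)
    ultimately show ?thesis by (simp add: LIMSEQ_const_iff)
  qed
  ultimately show ?thesis by blast
qed


text \<open>|y|^2 has the derivative 2 y \<bullet> y', so |y|^2 - 2 c t is nonincreasing. The case c
  = 0 is contractivity; a small c compares two approximate solutions.\<close>

lemma norm_power2_growth:
  fixes y y' :: "real \<Rightarrow> 'b::real_inner"
  assumes "\<And>t. 0 \<le> t \<Longrightarrow> (y has_vector_derivative y' t) (at t within {0..})"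
    and "\<And>t. 0 \<le> t \<Longrightarrow> y t \<bullet> y' t \<le> c" and "0 \<le> t"
  shows "(norm (y t))\<^sup>2 \<le> (norm (y 0))\<^sup>2 + 2 * c * t"
proof -
  have d: "((\<lambda>t. y t \<bullet> y t - 2 * c * t) has_real_derivative (2 * (y s \<bullet> y' s) - 2 * c)) (at s within {0..t})"
    if "s \<in> {0..t}" for s
  proof -
    have "(y has_vector_derivative y' s) (at s within {0..t})"
      using that by (intro has_vector_derivative_within_subset[OF assms(1)]) auto
    then show ?thesis
      unfolding has_vector_derivative_def has_field_derivative_def
      by (auto intro!: derivative_eq_intros simp: fun_eq_iff algebra_simps inner_commute)
  qed
  have "y t \<bullet> y t - 2 * c * t \<le> y 0 \<bullet> y 0 - 2 * c * 0"
  proof (rule DERIV_nonpos_imp_decreasing_open[OF \<open>0 \<le> t\<close>])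
    show "\<exists>z. ((\<lambda>t. y t \<bullet> y t - 2 * c * t) has_real_derivative z) (at s) \<and> z \<le> 0"
      if "0 < s" "s < t" for s
      using d[of s] assms(2)[of s] that
      by (intro exI[of _ "2 * (y s \<bullet> y' s) - 2 * c"]) (simp add: at_within_Icc_at)
    show "continuous_on {0..t} (\<lambda>t. y t \<bullet> y t - 2 * c * t)"
      using d by (rule DERIV_continuous_on)
  qed
  then show ?thesis by (simp add: power2_norm_eq_inner)
qed

text \<open>Since (K - h) w \<bullet> w \<le> - h |w|^2, a short explicit step along K - h is a
  strict contraction, and the solution is its fixed point, as in the Lax-Milgram theorem for a
  coercive operator without symmetry.\<close>

lemma dissipative_resolvent_exists:
  fixes K :: "'a::{real_inner,banach} \<Rightarrow> 'a"
  assumes "bounded_linear K" and diss: "\<And>z. K z \<bullet> z \<le> 0" and "0 < h"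
  shows "\<exists>w. K w - h *\<^sub>R w = z"
proof -
  interpret K: bounded_linear K by fact
  define A where "A w = K w - h *\<^sub>R w" for w
  have A: "bounded_linear A"
    unfolding A_def by (intro bounded_linear_sub assms bounded_linear_scaleR_right)
  interpret A: bounded_linear A by fact
  obtain L0 where L0: "\<And>x. norm (A x) \<le> norm x * L0" using A.nonneg_bounded by blast
  \<comment> \<open>The maximum with \<open>h\<close> makes \<open>L\<close> positive and keeps h^2
    / L^2 \<le> 1, so that the square root below is a contraction constant.\<close>
  define L where "L = max L0 h"
  have L: "norm (A x) \<le> norm x * L" for x
    using L0[of x] by (smt (verit) L_def mult_left_mono norm_ge_zero)
  have Lh: "h \<le> L" "0 < L" using \<open>0 < h\<close> by (auto simp: L_def)
  \<comment> \<open>This step length minimizes 1 - 2 h \<tau> + L^2 \<tau>^2, the bound for the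
    squared Lipschitz constant.\<close>
  define \<tau> where "\<tau> = h / L\<^sup>2"
  have \<tau>: "0 < \<tau>" using \<open>0 < h\<close> Lh by (simp add: \<tau>_def)
  define T where "T w = w + \<tau> *\<^sub>R (A w - z)" for w
  have contr: "norm (w + \<tau> *\<^sub>R A w) \<le> sqrt (1 - h\<^sup>2 / L\<^sup>2) * norm w" for w
  proof -
    have "A w \<bullet> w \<le> - h * (norm w)\<^sup>2"
      using diss[of w] by (simp add: A_def inner_diff_left dot_square_norm)
    then have "2 * \<tau> * (w \<bullet> A w) \<le> 2 * \<tau> * (- h * (norm w)\<^sup>2)"
      using \<tau> by (intro mult_left_mono) (auto simp: inner_commute)
    moreover have "\<tau>\<^sup>2 * (norm (A w))\<^sup>2 \<le> \<tau>\<^sup>2 * (norm w * L)\<^sup>2"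
      by (intro mult_left_mono power_mono L) auto
    moreover have "(norm (w + \<tau> *\<^sub>R A w))\<^sup>2
        = (norm w)\<^sup>2 + 2 * \<tau> * (w \<bullet> A w) + \<tau>\<^sup>2 * (norm (A w))\<^sup>2"
      unfolding power2_norm_eq_inner
      by (simp add: inner_add_left inner_add_right inner_commute power2_eq_square algebra_simps)
    ultimately have "(norm (w + \<tau> *\<^sub>R A w))\<^sup>2
        \<le> (norm w)\<^sup>2 + 2 * \<tau> * (- h * (norm w)\<^sup>2) + \<tau>\<^sup>2 * (norm w * L)\<^sup>2" by linarith
    also have "\<dots> = (1 - h\<^sup>2 / L\<^sup>2) * (norm w)\<^sup>2"
      using Lh by (simp add: \<tau>_def power2_eq_square field_simps)
    finally have "sqrt ((norm (w + \<tau> *\<^sub>R A w))\<^sup>2) \<le> sqrt ((1 - h\<^sup>2 / L\<^sup>2) * (norm w)\<^sup>2)"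
      by (rule real_sqrt_le_mono)
    then show ?thesis by (simp add: real_sqrt_mult)
  qed
  have "\<exists>!w. T w = w"
  proof (rule banach_fix_type[where c="sqrt (1 - h\<^sup>2 / L\<^sup>2)"])
    have "h\<^sup>2 / L\<^sup>2 \<le> 1" using Lh \<open>0 < h\<close> by (simp add: power_mono)
    then show "0 \<le> sqrt (1 - h\<^sup>2 / L\<^sup>2)" by simp
    have "1 - h\<^sup>2 / L\<^sup>2 < 1" using \<open>0 < h\<close> Lh by simp
    then show "sqrt (1 - h\<^sup>2 / L\<^sup>2) < 1" by simp
    show "\<forall>x y. dist (T x) (T y) \<le> sqrt (1 - h\<^sup>2 / L\<^sup>2) * dist x y"
    proof (intro allI)
      fix x y
      have "T x - T y = (x - y) + \<tau> *\<^sub>R A (x - y)" by (simp add: T_def A.diff algebra_simps)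
      then show "dist (T x) (T y) \<le> sqrt (1 - h\<^sup>2 / L\<^sup>2) * dist x y"
        using contr[of "x - y"] by (simp add: dist_norm)
    qed
  qed
  then obtain w where "T w = w" by blast
  then have "A w = z" using \<tau> by (simp add: T_def)
  then show ?thesis by (auto simp: A_def)
qed

text \<open>If K is the inverse of a generator A, then (K - h)^-1 = A (1 - h A)^-1 is the Yosida
  approximation of A. In this form it is obtained from the bounded operator K alone.\<close>

definition yosida :: "('a::{real_inner,banach} \<Rightarrow> 'a) \<Rightarrow> real \<Rightarrow> 'a \<Rightarrow> 'a" where
  "yosida K h z = (SOME w. K w - h *\<^sub>R w = z)"

section \<open>Yosida approximation for a generator given by its inverse\<close>

locale dissipative =
  fixes K :: "'a::{real_inner,banach} \<Rightarrow> 'a"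
  assumes bounded_linear: "bounded_linear K"
    and dissipative: "K z \<bullet> z \<le> 0"
begin

sublocale K: bounded_linear K by (rule bounded_linear)

lemma yosida_eq: "0 < h \<Longrightarrow> K (yosida K h z) - h *\<^sub>R yosida K h z = z"
  unfolding yosida_def by (rule someI_ex) (rule dissipative_resolvent_exists[OF bounded_linear dissipative])

lemma norm_yosida_le:
  assumes "0 < h" "K w - h *\<^sub>R w = z"
  shows "h * norm w \<le> norm z"
proof -
  have "h * (norm w)\<^sup>2 \<le> - (z \<bullet> w)"
    using dissipative[of w] assms(2) by (auto simp: inner_diff_left dot_square_norm)
  also have "\<dots> \<le> norm z * norm w" using norm_cauchy_schwarz[of "-z" w] by simp
  finally have "h * norm w * norm w \<le> norm z * norm w" by (simp add: power2_eq_square ac_simps)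
  then show ?thesis by (cases "norm w = 0") (auto simp: mult_le_cancel_right)
qed

lemma yosida_unique:
  assumes "0 < h" "K w - h *\<^sub>R w = z"
  shows "w = yosida K h z"
proof -
  have "K (w - yosida K h z) - h *\<^sub>R (w - yosida K h z) = 0"
    using assms yosida_eq[OF \<open>0 < h\<close>, of z] by (simp add: K.diff algebra_simps)
  then have "h * norm (w - yosida K h z) \<le> norm (0::'a)" by (rule norm_yosida_le[OF \<open>0 < h\<close>])
  then show ?thesis using \<open>0 < h\<close> by (simp add: mult_le_0_iff)
qed

lemma bounded_linear_yosida:
  assumes h: "0 < h"
  shows "bounded_linear (yosida K h)"
proof (rule bounded_linear_intro)
  show "yosida K h (x + y) = yosida K h x + yosida K h y" for x y
    using yosida_eq[OF h, of x] yosida_eq[OF h, of y]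
    by (intro yosida_unique[OF h, symmetric]) (simp add: K.add algebra_simps)
  show "yosida K h (r *\<^sub>R x) = r *\<^sub>R yosida K h x" for r x
    by (intro yosida_unique[OF h, symmetric], subst (3) yosida_eq[OF h, of x, symmetric])
      (simp add: K.scaleR algebra_simps)
  show "norm (yosida K h x) \<le> norm x * (1 / h)" for x
    using norm_yosida_le[OF h yosida_eq[OF h, of x]] h by (simp add: field_simps)
qed


lemma yosida_dissipative:
  assumes "0 < h"
  shows "z \<bullet> yosida K h z \<le> 0"
proof -
  let ?w = "yosida K h z"
  have "z \<bullet> ?w = K ?w \<bullet> ?w - h * (norm ?w)\<^sup>2"
    by (subst yosida_eq[OF assms, of z, symmetric]) (simp add: inner_diff_left dot_square_norm)
  then show ?thesis using dissipative[of ?w] assms by (smt (verit) mult_nonneg_nonneg zero_le_power2)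
qed

text \<open>For x = \<open>K \<xi>\<close> in the domain of the generator A this is the bound |A_h
  x| \<le> |A x|, uniform in h. Dissipativity is tested at w - \<xi>, where K (w - \<xi>) = h
  w.\<close>

lemma norm_yosida_range:
  assumes "0 < h"
  shows "norm (yosida K h (K \<xi>)) \<le> norm \<xi>"
proof -
  let ?w = "yosida K h (K \<xi>)"
  have "K (?w - \<xi>) = h *\<^sub>R ?w" using yosida_eq[OF assms, of "K \<xi>"] by (simp add: K.diff algebra_simps)
  then have "h * (?w \<bullet> (?w - \<xi>)) \<le> 0" using dissipative[of "?w - \<xi>"] by simp
  then have "(norm ?w)\<^sup>2 \<le> ?w \<bullet> \<xi>"
    using assms by (simp add: mult_le_0_iff inner_diff_right dot_square_norm)
  also have "\<dots> \<le> norm ?w * norm \<xi>" by (rule norm_cauchy_schwarz)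
  finally have "norm ?w * norm ?w \<le> norm ?w * norm \<xi>" by (simp add: power2_eq_square)
  then show ?thesis by (cases "norm ?w = 0") (auto simp: mult_le_cancel_left)
qed

text \<open>With A the inverse of K, the curve \<open>K (y t)\<close> is a classical solution of x'
  = A x and \<open>y\<close> is its derivative. The Yosida solutions start at
  \<open>K \<xi>\<close>, in the domain of A, so that their own derivatives are bounded uniformly in
  h; the solution itself therefore starts at K (K \<xi>).\<close>

theorem abstract_cauchy_problem:
  "\<exists>y. y 0 = K \<xi> \<and> continuous_on {0..} y \<and>
     (\<forall>t\<ge>0. ((\<lambda>t. K (y t)) has_vector_derivative y t) (at t within {0..}))"
proof -
  define h where "h n = inverse (real (Suc n))" for n
  have h: "0 < h n" for n by (simp add: h_def)
  have h0: "h \<longlonglongrightarrow> 0" unfolding h_def by (rule LIMSEQ_inverse_real_of_nat)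
  have "\<exists>y. y 0 = K \<xi> \<and> (\<forall>t\<ge>0. (y has_vector_derivative yosida K (h n) (y t)) (at t within {0..}))" for n
    by (rule bounded_linear_ode_exists[OF bounded_linear_yosida[OF h]])
  then obtain y where y0: "\<And>n. y n 0 = K \<xi>"
    and y: "\<And>n t. 0 \<le> t \<Longrightarrow> (y n has_vector_derivative yosida K (h n) (y n t)) (at t within {0..})"
    by metis
  define w where "w n t = yosida K (h n) (y n t)" for n t
  have yw: "y n t = K (w n t) - h n *\<^sub>R w n t" for n t
    by (simp add: w_def yosida_eq[OF h])
  \<comment> \<open>\<open>w n\<close> is the derivative of \<open>y n\<close> and solves the same
    linear equation, so its norm never exceeds the initial one.\<close>
  have w: "norm (w n t) \<le> norm \<xi>" if "0 \<le> t" for n t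
  proof -
    have "(norm (w n t))\<^sup>2 \<le> (norm (w n 0))\<^sup>2 + 2 * 0 * t"
    proof (rule norm_power2_growth)
      show "(w n has_vector_derivative yosida K (h n) (w n s)) (at s within {0..})" if "0 \<le> s" for s
        unfolding w_def
        by (intro bounded_linear.has_vector_derivative[OF bounded_linear_yosida[OF h]] y that)
    qed (use that in \<open>auto simp: yosida_dissipative[OF h]\<close>)
    then have "norm (w n t) \<le> norm (w n 0)" by simp
    also have "\<dots> \<le> norm \<xi>" by (simp add: w_def y0 norm_yosida_range[OF h])
    finally show ?thesis .
  qed
  define b where "b T n = sqrt (4 * norm \<xi> * norm \<xi> * T * h n)" for T n
  have dist: "dist (y n t) (y m t) \<le> b T n + b T m" if "t \<in> {0..T}" for n m t T
  proof -
    \<comment> \<open>Insert y = K w - h w into the inner product: the part with K is nonpositive,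
      and the rest is at most this constant, which vanishes with \<open>h n\<close> and
      \<open>h m\<close>.\<close>
    define c where "c = (h n * norm \<xi> + h m * norm \<xi>) * (norm \<xi> + norm \<xi>)"
    have t: "0 \<le> t" "t \<le> T" using that by auto
    have "(norm (y n t - y m t))\<^sup>2 \<le> (norm (y n 0 - y m 0))\<^sup>2 + 2 * c * t"
    proof (rule norm_power2_growth)
      show "((\<lambda>t. y n t - y m t) has_vector_derivative (w n s - w m s)) (at s within {0..})" if "0 \<le> s" for s
        unfolding w_def by (intro has_vector_derivative_diff y that)
      show "(y n s - y m s) \<bullet> (w n s - w m s) \<le> c" if "0 \<le> s" for s
      proof -
        have "(y n s - y m s) \<bullet> (w n s - w m s) = K (w n s - w m s) \<bullet> (w n s - w m s)
            + - (h n *\<^sub>R w n s - h m *\<^sub>R w m s) \<bullet> (w n s - w m s)"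
          by (simp add: yw[of n s] yw[of m s] K.diff algebra_simps)
        also have "\<dots> \<le> 0 + norm (h n *\<^sub>R w n s - h m *\<^sub>R w m s) * norm (w n s - w m s)"
          by (intro add_mono dissipative) (metis norm_cauchy_schwarz norm_minus_cancel)
        also have "\<dots> \<le> 0 + (norm (h n *\<^sub>R w n s) + norm (h m *\<^sub>R w m s)) * (norm (w n s) + norm (w m s))"
          by (intro add_mono mult_mono norm_triangle_ineq4) auto
        also have "\<dots> \<le> 0 + (h n * norm \<xi> + h m * norm \<xi>) * (norm \<xi> + norm \<xi>)"
          using w[OF that] h[of n] h[of m]
          by (intro add_mono mult_mono) (auto intro!: mult_left_mono add_nonneg_nonneg)
        finally show ?thesis by (simp add: c_def)
      qed
    qed (use t in auto)
    also have "\<dots> \<le> 2 * c * T"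
      using t h[of n] h[of m] by (auto simp: y0 c_def intro!: mult_left_mono)
    finally have "norm (y n t - y m t) \<le> sqrt (2 * c * T)"
      by (rule real_le_rsqrt)
    also have "2 * c * T = 4 * norm \<xi> * norm \<xi> * T * h n + 4 * norm \<xi> * norm \<xi> * T * h m"
      by (simp add: c_def algebra_simps)
    also have "sqrt \<dots> \<le> b T n + b T m"
      unfolding b_def using t h[of n] h[of m] by (intro sqrt_add_le_add_sqrt) auto
    finally show ?thesis by (simp add: dist_norm)
  qed
  have b0: "b T \<longlonglongrightarrow> 0" for T
  proof -
    have "(\<lambda>n. sqrt (4 * norm \<xi> * norm \<xi> * T * h n)) \<longlonglongrightarrow> sqrt (4 * norm \<xi> * norm \<xi> * T * 0)"
      by (intro tendsto_intros h0)
    then show ?thesis by (simp add: b_def[abs_def])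
  qed
  define z where "z t = lim (\<lambda>n. y n t)" for t
  have unif: "uniform_limit {0..T} y z sequentially" if "0 < T" for T
  proof -
    obtain l where l: "uniform_limit {0..T} y l sequentially"
      using uniform_limit_if_Cauchy_bound[where S="{0..T}" and f=y and b="b T"] dist b0 by meson
    have "l t = z t" if "t \<in> {0..T}" for t
      using tendsto_uniform_limitI[OF l that] by (simp add: z_def limI)
    then show ?thesis using l by (subst uniform_limit_cong'[of _ _ _ z l]) auto
  qed
  have lim: "(\<lambda>n. y n t) \<longlonglongrightarrow> z t" if "0 \<le> t" for t
    by (rule tendsto_uniform_limitI[OF unif[of "t + 1"]]) (use that in auto)
  have hy: "(\<lambda>n. h n *\<^sub>R y n t) \<longlonglongrightarrow> 0 *\<^sub>R z t" if "0 \<le> t" for t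
    by (intro tendsto_scaleR h0 lim that)
  \<comment> \<open>The correction with \<open>h n\<close> makes the identity exact, since K w - h w
    = y; it disappears in the limit.\<close>
  have der: "((\<lambda>t. K (y n t) - h n *\<^sub>R y n t) has_vector_derivative y n t) (at t within {0..})"
    if "0 \<le> t" for n t
  proof -
    have "((\<lambda>t. K (y n t) - h n *\<^sub>R y n t) has_vector_derivative (K (w n t) - h n *\<^sub>R w n t)) (at t within {0..})"
      unfolding w_def
      by (intro has_vector_derivative_diff K.has_vector_derivative y that
          bounded_linear.has_vector_derivative[OF bounded_linear_scaleR_right])
    then show ?thesis by (simp add: yw)
  qed
  have cont: "continuous_on {0..} (y n)" for n
    using y by (auto simp: continuous_on_eq_continuous_within intro: has_vector_derivative_continuous)
  have limK: "(\<lambda>n. K (y n t) - h n *\<^sub>R y n t) \<longlonglongrightarrow> K (z t)" if "0 \<le> t" for t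
    using tendsto_diff[OF K.tendsto[OF lim[OF that]] hy[OF that]] by simp
  have "continuous_on {0..} z" "0 \<le> t \<Longrightarrow> ((\<lambda>t. K (z t)) has_vector_derivative z t) (at t within {0..})" for t
    using uniform_limit_has_vector_derivative[OF der cont unif limK] by auto
  moreover have "z 0 = K \<xi>" using lim[of 0] by (simp add: y0 LIMSEQ_const_iff)
  ultimately show ?thesis by blast
qed

text \<open>The residuals e = K w - x of the regularized equations K w - w / r = x have decreasing
  norms and form a Cauchy sequence, by monotonicity. Since K e = (e + x) / r, their limit lies in
  the kernel of K and is therefore 0.\<close>

lemma dense_range:
  assumes inj: "\<And>z. K z = 0 \<Longrightarrow> z = 0"
  shows "\<exists>w. (\<lambda>n. K (w n)) \<longlonglongrightarrow> x"
proof -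
  define r where "r n = real (Suc n)" for n
  define w where "w n = yosida K (1 / r n) x" for n
  define e where "e n = K (w n) - x" for n
  have r: "0 < r n" for n by (simp add: r_def)
  have w: "w n = r n *\<^sub>R e n" for n
  proof -
    have "e n = (1 / r n) *\<^sub>R w n"
      using yosida_eq[of "1 / r n" x] r[of n] by (simp add: e_def w_def algebra_simps)
    then show ?thesis using r[of n] by simp
  qed
  have diff: "(norm (e n - e m))\<^sup>2 \<le> (norm (e m))\<^sup>2 - (norm (e n))\<^sup>2" if "m \<le> n" for m n
  proof -
    have rr: "r m \<le> r n" using that by (simp add: r_def)
    have "K (w n - w m) = e n - e m" by (simp add: e_def K.diff)
    then have "(e n - e m) \<bullet> (r n *\<^sub>R e n - r m *\<^sub>R e m) \<le> 0"
      using dissipative[of "w n - w m"] by (simp add: w)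
    \<comment> \<open>The identity 2 (a - b) \<bullet> (r a - s b) = (r + s) |a - b|^2 + (r - s)
      (|a|^2 - |b|^2) delivers both the decrease of the norms and the Cauchy estimate.\<close>
    moreover have "2 * ((e n - e m) \<bullet> (r n *\<^sub>R e n - r m *\<^sub>R e m)) =
        (r n + r m) * (norm (e n - e m))\<^sup>2 + (r n - r m) * ((norm (e n))\<^sup>2 - (norm (e m))\<^sup>2)"
      unfolding power2_norm_eq_inner
      by (simp add: inner_diff_left inner_diff_right inner_commute algebra_simps)
    ultimately have A: "(r n + r m) * (norm (e n - e m))\<^sup>2 \<le> (r n - r m) * ((norm (e m))\<^sup>2 - (norm (e n))\<^sup>2)"
      by (simp add: algebra_simps)
    show ?thesis
    proof (cases "m = n")
      case False
      then have "0 < r n - r m" using that by (simp add: r_def)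
      have "(r n - r m) * (norm (e n - e m))\<^sup>2 \<le> (r n + r m) * (norm (e n - e m))\<^sup>2"
        using r[of m] by (intro mult_right_mono) auto
      with A have "(r n - r m) * (norm (e n - e m))\<^sup>2 \<le> (r n - r m) * ((norm (e m))\<^sup>2 - (norm (e n))\<^sup>2)"
        by linarith
      with \<open>0 < r n - r m\<close> show ?thesis by (simp add: mult_le_cancel_left)
    qed simp
  qed
  have "decseq (\<lambda>n. (norm (e n))\<^sup>2)"
    unfolding decseq_def using diff by (smt (verit) zero_le_power2)
  then have "Cauchy (\<lambda>n. (norm (e n))\<^sup>2)"
    by (intro convergent_Cauchy) (metis convergentI decseq_convergent zero_le_power2)
  have "Cauchy e"
  proof (rule metric_CauchyI)
    fix \<epsilon> :: real assume "0 < \<epsilon>"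
    then obtain M where M: "\<And>m n. m \<ge> M \<Longrightarrow> n \<ge> M \<Longrightarrow> dist ((norm (e m))\<^sup>2) ((norm (e n))\<^sup>2) < \<epsilon>\<^sup>2"
      using \<open>Cauchy (\<lambda>n. (norm (e n))\<^sup>2)\<close> by (metis metric_CauchyD zero_less_power)
    have "dist (e n) (e m) < \<epsilon>" if "m \<ge> M" "n \<ge> m" for m n
    proof -
      have "(norm (e n - e m))\<^sup>2 < \<epsilon>\<^sup>2" using diff[OF that(2)] M[of m n] that by (auto simp: dist_real_def)
      then show ?thesis using \<open>0 < \<epsilon>\<close> by (simp add: dist_norm power_less_imp_less_base)
    qed
    then show "\<exists>M. \<forall>m\<ge>M. \<forall>n\<ge>M. dist (e m) (e n) < \<epsilon>"
      by (metis dist_commute nle_le)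
  qed
  then obtain l where l: "e \<longlonglongrightarrow> l" using convergent_eq_Cauchy by blast
  have "(\<lambda>n. (1 / r n) *\<^sub>R (e n + x)) \<longlonglongrightarrow> 0 *\<^sub>R (l + x)"
    using LIMSEQ_inverse_real_of_nat
    by (intro tendsto_scaleR tendsto_add l tendsto_const) (simp add: r_def divide_inverse)
  moreover have "K (e n) = (1 / r n) *\<^sub>R (e n + x)" for n
  proof -
    have "r n *\<^sub>R K (e n) = e n + x" using w[of n] by (simp add: e_def[of n] flip: K.scaleR)
    then have "(1 / r n) *\<^sub>R (r n *\<^sub>R K (e n)) = (1 / r n) *\<^sub>R (e n + x)" by simp
    then show ?thesis using r[of n] by simp
  qed
  ultimately have "K l = 0" using K.tendsto[OF l] LIMSEQ_unique by fastforce
  then have "l = 0" by (rule inj)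
  then have "(\<lambda>n. K (w n)) \<longlonglongrightarrow> x" using tendsto_add[OF l tendsto_const[of x]] by (simp add: e_def)
  then show ?thesis by blast
qed

end

section \<open>Square-integrable functions\<close>

lemma square_integrable_measurable: "square_integrable S f \<Longrightarrow> f \<in> borel_measurable (lebesgue_on S)"
  by (simp add: square_integrable_def)

lemma square_integrable_bound:
  assumes "g \<in> borel_measurable (lebesgue_on S)" "integrable (lebesgue_on S) b"
    and "\<And>s. s \<in> S \<Longrightarrow> (cmod (g s))\<^sup>2 \<le> b s"
  shows "square_integrable S g"
  unfolding square_integrable_def
proof
  show "integrable (lebesgue_on S) (\<lambda>s. (cmod (g s))\<^sup>2)"
    using assms by (intro Bochner_Integration.integrable_bound[OF assms(2)])
      (auto intro!: AE_I2 order_trans[OF assms(3) abs_ge_self])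
qed fact

lemma norm_add_square_le: "(norm (a + b))\<^sup>2 \<le> 2 * (norm a)\<^sup>2 + 2 * (norm b)\<^sup>2" for a b :: "'a::real_normed_vector"
proof -
  have "(norm (a + b))\<^sup>2 \<le> (norm a + norm b)\<^sup>2" by (intro power_mono norm_triangle_ineq) auto
  also have "\<dots> \<le> 2 * (norm a)\<^sup>2 + 2 * (norm b)\<^sup>2"
    using sum_squares_bound[of "norm a" "norm b"] by (simp add: power2_sum)
  finally show ?thesis .
qed

lemma square_integrable_add:
  assumes "square_integrable S f" "square_integrable S g"
  shows "square_integrable S (\<lambda>s. f s + g s)"
  using assms
  by (intro square_integrable_bound[where b="\<lambda>s. 2 * (cmod (f s))\<^sup>2 + 2 * (cmod (g s))\<^sup>2"] norm_add_square_le)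
    (auto simp: square_integrable_def)

lemma square_integrable_cmult:
  assumes "square_integrable S f"
  shows "square_integrable S (\<lambda>s. c * f s)"
  using assms
  by (intro square_integrable_bound[where b="\<lambda>s. (cmod c)\<^sup>2 * (cmod (f s))\<^sup>2"])
    (auto simp: square_integrable_def norm_mult power_mult_distrib)

lemma square_integrable_uminus: "square_integrable S f \<Longrightarrow> square_integrable S (\<lambda>s. - f s)"
  using square_integrable_cmult[of S f "-1"] by simp

lemma square_integrable_diff:
  "square_integrable S f \<Longrightarrow> square_integrable S g \<Longrightarrow> square_integrable S (\<lambda>s. f s - g s)"
  using square_integrable_add[of S f "\<lambda>s. - g s"] by (simp add: square_integrable_uminus)

lemma square_integrable_zero: "square_integrable S (\<lambda>s. 0)"
  by (simp add: square_integrable_def)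

lemma square_integrable_cong:
  assumes "square_integrable S f" "\<And>s. s \<in> S \<Longrightarrow> f s = g s"
  shows "square_integrable S g"
proof -
  have "g \<in> borel_measurable (lebesgue_on S)"
    using square_integrable_measurable[OF assms(1)] assms(2) by (subst measurable_cong[of _ _ f]) auto
  moreover have "integrable (lebesgue_on S) (\<lambda>s. (cmod (g s))\<^sup>2)"
    using assms by (subst Bochner_Integration.integrable_cong[OF refl, of _ _ "\<lambda>s. (cmod (f s))\<^sup>2"])
      (auto simp: square_integrable_def)
  ultimately show ?thesis by (simp add: square_integrable_def)
qed

lemma square_integrable_mult_cnj:
  assumes "square_integrable S f" "square_integrable S g"
  shows "integrable (lebesgue_on S) (\<lambda>s. f s * cnj (g s))"
proof (rule Bochner_Integration.integrable_bound)
  show "integrable (lebesgue_on S) (\<lambda>s. (cmod (f s))\<^sup>2 + (cmod (g s))\<^sup>2)"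
    using assms by (auto simp: square_integrable_def)
  have [measurable]: "f \<in> borel_measurable (lebesgue_on S)" "g \<in> borel_measurable (lebesgue_on S)"
    using assms by (auto simp: square_integrable_def)
  have "cnj \<in> borel_measurable borel"
    by (intro borel_measurable_continuous_onI continuous_intros)
  then show "(\<lambda>s. f s * cnj (g s)) \<in> borel_measurable (lebesgue_on S)"
    by (intro borel_measurable_times measurable_compose[of g _ borel cnj]) auto
  have "norm (f s * cnj (g s)) \<le> (cmod (f s))\<^sup>2 + (cmod (g s))\<^sup>2" for s
  proof -
    have "2 * cmod (f s) * cmod (g s) \<le> (cmod (f s))\<^sup>2 + (cmod (g s))\<^sup>2" by (rule sum_squares_bound)
    moreover have "0 \<le> cmod (f s) * cmod (g s)" by simp
    ultimately show ?thesis unfolding norm_mult complex_mod_cnj by linarith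
  qed
  then show "AE s in lebesgue_on S. norm (f s * cnj (g s)) \<le> norm ((cmod (f s))\<^sup>2 + (cmod (g s))\<^sup>2)"
    by (intro AE_I2) (simp only: real_norm_def abs_of_nonneg add_nonneg_nonneg zero_le_power2)
qed

lemma finite_measure_Icc: "finite_measure (lebesgue_on {a..b::real})"
  by (rule finite_measure_lebesgue_on) auto

lemma square_integrable_const: "square_integrable {a..b} (\<lambda>s. c)"
  using finite_measure.integrable_const[OF finite_measure_Icc] by (simp add: square_integrable_def)

lemma square_integrable_imp_integrable:
  assumes "square_integrable {a..b} f"
  shows "integrable (lebesgue_on {a..b}) f"
  using square_integrable_mult_cnj[OF assms square_integrable_const[of a b 1]] by simp

lemma square_integrable_continuous:
  assumes "continuous_on {a..b} f"
  shows "square_integrable {a..b} f"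
  unfolding square_integrable_def
proof
  show "f \<in> borel_measurable (lebesgue_on {a..b})"
    using assms by (intro continuous_imp_measurable_on_sets_lebesgue) auto
  show "integrable (lebesgue_on {a..b}) (\<lambda>s. (cmod (f s))\<^sup>2)"
    by (intro continuous_imp_integrable_real continuous_intros assms)
qed

lemma square_integrable_subset:
  assumes "square_integrable T f" "S \<subseteq> T" "S \<in> sets lebesgue" "T \<in> sets lebesgue"
  shows "square_integrable S f"
proof -
  have m: "f \<in> borel_measurable (lebesgue_on S)"
    using square_integrable_measurable[OF assms(1)] assms(2)
    by (rule measurable_restrict_mono)
  have "integrable (lebesgue_on S) (\<lambda>s. (cmod (f s))\<^sup>2)"
    using set_integrable_subset[of lebesgue T "\<lambda>s. (cmod (f s))\<^sup>2" S] assms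
    by (simp add: square_integrable_def integrable_restrict_space set_integrable_def)
  with m show ?thesis by (simp add: square_integrable_def)
qed

lemma integral_mono_set:
  fixes f :: "real \<Rightarrow> real"
  assumes "integrable (lebesgue_on T) f" "S \<subseteq> T" "S \<in> sets lebesgue" "T \<in> sets lebesgue"
    "\<And>s. s \<in> T \<Longrightarrow> 0 \<le> f s"
  shows "integral\<^sup>L (lebesgue_on S) f \<le> integral\<^sup>L (lebesgue_on T) f"
proof -
  have T: "integrable lebesgue (\<lambda>x. indicator T x *\<^sub>R f x)"
    using assms by (simp add: integrable_restrict_space)
  have "set_integrable lebesgue S f"
    using set_integrable_subset[of lebesgue T f S] T assms by (simp add: set_integrable_def)
  then have S: "integrable lebesgue (\<lambda>x. indicator S x *\<^sub>R f x)" by (simp add: set_integrable_def)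
  have "(\<integral>x. indicator S x *\<^sub>R f x \<partial>lebesgue) \<le> (\<integral>x. indicator T x *\<^sub>R f x \<partial>lebesgue)"
    using assms by (intro integral_mono S T) (auto simp: indicator_def)
  then show ?thesis using assms by (simp add: integral_restrict_space)
qed

text \<open>Completeness of L^2 over an arbitrary measure space. It is applied on [0,1], to make
  \<open>l2\<close> a Banach space, and on the half-line, to obtain the closed-loop input.\<close>

lemma riesz_fischer:
  fixes f :: "nat \<Rightarrow> 'a \<Rightarrow> complex"
  assumes [measurable]: "\<And>n. f n \<in> borel_measurable M"
    and int: "\<And>n. integrable M (\<lambda>x. (cmod (f n x))\<^sup>2)"
    and Cauchy: "\<And>e. 0 < e \<Longrightarrow> \<exists>N. \<forall>m\<ge>N. \<forall>n\<ge>N. (\<integral>x. (cmod (f m x - f n x))\<^sup>2 \<partial>M) < e"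
  shows "\<exists>F. F \<in> borel_measurable M \<and> integrable M (\<lambda>x. (cmod (F x))\<^sup>2) \<and>
    (\<lambda>n. \<integral>x. (cmod (f n x - F x))\<^sup>2 \<partial>M) \<longlonglongrightarrow> 0"
proof -
  have int_diff: "integrable M (\<lambda>x. (cmod (f m x - f n x))\<^sup>2)" for m n
  proof (rule Bochner_Integration.integrable_bound)
    show "integrable M (\<lambda>x. 2 * (cmod (f m x))\<^sup>2 + 2 * (cmod (f n x))\<^sup>2)"
      using int by auto
    show "AE x in M. norm ((cmod (f m x - f n x))\<^sup>2) \<le> norm (2 * (cmod (f m x))\<^sup>2 + 2 * (cmod (f n x))\<^sup>2)"
      using norm_add_square_le[of "f m x" "- f n x" for x] by (intro AE_I2) auto
  qed auto
  \<comment> \<open>Along the subsequence the squared distances are below 8^-k. The weight 4^k in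
    \<open>g\<close> leaves integrals of at most 2^-k, hence a sum that is finite almost everywhere,
    and this forces the increments below a multiple of 2^-k.\<close>
  define P where "P k N \<longleftrightarrow> (\<forall>m\<ge>N. \<forall>n\<ge>N. (\<integral>x. (cmod (f m x - f n x))\<^sup>2 \<partial>M) < (1/8)^k)" for k N
  have "\<exists>r. \<forall>k. P k (r k) \<and> r k < r (Suc k)"
  proof (rule dependent_nat_choice)
    show "\<exists>N. P 0 N" unfolding P_def by (rule Cauchy) simp
    show "\<exists>N. P (Suc k) N \<and> N0 < N" for N0 k
    proof -
      obtain N where "P (Suc k) N" using Cauchy[of "(1/8)^Suc k"] by (auto simp: P_def)
      then show ?thesis by (intro exI[of _ "max N (Suc N0)"]) (auto simp: P_def)
    qed
  qed
  then obtain r where r: "\<And>k. P k (r k)" and mono: "strict_mono r"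
    by (auto simp: strict_mono_Suc_iff)
  define g where "g k x = 4 ^ k * (cmod (f (r (Suc k)) x - f (r k) x))\<^sup>2" for k x
  have gm[measurable]: "g k \<in> borel_measurable M" for k unfolding g_def by measurable
  have gi: "(\<integral>\<^sup>+x. ennreal (g k x) \<partial>M) \<le> ennreal ((1/2)^k)" for k
  proof -
    have "(\<integral>x. (cmod (f (r (Suc k)) x - f (r k) x))\<^sup>2 \<partial>M) < (1/8)^k"
      using r[of k] mono by (auto simp: P_def strict_mono_Suc_iff less_imp_le)
    then have "4 ^ k * (\<integral>x. (cmod (f (r (Suc k)) x - f (r k) x))\<^sup>2 \<partial>M) \<le> 4 ^ k * (1/8)^k"
      by (intro mult_left_mono) auto
    also have "\<dots> = (1/2::real)^k" by (simp add: power_mult_distrib[symmetric])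
    finally have "(\<integral>x. g k x \<partial>M) \<le> (1/2)^k" by (simp add: g_def)
    moreover have "(\<integral>\<^sup>+x. ennreal (g k x) \<partial>M) = ennreal (\<integral>x. g k x \<partial>M)"
      unfolding g_def by (intro nn_integral_eq_integral integrable_mult_right int_diff) auto
    ultimately show ?thesis by (simp add: ennreal_leI)
  qed
  have "(\<integral>\<^sup>+x. (\<Sum>k. ennreal (g k x)) \<partial>M) = (\<Sum>k. \<integral>\<^sup>+x. ennreal (g k x) \<partial>M)"
    by (rule nn_integral_suminf) simp
  also have "\<dots> \<le> (\<Sum>k. ennreal ((1/2)^k))" by (intro suminf_le gi) auto
  also have "\<dots> = ennreal (\<Sum>k. (1/2)^k)"
    by (intro suminf_ennreal2 summable_geometric) auto
  finally have "(\<integral>\<^sup>+x. (\<Sum>k. ennreal (g k x)) \<partial>M) \<noteq> \<infinity>"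
    by (auto simp: top_unique)
  then have "AE x in M. (\<Sum>k. ennreal (g k x)) \<noteq> \<infinity>"
    by (intro nn_integral_noteq_infinite) auto
  then have conv: "AE x in M. (\<lambda>k. f (r k) x) \<longlonglongrightarrow> lim (\<lambda>k. f (r k) x)"
  proof eventually_elim
    case (elim x)
    have "summable (\<lambda>k. g k x)"
      using elim by (intro summable_suminf_not_top) (auto simp: g_def)
    then obtain C where C: "\<And>k. g k x \<le> C"
      by (metis summable_LIMSEQ_zero convergentI convergent_imp_Bseq Bseq_def abs_le_D1 real_norm_def)
    have "norm (f (r (Suc k)) x - f (r k) x) \<le> sqrt C * (1/2)^k" for k
    proof -
      have "(2 ^ k * cmod (f (r (Suc k)) x - f (r k) x))\<^sup>2 \<le> C"
        using C[of k] by (simp add: g_def power_mult_distrib power_mult[symmetric] mult.commute[of k 2])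
          (simp add: power_mult)
      then have "2 ^ k * cmod (f (r (Suc k)) x - f (r k) x) \<le> sqrt C" by (rule real_le_rsqrt)
      then show ?thesis by (simp add: field_simps power_divide)
    qed
    moreover have "summable (\<lambda>k. sqrt C * (1/2::real)^k)"
      by (rule summable_mult[OF summable_geometric]) simp
    ultimately have "summable (\<lambda>k. f (r (Suc k)) x - f (r k) x)"
      by (rule summable_comparison_test'[where N=0, rotated])
    then have "convergent (\<lambda>n. \<Sum>k<n. f (r (Suc k)) x - f (r k) x)"
      by (simp add: summable_iff_convergent)
    then have "convergent (\<lambda>n. f (r n) x - f (r 0) x)"
      using sum_lessThan_telescope[of "\<lambda>k. f (r k) x"] by simp
    then have "convergent (\<lambda>n. f (r n) x)"
      by (simp add: convergent_diff_const_right_iff)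
    then show ?case by (simp add: convergent_LIMSEQ_iff)
  qed
  define F where "F x = lim (\<lambda>k. f (r k) x)" for x
  have [measurable]: "F \<in> borel_measurable M" unfolding F_def by measurable
  \<comment> \<open>Fatou's lemma along the subsequence carries the Cauchy estimate over to
    \<open>F\<close>, for all large n and not only for the members of the subsequence.\<close>
  have fatou: "(\<integral>\<^sup>+x. ennreal ((cmod (f n x - F x))\<^sup>2) \<partial>M) \<le> ennreal ((1/8)^j)" if "n \<ge> r j" for n j
  proof -
    have "(\<integral>\<^sup>+x. ennreal ((cmod (f n x - F x))\<^sup>2) \<partial>M)
        = (\<integral>\<^sup>+x. liminf (\<lambda>k. ennreal ((cmod (f n x - f (r k) x))\<^sup>2)) \<partial>M)"
    proof (rule nn_integral_cong_AE)
      show "AE x in M. ennreal ((cmod (f n x - F x))\<^sup>2) = liminf (\<lambda>k. ennreal ((cmod (f n x - f (r k) x))\<^sup>2))"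
        using conv
      proof eventually_elim
        case (elim x)
        have "(\<lambda>k. ennreal ((cmod (f n x - f (r k) x))\<^sup>2)) \<longlonglongrightarrow> ennreal ((cmod (f n x - F x))\<^sup>2)"
          unfolding F_def by (intro tendsto_ennrealI tendsto_intros elim)
        then show ?case by (intro lim_imp_Liminf[symmetric]) auto
      qed
    qed
    also have "\<dots> \<le> liminf (\<lambda>k. \<integral>\<^sup>+x. ennreal ((cmod (f n x - f (r k) x))\<^sup>2) \<partial>M)"
      by (intro nn_integral_liminf) auto
    also have "\<dots> \<le> ennreal ((1/8)^j)"
    proof (rule Liminf_le)
      have "(\<integral>\<^sup>+x. ennreal ((cmod (f n x - f (r k) x))\<^sup>2) \<partial>M) \<le> ennreal ((1/8)^j)" if "k \<ge> j" for k
      proof -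
        have "r k \<ge> r j" using that mono by (simp add: strict_mono_less_eq)
        then have "(\<integral>x. (cmod (f n x - f (r k) x))\<^sup>2 \<partial>M) < (1/8)^j"
          using r[of j] \<open>n \<ge> r j\<close> by (auto simp: P_def)
        then show ?thesis
          by (subst nn_integral_eq_integral[OF int_diff]) (auto intro: ennreal_leI)
      qed
      then show "\<forall>\<^sub>F k in sequentially. (\<integral>\<^sup>+x. ennreal ((cmod (f n x - f (r k) x))\<^sup>2) \<partial>M) \<le> ennreal ((1/8)^j)"
        by (auto simp: eventually_sequentially)
    qed simp
    finally show ?thesis .
  qed
  have intF: "integrable M (\<lambda>x. (cmod (f n x - F x))\<^sup>2)" if "n \<ge> r 0" for n
    using fatou[OF that] by (intro integrableI_bounded) (auto simp: order_le_less_trans)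
  have "integrable M (\<lambda>x. (cmod (F x))\<^sup>2)"
  proof (rule Bochner_Integration.integrable_bound)
    show "integrable M (\<lambda>x. 2 * (cmod (f (r 0) x))\<^sup>2 + 2 * (cmod (f (r 0) x - F x))\<^sup>2)"
      using int intF by auto
    show "AE x in M. norm ((cmod (F x))\<^sup>2) \<le> norm (2 * (cmod (f (r 0) x))\<^sup>2 + 2 * (cmod (f (r 0) x - F x))\<^sup>2)"
      using norm_add_square_le[of "f (r 0) x" "- (f (r 0) x - F x)" for x]
      by (intro AE_I2) (auto simp: norm_minus_commute)
  qed auto
  moreover have "(\<lambda>n. \<integral>x. (cmod (f n x - F x))\<^sup>2 \<partial>M) \<longlonglongrightarrow> 0"
  proof (rule metric_LIMSEQ_I)
    fix e :: real assume "0 < e"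
    then obtain j where j: "(1/8::real)^j < e" using real_arch_pow_inv[of e "1/8"] by auto
    have "dist (\<integral>x. (cmod (f n x - F x))\<^sup>2 \<partial>M) 0 < e" if "n \<ge> r j" for n
    proof -
      have "n \<ge> r 0" using that mono by (meson le0 order_trans strict_mono_less_eq)
      then have "ennreal (\<integral>x. (cmod (f n x - F x))\<^sup>2 \<partial>M) \<le> ennreal ((1/8)^j)"
        using fatou[OF that] by (subst nn_integral_eq_integral[symmetric]) (auto intro: intF)
      then have "(\<integral>x. (cmod (f n x - F x))\<^sup>2 \<partial>M) \<le> (1/8)^j" by (simp add: ennreal_le_iff)
      then show ?thesis using j by simp
    qed
    then show "\<exists>N. \<forall>n\<ge>N. dist (\<integral>x. (cmod (f n x - F x))\<^sup>2 \<partial>M) 0 < e" by blast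
  qed
  ultimately show ?thesis by (intro exI[of _ F]) auto
qed

section \<open>The Hilbert space of square-integrable functions on the unit interval\<close>

lemma integral_eq_HK:
  assumes "square_integrable {0..1} f" "\<zeta> \<in> {0..1}"
  shows "(LINT s|lebesgue_on {0..\<zeta>}. f s) = integral {0..\<zeta>} f"
  by (intro lebesgue_integral_eq_integral square_integrable_imp_integrable square_integrable_subset[OF assms(1)])
    (use assms in auto)

text \<open>The positive and the negative part of the function give the same mass to every
  half-line, so as densities they define the same finite measure and agree almost everywhere; both
  are then 0. This is the source of the uniqueness of weak derivatives.\<close>

lemma AE_zero_if_integrals_zero_real:
  fixes f :: "real \<Rightarrow> real"
  assumes f: "integrable (lebesgue_on {0..1}) f"
    and zero: "\<And>\<zeta>. \<zeta> \<in> {0..1} \<Longrightarrow> (LINT s|lebesgue_on {0..\<zeta>}. f s) = 0"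
  shows "AE x in lebesgue_on {0..1}. f x = 0"
proof -
  define F where "F x = indicator {0..1} x * f x" for x
  have F: "integrable lebesgue F"
    using f by (simp add: integrable_restrict_space F_def[abs_def])
  \<comment> \<open>A Borel representative, because the comparison of measures through half-lines
    takes place on the Borel sets.\<close>
  then obtain g where [measurable]: "g \<in> borel_measurable lborel" and Fg: "AE x in lborel. F x = g x"
    using completion_ex_borel_measurable_real[of F lborel] by auto
  have Fg': "AE x in lebesgue. F x = g x" using Fg by (rule AE_completion)
  have "g \<in> borel_measurable lebesgue" by (rule measurable_completion) simp
  then have "integrable lebesgue g"
    using F Fg' integrable_cong_AE[of F lebesgue g] by auto
  then have g: "integrable lborel g" by (simp add: integrable_completion)
  have Fi: "(\<integral>y. indicator {0..\<zeta>} y * f y \<partial>lebesgue) = 0" "integrable lebesgue (\<lambda>y. indicator {0..\<zeta>} y * f y)"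
    if "\<zeta> \<in> {0..1}" for \<zeta>
  proof -
    show "(\<integral>y. indicator {0..\<zeta>} y * f y \<partial>lebesgue) = 0"
      using zero[OF that] by (simp add: integral_restrict_space)
    have "integrable lebesgue (\<lambda>y. indicator {0..\<zeta>} y * F y)"
      using integrable_mult_indicator[OF _ F, of "{0..\<zeta>}"] by simp
    also have "(\<lambda>y. indicator {0..\<zeta>} y * F y) = (\<lambda>y. indicator {0..\<zeta>} y * f y)"
      using that by (auto simp: F_def indicator_def fun_eq_iff)
    finally show "integrable lebesgue (\<lambda>y. indicator {0..\<zeta>} y * f y)" .
  qed
  have tail: "(\<integral>y. indicator {x<..} y * g y \<partial>lborel) = 0" for x
  proof -
    have "(\<integral>y. indicator {x<..} y * g y \<partial>lborel) = (\<integral>y. indicator {x<..} y * g y \<partial>lebesgue)"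
      by (subst integral_completion) auto
    also have "\<dots> = (\<integral>y. indicator {x<..} y * F y \<partial>lebesgue)"
    proof (rule integral_cong_AE)
      show "(\<lambda>y. indicator {x<..} y * g y) \<in> borel_measurable lebesgue"
        by (rule measurable_completion) simp
      show "(\<lambda>y. indicator {x<..} y * F y) \<in> borel_measurable lebesgue"
        using integrable_mult_indicator[OF _ F, of "{x<..}"] by auto
      show "AE y in lebesgue. indicator {x<..} y * g y = indicator {x<..} y * F y"
        using Fg' by eventually_elim simp
    qed
    also have "\<dots> = 0"
    proof -
      consider "x < 0" | "x \<in> {0..1}" | "1 < x" by fastforce
      then show ?thesis
      proof cases
        case 1
        then have "(\<lambda>y. indicator {x<..} y * F y) = (\<lambda>y. indicator {0..1} y * f y)"
          by (auto simp: F_def indicator_def fun_eq_iff)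
        then show ?thesis using Fi[of 1] by simp
      next
        case 2
        then have "(\<lambda>y. indicator {x<..} y * F y) = (\<lambda>y. indicator {0..1} y * f y - indicator {0..x} y * f y)"
          by (auto simp: F_def indicator_def fun_eq_iff)
        then show ?thesis using Fi[of 1] Fi[OF 2] by simp
      next
        case 3
        then have "(\<lambda>y. indicator {x<..} y * F y) = (\<lambda>y. 0)"
          by (auto simp: F_def indicator_def fun_eq_iff)
        then show ?thesis by simp
      qed
    qed
    finally show ?thesis .
  qed
  have fin: "(\<integral>\<^sup>+y. ennreal (g y) \<partial>lborel) \<noteq> \<infinity>" "(\<integral>\<^sup>+y. ennreal (- g y) \<partial>lborel) \<noteq> \<infinity>"
    using g by (auto simp: real_integrable_def)
  \<comment> \<open>\<open>ennreal\<close> truncates negative numbers to 0, so these densities are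
    the positive and the negative part of \<open>g\<close>.\<close>
  have eq: "emeasure (density lborel (\<lambda>y. ennreal (g y))) {x<..} = emeasure (density lborel (\<lambda>y. ennreal (- g y))) {x<..}" for x
  proof -
    define h where "h y = indicator {x<..} y * g y" for y
    have h: "integrable lborel h"
      unfolding h_def using integrable_mult_indicator[OF _ g, of "{x<..}"] by simp
    have "emeasure (density lborel (\<lambda>y. ennreal (g y))) {x<..} = (\<integral>\<^sup>+y. ennreal (h y) \<partial>lborel)"
      by (subst emeasure_density) (auto simp: h_def indicator_def intro!: nn_integral_cong)
    moreover have "emeasure (density lborel (\<lambda>y. ennreal (- g y))) {x<..} = (\<integral>\<^sup>+y. ennreal (- h y) \<partial>lborel)"
      by (subst emeasure_density) (auto simp: h_def indicator_def intro!: nn_integral_cong)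
    moreover have "enn2real (\<integral>\<^sup>+y. ennreal (h y) \<partial>lborel) = enn2real (\<integral>\<^sup>+y. ennreal (- h y) \<partial>lborel)"
      using tail[of x, folded h_def] real_lebesgue_integral_def[OF h] by simp
    moreover have "(\<integral>\<^sup>+y. ennreal (h y) \<partial>lborel) \<noteq> \<infinity>" "(\<integral>\<^sup>+y. ennreal (- h y) \<partial>lborel) \<noteq> \<infinity>"
      using h by (auto simp: real_integrable_def)
    ultimately show ?thesis by (metis ennreal_enn2real infinity_ennreal_def top.not_eq_extremum)
  qed
  have "density lborel (\<lambda>y. ennreal (g y)) = density lborel (\<lambda>y. ennreal (- g y))"
  proof (rule measure_eqI_lessThan)
    show "emeasure (density lborel (\<lambda>y. ennreal (g y))) {x<..} < \<infinity>" for x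
    proof -
      have "emeasure (density lborel (\<lambda>y. ennreal (g y))) {x<..} \<le> (\<integral>\<^sup>+y. ennreal (g y) \<partial>lborel)"
        by (subst emeasure_density) (auto intro!: nn_integral_mono simp: indicator_def)
      then show ?thesis using fin(1) by (simp add: order_le_less_trans top.not_eq_extremum)
    qed
  qed (auto simp: eq)
  then have "AE y in lborel. ennreal (g y) = ennreal (- g y)"
    using fin by (subst (asm) finite_density_unique) auto
  then have "AE y in lborel. g y = 0"
  proof eventually_elim
    case (elim y)
    then show ?case by (cases "g y" "0::real" rule: linorder_cases) (auto simp: ennreal_neg ennreal_eq_0_iff)
  qed
  with Fg have "AE y in lborel. F y = 0" by eventually_elim simp
  then have "AE y in lebesgue. F y = 0" by (rule AE_completion)
  then have "AE y in lebesgue. y \<in> {0..1} \<longrightarrow> f y = 0"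
    by eventually_elim (auto simp: F_def)
  then show ?thesis by (simp add: AE_restrict_space_iff)
qed

lemma AE_zero_if_integrals_zero:
  assumes f: "square_integrable {0..1} f"
    and zero: "\<And>\<zeta>. \<zeta> \<in> {0..1} \<Longrightarrow> integral {0..\<zeta>} f = 0"
  shows "AE x in lebesgue_on {0..1}. f x = 0"
proof -
  have fi: "integrable (lebesgue_on {0..\<zeta>}) f" if "\<zeta> \<in> {0..1}" for \<zeta>
    using that by (intro square_integrable_imp_integrable square_integrable_subset[OF f]) auto
  have z: "(LINT s|lebesgue_on {0..\<zeta>}. f s) = 0" if "\<zeta> \<in> {0..1}" for \<zeta>
    using zero[OF that] integral_eq_HK[OF f that] by simp
  have "AE x in lebesgue_on {0..1}. Re (f x) = 0"
    using fi z by (intro AE_zero_if_integrals_zero_real) auto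
  moreover have "AE x in lebesgue_on {0..1}. Im (f x) = 0"
    using fi z by (intro AE_zero_if_integrals_zero_real) auto
  ultimately show ?thesis by eventually_elim (simp add: complex_eq_iff)
qed

text \<open>A partial equivalence, reflexive only on square-integrable functions, so that the
  quotient consists of their classes alone.\<close>

definition l2rel :: "(real \<Rightarrow> complex) \<Rightarrow> (real \<Rightarrow> complex) \<Rightarrow> bool" where
  "l2rel f g \<longleftrightarrow> square_integrable {0..1} f \<and> square_integrable {0..1} g \<and>
     (AE x in lebesgue_on {0..1}. f x = g x)"

lemma l2rel_refl: "l2rel f f \<longleftrightarrow> square_integrable {0..1} f"
  by (simp add: l2rel_def)

quotient_type l2 = "real \<Rightarrow> complex" / partial: l2rel
proof (rule part_equivpI)
  show "\<exists>f. l2rel f f" using square_integrable_zero by (auto simp: l2rel_refl)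
  show "symp l2rel" by (rule sympI) (auto simp: l2rel_def)
  show "transp l2rel" by (rule transpI) (auto simp: l2rel_def)
qed

lemma inner_integral_cong:
  assumes "l2rel f f'" "l2rel g g'"
  shows "(LINT x|lebesgue_on {0..1}. f x * cnj (g x)) = (LINT x|lebesgue_on {0..1}. f' x * cnj (g' x))"
proof (rule integral_cong_AE)
  have ae: "AE x in lebesgue_on {0..1}. f x = f' x" "AE x in lebesgue_on {0..1}. g x = g' x"
    using assms by (auto simp: l2rel_def)
  then show "AE x in lebesgue_on {0..1}. f x * cnj (g x) = f' x * cnj (g' x)"
    by eventually_elim simp
qed (use assms in \<open>auto simp: l2rel_def intro!: borel_measurable_integrable square_integrable_mult_cnj\<close>)

text \<open>The real part of the complex pairing induces the usual norm and gives access to the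
  calculus of real inner product spaces; complex numbers remain visible only in constants and
  boundary values.\<close>

instantiation l2 :: real_inner
begin

lift_definition zero_l2 :: l2 is "\<lambda>x. 0"
  by (simp add: l2rel_refl square_integrable_zero)

lift_definition plus_l2 :: "l2 \<Rightarrow> l2 \<Rightarrow> l2" is "\<lambda>f g x. f x + g x"
  by (auto simp: l2rel_def square_integrable_add)

lift_definition uminus_l2 :: "l2 \<Rightarrow> l2" is "\<lambda>f x. - f x"
  by (auto simp: l2rel_def square_integrable_uminus)

lift_definition minus_l2 :: "l2 \<Rightarrow> l2 \<Rightarrow> l2" is "\<lambda>f g x. f x - g x"
  by (auto simp: l2rel_def square_integrable_diff)

lift_definition scaleR_l2 :: "real \<Rightarrow> l2 \<Rightarrow> l2" is "\<lambda>c f x. of_real c * f x"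
  by (auto simp: l2rel_def square_integrable_cmult)

lift_definition inner_l2 :: "l2 \<Rightarrow> l2 \<Rightarrow> real" is "\<lambda>f g. Re (LINT x|lebesgue_on {0..1}. f x * cnj (g x))"
  using inner_integral_cong by metis

definition norm_l2 :: "l2 \<Rightarrow> real" where "norm_l2 f = sqrt (f \<bullet> f)"
definition dist_l2 :: "l2 \<Rightarrow> l2 \<Rightarrow> real" where "dist_l2 f g = norm (f - g)"
definition sgn_l2 :: "l2 \<Rightarrow> l2" where "sgn_l2 f = scaleR (inverse (norm f)) f"
definition uniformity_l2 :: "(l2 \<times> l2) filter" where
  "uniformity_l2 = (INF e\<in>{0<..}. principal {(x, y). dist x y < e})"
definition open_l2 :: "l2 set \<Rightarrow> bool" where
  "open_l2 U \<longleftrightarrow> (\<forall>x\<in>U. \<forall>\<^sub>F (x', y) in uniformity. x' = x \<longrightarrow> y \<in> U)"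

lemma integral_square:
  assumes "square_integrable {0..1} f"
  shows "Re (LINT x|lebesgue_on {0..1}. f x * cnj (f x)) = (LINT x|lebesgue_on {0..1}. (cmod (f x))\<^sup>2)"
  by (simp add: complex_mult_cnj cmod_power2 flip: of_real_add of_real_power)

instance
proof
  fix x y z :: l2 and a b :: real
  show "x + y + z = x + (y + z)"
    by transfer (auto simp: l2rel_def algebra_simps intro!: square_integrable_add)
  show "x + y = y + x"
    by transfer (auto simp: l2rel_def algebra_simps intro!: square_integrable_add)
  show "0 + x = x" by transfer (simp add: l2rel_def)
  show "- x + x = 0" by transfer (simp add: l2rel_def square_integrable_zero)
  show "x - y = x + - y"
    by transfer (auto simp: l2rel_def intro!: square_integrable_diff)
  show "a *\<^sub>R (x + y) = a *\<^sub>R x + a *\<^sub>R y"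
    by transfer (auto simp: l2rel_def distrib_left intro!: square_integrable_add square_integrable_cmult)
  show "(a + b) *\<^sub>R x = a *\<^sub>R x + b *\<^sub>R x"
    by transfer (auto simp: l2rel_def distrib_right intro!: square_integrable_add square_integrable_cmult)
  show "a *\<^sub>R b *\<^sub>R x = (a * b) *\<^sub>R x"
    by transfer (auto simp: l2rel_def mult.assoc intro!: square_integrable_cmult)
  show "1 *\<^sub>R x = x" by transfer (simp add: l2rel_def)
  show "dist x y = norm (x - y)" by (rule dist_l2_def)
  show "sgn x = inverse (norm x) *\<^sub>R x" by (rule sgn_l2_def)
  show "uniformity = (INF e\<in>{0<..}. principal {(x, y). dist (x::l2) y < e})" by (rule uniformity_l2_def)
  show "open U \<longleftrightarrow> (\<forall>x\<in>U. \<forall>\<^sub>F (x', y) in uniformity. x' = x \<longrightarrow> y \<in> U)" for U :: "l2 set"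
    by (rule open_l2_def)
  show "x \<bullet> y = y \<bullet> x"
  proof transfer
    fix x y :: "real \<Rightarrow> complex"
    have "(LINT t|lebesgue_on {0..1}. y t * cnj (x t)) = cnj (LINT t|lebesgue_on {0..1}. x t * cnj (y t))"
      by (subst Bochner_Integration.integral_cnj[symmetric]) (simp add: mult.commute)
    then show "Re (LINT t|lebesgue_on {0..1}. x t * cnj (y t)) = Re (LINT t|lebesgue_on {0..1}. y t * cnj (x t))"
      by simp
  qed
  show "(x + y) \<bullet> z = x \<bullet> z + y \<bullet> z"
  proof transfer
    fix x y z assume "l2rel x x" "l2rel y y" "l2rel z z"
    then show "Re (LINT t|lebesgue_on {0..1}. (x t + y t) * cnj (z t)) =
       Re (LINT t|lebesgue_on {0..1}. x t * cnj (z t)) + Re (LINT t|lebesgue_on {0..1}. y t * cnj (z t))"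
      by (simp add: distrib_right l2rel_refl square_integrable_mult_cnj)
  qed
  show "(a *\<^sub>R x) \<bullet> y = a * (x \<bullet> y)"
    by transfer (simp add: mult.assoc)
  show "0 \<le> x \<bullet> x"
    by transfer (simp add: l2rel_refl integral_square)
  show "x \<bullet> x = 0 \<longleftrightarrow> x = 0"
  proof transfer
    fix f assume "l2rel f f"
    then have f: "square_integrable {0..1} f" by (simp add: l2rel_refl)
    then have "(LINT x|lebesgue_on {0..1}. (cmod (f x))\<^sup>2) = 0 \<longleftrightarrow> (AE x in lebesgue_on {0..1}. (cmod (f x))\<^sup>2 = 0)"
      by (intro integral_nonneg_eq_0_iff_AE) (auto simp: square_integrable_def)
    then show "Re (LINT x|lebesgue_on {0..1}. f x * cnj (f x)) = 0 \<longleftrightarrow> l2rel f (\<lambda>x. 0)"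
      using f by (simp add: l2rel_def integral_square square_integrable_zero)
  qed
  show "norm x = sqrt (x \<bullet> x)" by (rule norm_l2_def)
qed

end

lemma abs_l2_eq_iff:
  assumes "square_integrable {0..1} f" "square_integrable {0..1} g"
  shows "abs_l2 f = abs_l2 g \<longleftrightarrow> (AE x in lebesgue_on {0..1}. f x = g x)"
  using Quotient3_rel[OF Quotient3_l2, of f g] assms by (simp add: l2rel_def)

lemma abs_l2_cong:
  assumes "square_integrable {0..1} f" "\<And>x. x \<in> {0..1} \<Longrightarrow> f x = g x"
  shows "abs_l2 f = abs_l2 g"
  using assms square_integrable_cong[OF assms] by (subst abs_l2_eq_iff) (auto intro!: AE_I2)

lemma square_integrable_rep_l2: "square_integrable {0..1} (rep_l2 x)"
  using Quotient3_rep_reflp[OF Quotient3_l2, of x] by (simp add: l2rel_refl)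

lemma abs_rep_l2 [simp]: "abs_l2 (rep_l2 x) = x"
  by (rule Quotient3_abs_rep[OF Quotient3_l2])

lemma norm_abs_l2:
  assumes "square_integrable {0..1} f"
  shows "(norm (abs_l2 f))\<^sup>2 = (LINT x|lebesgue_on {0..1}. (cmod (f x))\<^sup>2)"
  using assms by (simp add: power2_norm_eq_inner inner_l2.abs_eq l2rel_refl integral_square)

instance l2 :: banach
proof
  fix X :: "nat \<Rightarrow> l2" assume X: "Cauchy X"
  define f where "f n = rep_l2 (X n)" for n
  have f: "square_integrable {0..1} (f n)" "X n = abs_l2 (f n)" for n
    by (auto simp: f_def square_integrable_rep_l2)
  have diff: "(norm (abs_l2 (f m) - abs_l2 g))\<^sup>2 = (LINT x|lebesgue_on {0..1}. (cmod (f m x - g x))\<^sup>2)"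
    if "square_integrable {0..1} g" for m g
    using f that by (simp add: minus_l2.abs_eq l2rel_refl norm_abs_l2 square_integrable_diff)
  have "\<exists>F. F \<in> borel_measurable (lebesgue_on {0..1}) \<and> integrable (lebesgue_on {0..1}) (\<lambda>x. (cmod (F x))\<^sup>2) \<and>
    (\<lambda>n. LINT x|lebesgue_on {0..1}. (cmod (f n x - F x))\<^sup>2) \<longlonglongrightarrow> 0"
  proof (rule riesz_fischer)
    show "\<exists>N. \<forall>m\<ge>N. \<forall>n\<ge>N. (LINT x|lebesgue_on {0..1}. (cmod (f m x - f n x))\<^sup>2) < e" if "0 < e" for e
    proof -
      obtain N where N: "\<And>m n. m \<ge> N \<Longrightarrow> n \<ge> N \<Longrightarrow> dist (X m) (X n) < sqrt e"
        using metric_CauchyD[OF X, of "sqrt e"] \<open>0 < e\<close> by auto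
      have "(LINT x|lebesgue_on {0..1}. (cmod (f m x - f n x))\<^sup>2) < e" if "m \<ge> N" "n \<ge> N" for m n
      proof -
        have "(norm (X m - X n))\<^sup>2 < (sqrt e)\<^sup>2"
          using N[OF that] by (intro power_strict_mono) (auto simp: dist_norm)
        then show ?thesis using \<open>0 < e\<close> f diff by simp
      qed
      then show ?thesis by blast
    qed
  qed (use f in \<open>auto simp: square_integrable_def\<close>)
  then obtain F where F: "square_integrable {0..1} F"
    "(\<lambda>n. LINT x|lebesgue_on {0..1}. (cmod (f n x - F x))\<^sup>2) \<longlonglongrightarrow> 0"
    by (auto simp: square_integrable_def)
  have "(\<lambda>n. sqrt ((norm (X n - abs_l2 F))\<^sup>2)) \<longlonglongrightarrow> sqrt 0"
    using F f diff by (intro tendsto_real_sqrt) simp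
  then have "X \<longlonglongrightarrow> abs_l2 F" by (simp add: tendsto_norm_zero_iff LIM_zero_iff)
  then show "convergent X" by (rule convergentI)
qed

section \<open>The Volterra operator\<close>

lemma square_integrable_integrable_on:
  assumes "square_integrable {0..1} f" "{a..b} \<subseteq> {0..1}"
  shows "f integrable_on {a..b}"
proof -
  have "integrable (lebesgue_on {a..b}) f"
    by (rule square_integrable_imp_integrable) (use square_integrable_subset[OF assms(1)] assms(2) in auto)
  then show ?thesis by (intro integrable_on_lebesgue_on) auto
qed

lemma continuous_on_indefinite_integral:
  assumes "square_integrable {0..1} f"
  shows "continuous_on {0..1} (\<lambda>\<zeta>. integral {0..\<zeta>} f)"
  by (intro indefinite_integral_continuous_1 square_integrable_integrable_on[OF assms]) auto

lemma square_integrable_indefinite_integral: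
  "square_integrable {0..1} f \<Longrightarrow> square_integrable {0..1} (\<lambda>\<zeta>. integral {0..\<zeta>} f)"
  by (rule square_integrable_continuous[OF continuous_on_indefinite_integral])

lemma continuous_AE_zero:
  fixes h :: "real \<Rightarrow> complex"
  assumes "continuous_on {0..1} h" "AE x in lebesgue_on {0..1}. h x = 0" "x \<in> {0..1}"
  shows "h x = 0"
proof -
  have c: "continuous_on {0..1} (\<lambda>x. (cmod (h x))\<^sup>2)" by (intro continuous_intros assms)
  have "(LINT x|lebesgue_on {0..1}. (cmod (h x))\<^sup>2) = 0"
    using assms(2) by (intro integral_eq_zero_AE) auto
  then have "integral {0..1} (\<lambda>x. (cmod (h x))\<^sup>2) = 0"
    using lebesgue_integral_eq_integral[OF continuous_imp_integrable_real[OF c]] by simp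
  then show ?thesis using integral_eq_0_iff[OF c] assms(3) by auto
qed

lemma l2rel_integral_eq:
  assumes "l2rel f g" "\<zeta> \<in> {0..1}"
  shows "integral {0..\<zeta>} f = integral {0..\<zeta>} g"
proof -
  have f: "square_integrable {0..\<zeta>} f" and g: "square_integrable {0..\<zeta>} g"
    using assms by (auto simp: l2rel_def intro: square_integrable_subset)
  have "AE x in lebesgue_on {0..1}. f x = g x" using assms(1) by (simp add: l2rel_def)
  then have "AE x in lebesgue. x \<in> {0..1} \<longrightarrow> f x = g x" by (simp add: AE_restrict_space_iff)
  then have "AE x in lebesgue. x \<in> {0..\<zeta>} \<longrightarrow> f x = g x"
    by eventually_elim (use assms(2) in auto)
  then have "AE x in lebesgue_on {0..\<zeta>}. f x = g x" by (simp add: AE_restrict_space_iff)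
  then have "(LINT s|lebesgue_on {0..\<zeta>}. f s) = (LINT s|lebesgue_on {0..\<zeta>}. g s)"
    using f g by (intro integral_cong_AE) (auto simp: square_integrable_def)
  then show ?thesis using assms by (simp add: integral_eq_HK l2rel_def)
qed

lemma square_integrable_mult_id:
  assumes "square_integrable {0..1} f"
  shows "square_integrable {0..1} (\<lambda>\<zeta>. of_real \<zeta> * f \<zeta>)"
proof (rule square_integrable_bound)
  have [measurable]: "f \<in> borel_measurable (lebesgue_on {0..1})" "(\<lambda>\<zeta>. \<zeta>) \<in> borel_measurable (lebesgue_on {0..1})"
    using assms id_borel_measurable_lebesgue_on by (auto simp: square_integrable_def id_def)
  show "(\<lambda>\<zeta>. complex_of_real \<zeta> * f \<zeta>) \<in> borel_measurable (lebesgue_on {0..1})" by measurable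
  show "integrable (lebesgue_on {0..1}) (\<lambda>\<zeta>. (cmod (f \<zeta>))\<^sup>2)"
    using assms by (simp add: square_integrable_def)
  show "(cmod (complex_of_real \<zeta> * f \<zeta>))\<^sup>2 \<le> (cmod (f \<zeta>))\<^sup>2" if "\<zeta> \<in> {0..1}" for \<zeta>
    using that by (auto simp: norm_mult power_mult_distrib power_le_one mult_left_le_one_le)
qed

text \<open>Fubini on the triangle 0 \<le> s \<le> r \<le> b. With b = 1 it yields the adjoint of
  integration, with g = 1 the integration by parts against the coordinate.\<close>

lemma iterated_integral_swap:
  assumes sf: "square_integrable {0..1} f" and sg: "square_integrable {0..1} g" and b: "b \<in> {0..1}"
  shows "(LINT r|lebesgue_on {0..b}. integral {0..r} f * g r) =
         (LINT s|lebesgue_on {0..b}. f s * (integral {0..b} g - integral {0..s} g))"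
proof -
  define M where "M = lebesgue_on {0..b}"
  interpret M: finite_measure M unfolding M_def by (rule finite_measure_Icc)
  interpret P: pair_sigma_finite M M ..
  have f: "integrable M f" and g: "integrable M g"
    unfolding M_def using b
    by (auto intro!: square_integrable_imp_integrable square_integrable_subset[OF sf] square_integrable_subset[OF sg])
  have [measurable]: "f \<in> borel_measurable M" "g \<in> borel_measurable M" "(\<lambda>x. x) \<in> borel_measurable M"
    using f g id_borel_measurable_lebesgue_on by (auto simp: M_def id_def)
  define ind where "ind s r = (if s \<le> r then 1 else 0 :: complex)" for s r :: real
  have fg: "integrable (M \<Otimes>\<^sub>M M) (\<lambda>(s, r). f s * g r)"
    using f g by (intro P.Fubini_integrable) (auto simp: norm_mult)
  have "integrable (M \<Otimes>\<^sub>M M) (\<lambda>(s, r). f s * g r * ind s r)"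
  proof (rule Bochner_Integration.integrable_bound[OF fg])
    show "(\<lambda>(s, r). f s * g r * ind s r) \<in> borel_measurable (M \<Otimes>\<^sub>M M)"
      unfolding ind_def by measurable
    show "AE p in M \<Otimes>\<^sub>M M. norm (case p of (s, r) \<Rightarrow> f s * g r * ind s r) \<le> norm (case p of (s, r) \<Rightarrow> f s * g r)"
      by (intro AE_I2) (auto simp: ind_def norm_mult)
  qed
  then have swap: "(LINT r|M. LINT s|M. f s * g r * ind s r) = (LINT s|M. LINT r|M. f s * g r * ind s r)"
    by (rule P.Fubini_integral)
  have inner1: "(LINT s|M. f s * g r * ind s r) = integral {0..r} f * g r" if "r \<in> {0..b}" for r
  proof -
    have "(LINT s|M. f s * g r * ind s r) = (LINT s|M. f s * ind s r * g r)"
      by (simp add: mult_ac)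
    also have "\<dots> = (LINT s|M. f s * ind s r) * g r" by simp
    also have "(LINT s|M. f s * ind s r) = (LINT s|lebesgue_on {0..r}. f s)"
      unfolding M_def using that
      by (simp add: integral_restrict_space) (auto intro!: Bochner_Integration.integral_cong simp: ind_def indicator_def)
    also have "\<dots> = integral {0..r} f" using that b by (intro integral_eq_HK sf) auto
    finally show ?thesis .
  qed
  have inner2: "(LINT r|M. f s * g r * ind s r) = f s * (integral {0..b} g - integral {0..s} g)"
    if "s \<in> {0..b}" for s
  proof -
    have "(LINT r|M. f s * g r * ind s r) = f s * (LINT r|M. g r * ind s r)"
      by (simp add: mult.assoc)
    also have "(LINT r|M. g r * ind s r) = (LINT r|lebesgue_on {s..b}. g r)"
      unfolding M_def using that
      by (simp add: integral_restrict_space) (auto intro!: Bochner_Integration.integral_cong simp: ind_def indicator_def)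
    also have "\<dots> = integral {s..b} g"
      using that b by (intro lebesgue_integral_eq_integral square_integrable_imp_integrable square_integrable_subset[OF sg]) auto
    also have "\<dots> = integral {0..b} g - integral {0..s} g"
      using Henstock_Kurzweil_Integration.integral_combine[of 0 s b g] square_integrable_integrable_on[OF sg, of 0 b] that b
      by (auto simp: algebra_simps)
    finally show ?thesis .
  qed
  have "(LINT r|M. integral {0..r} f * g r) = (LINT r|M. LINT s|M. f s * g r * ind s r)"
    by (intro Bochner_Integration.integral_cong refl inner1[symmetric]) (simp add: M_def)
  also note swap
  also have "(LINT s|M. LINT r|M. f s * g r * ind s r)
      = (LINT s|M. f s * (integral {0..b} g - integral {0..s} g))"
    by (intro Bochner_Integration.integral_cong refl inner2) (simp add: M_def)
  finally show ?thesis by (simp only: M_def)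
qed

section \<open>Integration and multiplication by the coordinate as operators\<close>

lift_definition volterra :: "l2 \<Rightarrow> l2" is "\<lambda>f \<zeta>. integral {0..\<zeta>} f"
  using l2rel_integral_eq
  by (auto simp: l2rel_def square_integrable_indefinite_integral intro!: AE_I2)

lift_definition integral_l2 :: "l2 \<Rightarrow> complex" is "\<lambda>f. integral {0..1} f"
  by (rule l2rel_integral_eq) auto

lift_definition const_l2 :: "complex \<Rightarrow> l2" is "\<lambda>c \<zeta>. c"
  by (simp add: l2rel_refl square_integrable_const)

lift_definition mult_id :: "l2 \<Rightarrow> l2" is "\<lambda>f \<zeta>. of_real \<zeta> * f \<zeta>"
  by (auto simp: l2rel_def square_integrable_mult_id)

lemma linear_volterra: "linear volterra"
proof
  show "volterra (f + g) = volterra f + volterra g" for f g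
    by transfer (auto simp: l2rel_def intro!: AE_I2 square_integrable_indefinite_integral square_integrable_add
        Henstock_Kurzweil_Integration.integral_add square_integrable_integrable_on)
  show "volterra (c *\<^sub>R f) = c *\<^sub>R volterra f" for f c
    by transfer (auto simp: l2rel_def intro!: AE_I2 square_integrable_indefinite_integral square_integrable_cmult)
qed

lemma linear_integral_l2: "linear integral_l2"
proof
  show "integral_l2 (f + g) = integral_l2 f + integral_l2 g" for f g
    by transfer (auto simp: l2rel_def
        intro!: Henstock_Kurzweil_Integration.integral_add square_integrable_integrable_on)
  show "integral_l2 (c *\<^sub>R f) = c *\<^sub>R integral_l2 f" for f c
    by transfer (simp add: scaleR_conv_of_real)
qed

lemma linear_const_l2: "linear const_l2"
proof
  show "const_l2 (b + c) = const_l2 b + const_l2 c" for b c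
    by transfer (simp add: l2rel_refl square_integrable_const)
  show "const_l2 (r *\<^sub>R c) = r *\<^sub>R const_l2 c" for r c
    by transfer (simp add: l2rel_refl square_integrable_const scaleR_conv_of_real)
qed

lemma linear_mult_id: "linear mult_id"
proof
  show "mult_id (f + g) = mult_id f + mult_id g" for f g
    by transfer (auto simp: l2rel_def distrib_left intro!: square_integrable_mult_id square_integrable_add)
  show "mult_id (c *\<^sub>R f) = c *\<^sub>R mult_id f" for f c
    by transfer (auto simp: l2rel_def mult.left_commute intro!: square_integrable_mult_id square_integrable_cmult)
qed

lemma integral_l2_const_l2 [simp]: "integral_l2 (const_l2 c) = c"
  by transfer simp

lemma inner_const_l2: "f \<bullet> const_l2 c = Re (integral_l2 f * cnj c)"
proof transfer
  fix f c assume "l2rel f f"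
  then have f: "square_integrable {0..1} f" by (simp add: l2rel_refl)
  have "(LINT x|lebesgue_on {0..1}. f x * cnj c) = (LINT x|lebesgue_on {0..1}. f x) * cnj c" by simp
  also have "(LINT x|lebesgue_on {0..1}. f x) = integral {0..1} f"
    by (rule integral_eq_HK[OF f]) simp
  finally show "Re (LINT x|lebesgue_on {0..1}. f x * cnj c) = Re (integral {0..1} f * cnj c)"
    by (rule arg_cong)
qed

lemma volterra_const_l2: "volterra (const_l2 c) = mult_id (const_l2 c)"
proof transfer
  fix c :: complex
  show "l2rel (\<lambda>\<zeta>. integral {0..\<zeta>} (\<lambda>_. c)) (\<lambda>\<zeta>. of_real \<zeta> * c)"
    unfolding l2rel_def
  proof (intro conjI AE_I2)
    show "square_integrable {0..1} (\<lambda>\<zeta>. integral {0..\<zeta>} (\<lambda>_. c))"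
      by (rule square_integrable_indefinite_integral[OF square_integrable_const])
    show "square_integrable {0..1} (\<lambda>\<zeta>. complex_of_real \<zeta> * c)"
      by (rule square_integrable_mult_id[OF square_integrable_const])
    show "integral {0..\<zeta>} (\<lambda>_. c) = complex_of_real \<zeta> * c" if "\<zeta> \<in> space (lebesgue_on {0..1})" for \<zeta>
      using that by (simp add: scaleR_conv_of_real)
  qed
qed

lemma inner_mult_id: "mult_id f \<bullet> g = f \<bullet> mult_id g"
  by transfer (simp add: mult_ac)

text \<open>By Fubini, the adjoint of integration from 0 to \<zeta> is integration from \<zeta> to
  1, written as total integral minus primitive.\<close>

lemma inner_volterra: "volterra f \<bullet> g = f \<bullet> (const_l2 (integral_l2 g) - volterra g)"
proof transfer
  fix f g assume "l2rel f f" "l2rel g g"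
  then have f: "square_integrable {0..1} f" and g: "square_integrable {0..1} g" by (auto simp: l2rel_refl)
  have cg: "square_integrable {0..1} (\<lambda>x. cnj (g x))"
    using g measurable_compose[of g _ borel cnj] borel_measurable_continuous_onI[of cnj]
    by (auto simp: square_integrable_def intro!: continuous_intros)
  have cnj_int: "cnj (integral {0..\<zeta>} g) = integral {0..\<zeta>} (\<lambda>x. cnj (g x))" for \<zeta>
    by (rule Henstock_Kurzweil_Integration.integral_cnj)
  have "(LINT x|lebesgue_on {0..1}. integral {0..x} f * cnj (g x)) =
    (LINT x|lebesgue_on {0..1}. f x * (integral {0..1} (\<lambda>x. cnj (g x)) - integral {0..x} (\<lambda>x. cnj (g x))))"
    by (rule iterated_integral_swap[OF f cg]) simp
  also have "\<dots> = (LINT x|lebesgue_on {0..1}. f x * cnj (integral {0..1} g - integral {0..x} g))"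
    by (intro Bochner_Integration.integral_cong) (auto simp: cnj_int)
  finally show "Re (LINT x|lebesgue_on {0..1}. integral {0..x} f * cnj (g x)) =
    Re (LINT x|lebesgue_on {0..1}. f x * cnj (integral {0..1} g - integral {0..x} g))" by simp
qed

text \<open>The integrated product rule (\<zeta> F)' = \<zeta> f + F for F the primitive of f. This
  commutation rule is behind all multiplier identities below.\<close>

lemma mult_id_volterra: "mult_id (volterra f) = volterra (mult_id f) + volterra (volterra f)"
proof transfer
  fix f assume "l2rel f f"
  then have f: "square_integrable {0..1} f" by (simp add: l2rel_refl)
  note sq = square_integrable_indefinite_integral square_integrable_mult_id square_integrable_add
  have "of_real \<zeta> * integral {0..\<zeta>} f =
      integral {0..\<zeta>} (\<lambda>s. of_real s * f s) + integral {0..\<zeta>} (\<lambda>s. integral {0..s} f)"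
    if z: "\<zeta> \<in> {0..1}" for \<zeta>
  proof -
    have "integral {0..\<zeta>} (\<lambda>s. integral {0..s} f) = (LINT r|lebesgue_on {0..\<zeta>}. integral {0..r} f * 1)"
      using integral_eq_HK[OF square_integrable_indefinite_integral[OF f] z] by simp
    also have "\<dots> = (LINT s|lebesgue_on {0..\<zeta>}. f s * (integral {0..\<zeta>} (\<lambda>_. 1) - integral {0..s} (\<lambda>_. 1)))"
      by (rule iterated_integral_swap[OF f square_integrable_const z])
    also have "\<dots> = (LINT s|lebesgue_on {0..\<zeta>}. of_real \<zeta> * f s - of_real s * f s)"
      using z by (intro Bochner_Integration.integral_cong) (auto simp: scaleR_conv_of_real algebra_simps)
    also have "\<dots> = (LINT s|lebesgue_on {0..\<zeta>}. of_real \<zeta> * f s) - (LINT s|lebesgue_on {0..\<zeta>}. of_real s * f s)"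
      using z by (intro Bochner_Integration.integral_diff square_integrable_imp_integrable
          square_integrable_subset[OF square_integrable_cmult[OF f]]
          square_integrable_subset[OF square_integrable_mult_id[OF f]]) auto
    finally show ?thesis
      using integral_eq_HK[OF f z] integral_eq_HK[OF square_integrable_mult_id[OF f] z] by simp
  qed
  then show "l2rel (\<lambda>\<zeta>. of_real \<zeta> * integral {0..\<zeta>} f)
     (\<lambda>x. integral {0..x} (\<lambda>\<zeta>. of_real \<zeta> * f \<zeta>) + integral {0..x} (\<lambda>\<zeta>. integral {0..\<zeta>} f))"
    using f by (auto simp: l2rel_def intro!: AE_I2 sq)
qed

lemma volterra_eq_zero:
  assumes "volterra f = 0"
  shows "f = 0"
  using assms
proof transfer
  fix f assume "l2rel f f" and V: "l2rel (\<lambda>\<zeta>. integral {0..\<zeta>} f) (\<lambda>x. 0)"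
  then have f: "square_integrable {0..1} f" by (simp add: l2rel_refl)
  have "integral {0..\<zeta>} f = 0" if "\<zeta> \<in> {0..1}" for \<zeta>
    using V that by (intro continuous_AE_zero[OF continuous_on_indefinite_integral[OF f]]) (auto simp: l2rel_def)
  then show "l2rel f (\<lambda>x. 0)"
    using AE_zero_if_integrals_zero[OF f] f by (simp add: l2rel_def square_integrable_zero)
qed

section \<open>The beam operator and its boundary values\<close>

text \<open>Integration from \<zeta> to 1, the adjoint of \<open>volterra\<close>. It inverts
  -d/d\<zeta> with zero value at the free end 1, as \<open>volterra\<close> inverts d/d\<zeta> with
  zero value at the clamped end 0.\<close>

definition covolterra :: "l2 \<Rightarrow> l2" where
  "covolterra f = const_l2 (integral_l2 f) - volterra f"

lemma inner_volterra_covolterra: "volterra f \<bullet> g = f \<bullet> covolterra g"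
  by (simp add: inner_volterra covolterra_def)

lemma inner_covolterra: "covolterra f \<bullet> g = f \<bullet> volterra g"
  by (metis inner_commute inner_volterra_covolterra)

lemma Re_mult_cnj_self: "Re (z * cnj z) = (cmod z)\<^sup>2"
  unfolding cmod_power2 by (simp add: power2_eq_square)

lemma norm_const_l2 [simp]: "norm (const_l2 c) = cmod c"
proof -
  have "(norm (const_l2 c))\<^sup>2 = (cmod c)\<^sup>2"
    unfolding power2_norm_eq_inner[of "const_l2 c"] inner_const_l2 integral_l2_const_l2 by (rule Re_mult_cnj_self)
  then show ?thesis by simp
qed

lemma norm_integral_l2_le: "cmod (integral_l2 f) \<le> norm f"
proof -
  have "(cmod (integral_l2 f))\<^sup>2 = f \<bullet> const_l2 (integral_l2 f)"
    unfolding inner_const_l2 by (rule Re_mult_cnj_self[symmetric])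
  also have "\<dots> \<le> norm f * cmod (integral_l2 f)"
    using norm_cauchy_schwarz[of f "const_l2 (integral_l2 f)"] by simp
  finally have "cmod (integral_l2 f) * cmod (integral_l2 f) \<le> norm f * cmod (integral_l2 f)"
    by (simp add: power2_eq_square)
  then show ?thesis by (cases "integral_l2 f = 0") (auto simp: mult_le_cancel_right)
qed

lemma norm_mult_id_le: "norm (mult_id f) \<le> norm f"
proof -
  have f: "square_integrable {0..1} (rep_l2 f)" by (rule square_integrable_rep_l2)
  have Zf: "square_integrable {0..1} (\<lambda>\<zeta>. of_real \<zeta> * rep_l2 f \<zeta>)" by (rule square_integrable_mult_id[OF f])
  have "mult_id f = abs_l2 (\<lambda>\<zeta>. of_real \<zeta> * rep_l2 f \<zeta>)"
    using mult_id.abs_eq[of "rep_l2 f"] f by (simp add: l2rel_refl)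
  then have "(norm (mult_id f))\<^sup>2 = (LINT \<zeta>|lebesgue_on {0..1}. (cmod (of_real \<zeta> * rep_l2 f \<zeta>))\<^sup>2)"
    using norm_abs_l2[OF Zf] by simp
  also have "\<dots> \<le> (LINT \<zeta>|lebesgue_on {0..1}. (cmod (rep_l2 f \<zeta>))\<^sup>2)"
  proof (rule integral_mono)
    show "(cmod (complex_of_real \<zeta> * rep_l2 f \<zeta>))\<^sup>2 \<le> (cmod (rep_l2 f \<zeta>))\<^sup>2"
      if "\<zeta> \<in> space (lebesgue_on {0..1})" for \<zeta>
      using that by (auto simp: norm_mult power_mult_distrib power_le_one mult_left_le_one_le)
  qed (use f Zf in \<open>auto simp: square_integrable_def\<close>)
  also have "\<dots> = (norm f)\<^sup>2" using norm_abs_l2[OF f] by simp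
  finally show ?thesis by (rule power2_le_imp_le) simp
qed

lemma Re_mult_cnj_eq_zero:
  assumes "\<And>c. Re (d * cnj c) = 0"
  shows "d = 0"
  using assms[of d] by (simp add: complex_mult_cnj complex_eq_iff sum_power2_eq_zero_iff)

text \<open>The adjoint of integration maps 1 to 1 - \<zeta>. Testing with all constants
  \<open>c\<close> recovers the complex identity from the real inner product.\<close>

lemma integral_l2_volterra: "integral_l2 (volterra f) = integral_l2 f - integral_l2 (mult_id f)"
proof -
  have "Re ((integral_l2 (volterra f) - (integral_l2 f - integral_l2 (mult_id f))) * cnj c) = 0" for c
  proof -
    have "volterra f \<bullet> const_l2 c = f \<bullet> const_l2 c - mult_id f \<bullet> const_l2 c"
      by (simp add: inner_volterra volterra_const_l2 inner_mult_id inner_diff_right)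
    then show ?thesis by (simp add: inner_const_l2 algebra_simps)
  qed
  then have "integral_l2 (volterra f) - (integral_l2 f - integral_l2 (mult_id f)) = 0" by (rule Re_mult_cnj_eq_zero)
  then show ?thesis by simp
qed

text \<open>For F = \<open>volterra f\<close> the left side is the integral of \<zeta> (|F|^2)' over
  [0,1]; integration by parts gives |F(1)|^2 minus the integral of |F|^2, and F(1) is the total
  integral of f.\<close>

lemma volterra_multiplier:
  "2 * (volterra f \<bullet> mult_id f) = (cmod (integral_l2 f))\<^sup>2 - (norm (volterra f))\<^sup>2"
proof -
  have "volterra f \<bullet> mult_id f = volterra (mult_id f) \<bullet> f + volterra (volterra f) \<bullet> f"
    by (simp add: inner_mult_id[symmetric] mult_id_volterra inner_add_left)
  also have "volterra (mult_id f) \<bullet> f = mult_id f \<bullet> const_l2 (integral_l2 f) - mult_id f \<bullet> volterra f"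
    by (simp add: inner_volterra inner_diff_right)
  also have "volterra (volterra f) \<bullet> f = volterra f \<bullet> const_l2 (integral_l2 f) - (norm (volterra f))\<^sup>2"
    by (simp add: inner_volterra inner_diff_right power2_norm_eq_inner)
  finally have "2 * (volterra f \<bullet> mult_id f) = Re ((integral_l2 (mult_id f) + integral_l2 (volterra f)) * cnj (integral_l2 f)) - (norm (volterra f))\<^sup>2"
    by (simp add: inner_const_l2 inner_commute algebra_simps)
  moreover have "integral_l2 (mult_id f) + integral_l2 (volterra f) = integral_l2 f" by (simp add: integral_l2_volterra)
  ultimately show ?thesis by (simp only: Re_mult_cnj_self)
qed

text \<open>The multiplier identity gives |F|^2 \<le> |f|^2 + 2 |F| |f| for F =
  \<open>volterra f\<close>, which is incompatible with |F| > 3 |f|. The constant is crude; it is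
  the 3 of \<open>multiplier_form_bound\<close>.\<close>

lemma norm_volterra_le: "norm (volterra f) \<le> 3 * norm f"
proof (rule ccontr)
  assume "\<not> norm (volterra f) \<le> 3 * norm f"
  then have less: "3 * norm f < norm (volterra f)" by simp
  have "(norm (volterra f))\<^sup>2 = (cmod (integral_l2 f))\<^sup>2 - 2 * (volterra f \<bullet> mult_id f)"
    using volterra_multiplier[of f] by simp
  also have "\<dots> \<le> (norm f)\<^sup>2 + 2 * (norm (volterra f) * norm f)"
  proof -
    have "(cmod (integral_l2 f))\<^sup>2 \<le> (norm f)\<^sup>2" by (intro power_mono norm_integral_l2_le) auto
    moreover have "- (volterra f \<bullet> mult_id f) \<le> norm (volterra f) * norm (mult_id f)"
      using norm_cauchy_schwarz[of "- volterra f" "mult_id f"] by simp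
    moreover have "norm (volterra f) * norm (mult_id f) \<le> norm (volterra f) * norm f"
      by (intro mult_left_mono norm_mult_id_le) auto
    ultimately show ?thesis by linarith
  qed
  also have "\<dots> \<le> norm (volterra f) * norm f + 2 * (norm (volterra f) * norm f)"
  proof -
    have "norm f \<le> norm (volterra f)" using less norm_ge_zero[of f] by linarith
    then show ?thesis by (simp add: power2_eq_square mult_left_mono)
  qed
  also have "\<dots> = norm (volterra f) * (3 * norm f)" by simp
  also have "\<dots> < norm (volterra f) * norm (volterra f)"
    using less by (intro mult_strict_left_mono) (auto intro: le_less_trans[rotated])
  finally show False by (simp add: power2_eq_square)
qed

lemma bounded_linear_volterra: "bounded_linear volterra"
  using linear_volterra norm_volterra_le
  by (auto intro!: bounded_linear_intro[where K=3] simp: linear_add linear_scale mult.commute)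

lemma bounded_linear_integral_l2: "bounded_linear integral_l2"
  using linear_integral_l2 norm_integral_l2_le
  by (auto intro!: bounded_linear_intro[where K=1] simp: linear_add linear_scale)

lemma bounded_linear_mult_id: "bounded_linear mult_id"
  using linear_mult_id norm_mult_id_le
  by (auto intro!: bounded_linear_intro[where K=1] simp: linear_add linear_scale)

lemma bounded_linear_const_l2: "bounded_linear const_l2"
  using linear_const_l2
  by (auto intro!: bounded_linear_intro[where K=1] simp: linear_add linear_scale)

lemma bounded_linear_covolterra: "bounded_linear covolterra"
  unfolding covolterra_def[abs_def]
  by (intro bounded_linear_sub bounded_linear_volterra
      bounded_linear_compose[OF bounded_linear_const_l2 bounded_linear_integral_l2])


lemma volterra_eq_const_l2:
  assumes "volterra f = const_l2 c"
  shows "c = 0"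
  using assms
proof transfer
  fix f c assume "l2rel f f" and eq: "l2rel (\<lambda>\<zeta>. integral {0..\<zeta>} f) (\<lambda>\<zeta>. c)"
  then have "continuous_on {0..1} (\<lambda>\<zeta>. integral {0..\<zeta>} f - c)"
    by (intro continuous_intros continuous_on_indefinite_integral) (simp add: l2rel_refl)
  moreover have "AE \<zeta> in lebesgue_on {0..1}. integral {0..\<zeta>} f - c = 0"
    using eq by (simp add: l2rel_def)
  ultimately have "integral {0..0} f - c = 0" by (rule continuous_AE_zero) simp
  then show "c = 0" by simp
qed

lemma covolterra_eq_zero:
  assumes "covolterra f = 0"
  shows "f = 0"
proof -
  have "volterra f = const_l2 (integral_l2 f)" using assms by (simp add: covolterra_def)
  moreover from this have "integral_l2 f = 0" by (rule volterra_eq_const_l2)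
  ultimately show ?thesis using volterra_eq_zero[of f] linear_0[OF linear_const_l2] by simp
qed

text \<open>\<open>beam_state X' u\<close> is the state \<open>(w\<^sub>\<zeta>\<^sub>\<zeta>, w\<^sub>t)\<close> whose image under the beam operator is
  \<open>X' = (w\<^sub>t\<^sub>\<zeta>\<^sub>\<zeta>, - w\<^sub>\<zeta>\<^sub>\<zeta>\<^sub>\<zeta>\<^sub>\<zeta>)\<close> and whose boundary value \<open>w\<^sub>\<zeta>\<^sub>\<zeta>\<^sub>\<zeta>(1)\<close> is \<open>u\<close>;
  then \<open>tip_velocity X'\<close> is \<open>w\<^sub>t(1)\<close>.\<close>

definition beam_state :: "l2 \<times> l2 \<Rightarrow> complex \<Rightarrow> l2 \<times> l2" where
  "beam_state X' u = (- covolterra (covolterra (snd X') + const_l2 u), volterra (volterra (fst X')))"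

definition tip_velocity :: "l2 \<times> l2 \<Rightarrow> complex" where
  "tip_velocity X' = integral_l2 (volterra (fst X'))"

lemma bounded_linear_tip_velocity: "bounded_linear tip_velocity"
  unfolding tip_velocity_def[abs_def]
  by (intro bounded_linear_compose[OF bounded_linear_integral_l2] bounded_linear_compose[OF bounded_linear_volterra]
      bounded_linear_fst)


text \<open>The outer \<open>covolterra\<close> becomes \<open>volterra\<close> on the other side of
  the inner product. The interior terms of the two components then cancel, both being
  \<open>volterra (volterra f)\<close> against g, and only the power supplied at the free end
  remains.\<close>

lemma beam_state_energy: "beam_state X' u \<bullet> X' = - Re (u * cnj (tip_velocity X'))"
proof -
  obtain f g where X': "X' = (f, g)" by (cases X')
  have "covolterra (covolterra g + const_l2 u) \<bullet> f = covolterra g \<bullet> volterra f + const_l2 u \<bullet> volterra f"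
    by (simp add: inner_covolterra inner_add_left)
  also have "covolterra g \<bullet> volterra f = volterra (volterra f) \<bullet> g"
    by (subst inner_covolterra) (rule inner_commute)
  also have "const_l2 u \<bullet> volterra f = Re (u * cnj (integral_l2 (volterra f)))"
    by (subst inner_commute) (simp add: inner_const_l2 algebra_simps)
  finally show ?thesis by (simp add: X' beam_state_def tip_velocity_def inner_prod_def)
qed

text \<open>The multiplier \<open>\<zeta> w\<^sub>\<zeta>\<close>: with \<open>p = w\<^sub>\<zeta>\<^sub>\<zeta>\<close>, \<open>q = w\<^sub>t\<close>, this is \<open>2 Re \<integral> \<zeta> w\<^sub>t cnj(w\<^sub>\<zeta>)\<close>.\<close>

definition multiplier_form :: "l2 \<times> l2 \<Rightarrow> l2 \<times> l2 \<Rightarrow> real" where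
  "multiplier_form X Y = 2 * (snd X \<bullet> mult_id (volterra (fst Y)))"

text \<open>This is the time derivative of the multiplier form. The velocity part gives |w_t(1)|^2 -
  |w_t|^2 by \<open>volterra_multiplier\<close>. With p the second space derivative of w, the
  elastic part gives - |p|^2 from the term that keeps the weight \<zeta> and - 2 |p|^2 from the
  derivative of the weight, hence the 3; the input is paired with the slope of w at 1.\<close>

lemma beam_state_multiplier:
  assumes "X = beam_state X' u"
  shows "multiplier_form X' X + multiplier_form X X' =
    (cmod (tip_velocity X'))\<^sup>2 - (norm (snd X))\<^sup>2 - 3 * (norm (fst X))\<^sup>2 - 2 * Re (u * cnj (integral_l2 (fst X)))"
proof -
  obtain f g where X': "X' = (f, g)" by (cases X')
  \<comment> \<open>\<open>r\<close> is the third and \<open>p\<close> the second space derivative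
    of w; their values at 1 are u and 0.\<close>
  define r where "r = covolterra g + const_l2 u"
  define p where "p = - covolterra r"
  have X: "X = (p, volterra (volterra f))" by (simp add: assms X' beam_state_def r_def p_def)
  have q: "2 * (volterra (volterra f) \<bullet> mult_id (volterra f)) = (cmod (integral_l2 (volterra f)))\<^sup>2 - (norm (volterra (volterra f)))\<^sup>2"
    by (rule volterra_multiplier)
  have rV: "r \<bullet> volterra p = - (norm p)\<^sup>2"
    by (simp add: inner_covolterra[symmetric] p_def power2_norm_eq_inner)
  have rZ: "2 * (r \<bullet> mult_id p) = - (norm p)\<^sup>2"
  proof -
    let ?t = "integral_l2 r"
    have p: "p = volterra r - const_l2 ?t" by (simp add: p_def covolterra_def)
    have "r \<bullet> mult_id p = volterra r \<bullet> mult_id r - mult_id r \<bullet> const_l2 ?t"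
      by (simp add: p linear_diff[OF linear_mult_id] inner_diff_right inner_mult_id[symmetric] inner_commute)
    also have "mult_id r \<bullet> const_l2 ?t = (cmod ?t)\<^sup>2 - volterra r \<bullet> const_l2 ?t"
    proof -
      have "integral_l2 (mult_id r) = ?t - integral_l2 (volterra r)" by (simp add: integral_l2_volterra)
      then show ?thesis
        by (simp only: inner_const_l2 left_diff_distrib minus_complex.simps Re_mult_cnj_self)
    qed
    finally have "2 * (r \<bullet> mult_id p) = 2 * (volterra r \<bullet> mult_id r) - 2 * (cmod ?t)\<^sup>2 + 2 * (volterra r \<bullet> const_l2 ?t)"
      by simp
    also have "\<dots> = - (norm (volterra r))\<^sup>2 - (norm (const_l2 ?t))\<^sup>2 + 2 * (volterra r \<bullet> const_l2 ?t)"
      by (simp add: volterra_multiplier)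
    also have "\<dots> = - (norm p)\<^sup>2"
      unfolding p power2_norm_eq_inner by (simp add: inner_diff_left inner_diff_right inner_commute)
    finally show ?thesis .
  qed
  have "g \<bullet> mult_id (volterra p) = covolterra g \<bullet> (mult_id p + volterra p)"
    by (simp add: mult_id_volterra inner_add_right inner_covolterra)
  also have "\<dots> = r \<bullet> mult_id p + r \<bullet> volterra p - (mult_id p + volterra p) \<bullet> const_l2 u"
    by (simp add: r_def inner_add_left inner_add_right inner_commute algebra_simps)
  also have "(mult_id p + volterra p) \<bullet> const_l2 u = Re (u * cnj (integral_l2 p))"
    by (simp add: inner_const_l2 linear_add[OF linear_integral_l2] integral_l2_volterra algebra_simps)
  finally show ?thesis
    using q rV rZ by (simp add: X X' multiplier_form_def tip_velocity_def)
qed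

lemma multiplier_form_bound: "\<bar>multiplier_form X X\<bar> \<le> 3 * (norm X)\<^sup>2"
proof -
  have "\<bar>snd X \<bullet> mult_id (volterra (fst X))\<bar> \<le> norm (snd X) * norm (mult_id (volterra (fst X)))"
    by (rule Cauchy_Schwarz_ineq2)
  also have "\<dots> \<le> norm (snd X) * (3 * norm (fst X))"
    by (intro mult_left_mono order_trans[OF norm_mult_id_le norm_volterra_le]) auto
  finally have "2 * \<bar>snd X \<bullet> mult_id (volterra (fst X))\<bar> \<le> 3 * (2 * norm (snd X) * norm (fst X))"
    by (simp add: mult_ac)
  also have "\<dots> \<le> 3 * ((norm (snd X))\<^sup>2 + (norm (fst X))\<^sup>2)"
    by (intro mult_left_mono sum_squares_bound) auto
  finally show ?thesis by (simp add: multiplier_form_def norm_prod_def abs_mult add.commute)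
qed

section \<open>Local convergence in the mean square\<close>

definition sq_int :: "real \<Rightarrow> (real \<Rightarrow> complex) \<Rightarrow> real" where
  "sq_int T f = (LINT t|lebesgue_on {0..T}. (cmod (f t))\<^sup>2)"

lemma sq_int_nonneg: "0 \<le> sq_int T f"
  by (simp add: sq_int_def)

lemma L2_loc_square_integrable: "L2_loc f \<Longrightarrow> 0 < T \<Longrightarrow> square_integrable {0..T} f"
  by (simp add: L2_loc_def)

lemma L2_loc_integrable: "L2_loc f \<Longrightarrow> 0 < T \<Longrightarrow> integrable (lebesgue_on {0..T}) (\<lambda>t. (cmod (f t))\<^sup>2)"
  using L2_loc_square_integrable by (simp add: square_integrable_def)

lemma L2_loc_add: "L2_loc f \<Longrightarrow> L2_loc g \<Longrightarrow> L2_loc (\<lambda>t. f t + g t)"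
  by (simp add: L2_loc_def square_integrable_add)

lemma L2_loc_diff: "L2_loc f \<Longrightarrow> L2_loc g \<Longrightarrow> L2_loc (\<lambda>t. f t - g t)"
  by (simp add: L2_loc_def square_integrable_diff)

lemma L2_loc_cmult: "L2_loc f \<Longrightarrow> L2_loc (\<lambda>t. c * f t)"
  by (simp add: L2_loc_def square_integrable_cmult)

lemma L2_loc_continuous: "continuous_on {0..} f \<Longrightarrow> L2_loc f"
  by (auto simp: L2_loc_def intro!: square_integrable_continuous intro: continuous_on_subset)

lemma sq_int_cong_AE:
  assumes "L2_loc f" "L2_loc g" "0 < T" "AE t in lebesgue_on {0..T}. f t = g t"
  shows "sq_int T f = sq_int T g"
  unfolding sq_int_def
proof (rule integral_cong_AE)
  show "AE t in lebesgue_on {0..T}. (cmod (f t))\<^sup>2 = (cmod (g t))\<^sup>2"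
    using assms(4) by eventually_elim simp
qed (use L2_loc_integrable assms in auto)

lemma sq_int_cmult: "sq_int T (\<lambda>t. c * f t) = (cmod c)\<^sup>2 * sq_int T f"
  by (simp add: sq_int_def norm_mult power_mult_distrib)

lemma sq_int_add_le:
  assumes "L2_loc f" "L2_loc g" "0 < T"
  shows "sq_int T (\<lambda>t. f t + g t) \<le> 2 * sq_int T f + 2 * sq_int T g"
proof -
  have "sq_int T (\<lambda>t. f t + g t) \<le> (LINT t|lebesgue_on {0..T}. 2 * (cmod (f t))\<^sup>2 + 2 * (cmod (g t))\<^sup>2)"
    unfolding sq_int_def
    by (intro integral_mono L2_loc_integrable L2_loc_add assms Bochner_Integration.integrable_add
        integrable_mult_right norm_add_square_le)
  also have "\<dots> = 2 * sq_int T f + 2 * sq_int T g"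
    unfolding sq_int_def using L2_loc_integrable[OF assms(1,3)] L2_loc_integrable[OF assms(2,3)] by simp
  finally show ?thesis .
qed

lemma L2_loc_limit_iff:
  "L2_loc_limit fk f \<longleftrightarrow> (\<forall>k. L2_loc (fk k)) \<and> L2_loc f \<and>
    (\<forall>T>0. (\<lambda>k. sq_int T (\<lambda>t. fk k t - f t)) \<longlonglongrightarrow> 0)"
  by (simp add: L2_loc_limit_def sq_int_def)

lemma L2_loc_limit_add:
  assumes "L2_loc_limit fk f" "L2_loc_limit gk g"
  shows "L2_loc_limit (\<lambda>k t. fk k t + gk k t) (\<lambda>t. f t + g t)"
  unfolding L2_loc_limit_iff
proof (intro conjI allI impI)
  show "L2_loc (\<lambda>t. fk k t + gk k t)" for k using assms by (auto simp: L2_loc_limit_iff intro: L2_loc_add)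
  show "L2_loc (\<lambda>t. f t + g t)" using assms by (auto simp: L2_loc_limit_iff intro: L2_loc_add)
  fix T :: real assume T: "0 < T"
  have lim: "(\<lambda>k. 2 * sq_int T (\<lambda>t. fk k t - f t) + 2 * sq_int T (\<lambda>t. gk k t - g t)) \<longlonglongrightarrow> 2 * 0 + 2 * 0"
    using assms T by (intro tendsto_intros) (auto simp: L2_loc_limit_iff)
  have le: "sq_int T (\<lambda>t. fk k t + gk k t - (f t + g t))
      \<le> 2 * sq_int T (\<lambda>t. fk k t - f t) + 2 * sq_int T (\<lambda>t. gk k t - g t)" for k
    using sq_int_add_le[of "\<lambda>t. fk k t - f t" "\<lambda>t. gk k t - g t" T] assms T
    by (auto simp: L2_loc_limit_iff L2_loc_diff algebra_simps)
  show "(\<lambda>k. sq_int T (\<lambda>t. fk k t + gk k t - (f t + g t))) \<longlonglongrightarrow> 0"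
    by (rule Lim_null_comparison[OF always_eventually lim[simplified]])
      (use le sq_int_nonneg in \<open>auto simp: abs_of_nonneg\<close>)
qed

lemma L2_loc_limit_cmult:
  assumes "L2_loc_limit fk f"
  shows "L2_loc_limit (\<lambda>k t. c * fk k t) (\<lambda>t. c * f t)"
  unfolding L2_loc_limit_iff
proof (intro conjI allI impI)
  show "L2_loc (\<lambda>t. c * fk k t)" for k using assms by (auto simp: L2_loc_limit_iff intro: L2_loc_cmult)
  show "L2_loc (\<lambda>t. c * f t)" using assms by (auto simp: L2_loc_limit_iff intro: L2_loc_cmult)
  fix T :: real assume T: "0 < T"
  have "(\<lambda>k. (cmod c)\<^sup>2 * sq_int T (\<lambda>t. fk k t - f t)) \<longlonglongrightarrow> (cmod c)\<^sup>2 * 0"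
    using assms T by (intro tendsto_intros) (auto simp: L2_loc_limit_iff)
  then show "(\<lambda>k. sq_int T (\<lambda>t. c * fk k t - c * f t)) \<longlonglongrightarrow> 0"
    by (simp add: sq_int_cmult[symmetric] right_diff_distrib)
qed

lemma L2_loc_limit_diff:
  assumes "L2_loc_limit fk f" "L2_loc_limit gk g"
  shows "L2_loc_limit (\<lambda>k t. fk k t - gk k t) (\<lambda>t. f t - g t)"
  using L2_loc_limit_add[OF assms(1) L2_loc_limit_cmult[OF assms(2), of "-1"]] by simp

text \<open>Factor |a|^2 - |b|^2 and split |a - b| |b| by Young's inequality with weight \<delta>.
  The large factor 1 / \<delta> sits at a quantity that will tend to 0, so \<delta> can be fixed
  first.\<close>

lemma sq_int_diff_le:
  assumes "L2_loc f" "L2_loc g" "0 < T" "0 < \<delta>"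
  shows "\<bar>sq_int T f - sq_int T g\<bar> \<le> (1 + 1 / \<delta>) * sq_int T (\<lambda>t. f t - g t) + \<delta> * sq_int T g"
proof -
  have pt: "\<bar>(cmod a)\<^sup>2 - (cmod b)\<^sup>2\<bar> \<le> (1 + 1 / \<delta>) * (cmod (a - b))\<^sup>2 + \<delta> * (cmod b)\<^sup>2" for a b
  proof -
    let ?d = "cmod (a - b)"
    have "\<bar>cmod a - cmod b\<bar> \<le> ?d" by (rule norm_triangle_ineq3)
    moreover have "cmod a + cmod b \<le> ?d + 2 * cmod b"
      using norm_triangle_ineq2[of a b] by simp
    ultimately have "\<bar>cmod a - cmod b\<bar> * (cmod a + cmod b) \<le> ?d * (?d + 2 * cmod b)"
      by (intro mult_mono) auto
    also have "\<bar>cmod a - cmod b\<bar> * (cmod a + cmod b) = \<bar>(cmod a)\<^sup>2 - (cmod b)\<^sup>2\<bar>"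
      by (simp add: power2_eq_square square_diff_square_factored abs_mult)
    finally have A: "\<bar>(cmod a)\<^sup>2 - (cmod b)\<^sup>2\<bar> \<le> ?d\<^sup>2 + 2 * (?d * cmod b)"
      by (simp add: power2_eq_square algebra_simps)
    have "2 * (?d / sqrt \<delta>) * (sqrt \<delta> * cmod b) \<le> (?d / sqrt \<delta>)\<^sup>2 + (sqrt \<delta> * cmod b)\<^sup>2"
      by (rule sum_squares_bound)
    then have "2 * (?d * cmod b) \<le> ?d\<^sup>2 / \<delta> + \<delta> * (cmod b)\<^sup>2"
      using assms(4) by (simp add: power_divide power_mult_distrib)
    with A show ?thesis by (simp add: algebra_simps)
  qed
  note int = L2_loc_integrable[OF assms(1,3)] L2_loc_integrable[OF assms(2,3)]
    L2_loc_integrable[OF L2_loc_diff[OF assms(1,2)] assms(3)]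
  have "\<bar>sq_int T f - sq_int T g\<bar> = \<bar>LINT t|lebesgue_on {0..T}. (cmod (f t))\<^sup>2 - (cmod (g t))\<^sup>2\<bar>"
    unfolding sq_int_def using int by simp
  also have "\<dots> \<le> (LINT t|lebesgue_on {0..T}. \<bar>(cmod (f t))\<^sup>2 - (cmod (g t))\<^sup>2\<bar>)"
    by (rule integral_abs_bound)
  also have "\<dots> \<le> (LINT t|lebesgue_on {0..T}. (1 + 1 / \<delta>) * (cmod (f t - g t))\<^sup>2 + \<delta> * (cmod (g t))\<^sup>2)"
    using int by (intro integral_mono pt) auto
  also have "\<dots> = (1 + 1 / \<delta>) * sq_int T (\<lambda>t. f t - g t) + \<delta> * sq_int T g"
    unfolding sq_int_def using int by simp
  finally show ?thesis .
qed

lemma L2_loc_limit_sq_int: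
  assumes "L2_loc_limit fk f" "0 < T"
  shows "(\<lambda>k. sq_int T (fk k)) \<longlonglongrightarrow> sq_int T f"
proof (rule metric_LIMSEQ_I)
  fix e :: real assume "0 < e"
  \<comment> \<open>Makes the second term of \<open>sq_int_diff_le\<close> at most e / 2; the added
    1 keeps the denominator positive when \<open>f\<close> vanishes.\<close>
  define \<delta> where "\<delta> = e / (2 * (sq_int T f + 1))"
  have B: "0 < sq_int T f + 1" using sq_int_nonneg[of T f] by linarith
  have \<delta>: "0 < \<delta>" using \<open>0 < e\<close> B by (simp add: \<delta>_def)
  have "\<delta> * sq_int T f \<le> \<delta> * (sq_int T f + 1)" using \<delta> by simp
  also have "\<dots> = e / 2" using B by (simp add: \<delta>_def field_simps)
  finally have \<delta>B: "\<delta> * sq_int T f \<le> e / 2" .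
  have "(\<lambda>k. (1 + 1 / \<delta>) * sq_int T (\<lambda>t. fk k t - f t)) \<longlonglongrightarrow> (1 + 1 / \<delta>) * 0"
    using assms by (intro tendsto_intros) (auto simp: L2_loc_limit_iff)
  then have "\<forall>\<^sub>F k in sequentially. (1 + 1 / \<delta>) * sq_int T (\<lambda>t. fk k t - f t) < e / 2"
    using \<open>0 < e\<close> by (intro order_tendstoD) auto
  then have "\<forall>\<^sub>F k in sequentially. dist (sq_int T (fk k)) (sq_int T f) < e"
  proof eventually_elim
    case (elim k)
    have "\<bar>sq_int T (fk k) - sq_int T f\<bar> \<le> (1 + 1 / \<delta>) * sq_int T (\<lambda>t. fk k t - f t) + \<delta> * sq_int T f"
      using assms \<delta> by (intro sq_int_diff_le) (auto simp: L2_loc_limit_iff)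
    with elim \<delta>B show ?case unfolding dist_real_def by linarith
  qed
  then show "\<exists>N. \<forall>k\<ge>N. dist (sq_int T (fk k)) (sq_int T f) < e"
    by (simp add: eventually_sequentially)
qed

lemma sq_int_eq_zero_iff:
  assumes "L2_loc f" "0 < T"
  shows "sq_int T f = 0 \<longleftrightarrow> (AE t in lebesgue_on {0..T}. f t = 0)"
  unfolding sq_int_def
  by (subst integral_nonneg_eq_0_iff_AE) (use L2_loc_integrable[OF assms] in auto)

lemma AE_atLeast_0_iff:
  "(AE t in lebesgue_on {0..}. P t) \<longleftrightarrow> (\<forall>T>0. AE t in lebesgue_on {0..T::real}. P t)"
proof
  assume "AE t in lebesgue_on {0..}. P t"
  then have "AE t in lebesgue. t \<in> {0..} \<longrightarrow> P t" by (simp add: AE_restrict_space_iff)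
  then have "AE t in lebesgue. t \<in> {0..T} \<longrightarrow> P t" for T
    by eventually_elim auto
  then show "\<forall>T>0. AE t in lebesgue_on {0..T}. P t" by (simp add: AE_restrict_space_iff)
next
  assume "\<forall>T>0. AE t in lebesgue_on {0..T}. P t"
  then have "AE t in lebesgue. t \<in> {0..real (Suc n)} \<longrightarrow> P t" for n
    using AE_restrict_space_iff[of "{0..real (Suc n)}" lebesgue P] by simp
  then have "AE t in lebesgue. \<forall>n. t \<in> {0..real (Suc n)} \<longrightarrow> P t"
    unfolding AE_all_countable by blast
  then have "AE t in lebesgue. t \<in> {0..} \<longrightarrow> P t"
  proof eventually_elim
    case (elim t)
    obtain n where "t \<le> real n" using real_arch_simple by blast
    then show ?case using elim[THEN spec, of n] by auto
  qed
  then show "AE t in lebesgue_on {0..}. P t" by (simp add: AE_restrict_space_iff)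
qed

lemma L2_loc_limit_unique:
  assumes "L2_loc_limit fk f" "L2_loc_limit fk g"
  shows "AE t in lebesgue_on {0..}. f t = g t"
  unfolding AE_atLeast_0_iff
proof (intro allI impI)
  fix T :: real assume "0 < T"
  have "L2_loc_limit (\<lambda>k t. fk k t - fk k t) (\<lambda>t. f t - g t)"
    by (rule L2_loc_limit_diff[OF assms])
  then have "(\<lambda>k. sq_int T (\<lambda>t. fk k t - fk k t)) \<longlonglongrightarrow> sq_int T (\<lambda>t. f t - g t)"
    and L: "L2_loc (\<lambda>t. f t - g t)"
    using L2_loc_limit_sq_int \<open>0 < T\<close> by (auto simp: L2_loc_limit_iff)
  then have "sq_int T (\<lambda>t. f t - g t) = 0"
    by (simp add: sq_int_def LIMSEQ_const_iff)
  then show "AE t in lebesgue_on {0..T}. f t = g t"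
    using sq_int_eq_zero_iff[OF L \<open>0 < T\<close>] by simp
qed

lemma FTC_lebesgue:
  fixes \<phi> :: "real \<Rightarrow> real"
  assumes "\<And>t. 0 \<le> t \<Longrightarrow> (\<phi> has_real_derivative \<phi>' t) (at t within {0..})"
    and "continuous_on {0..} \<phi>'" and "0 < T"
  shows "(LINT t|lebesgue_on {0..T}. \<phi>' t) = \<phi> T - \<phi> 0"
proof -
  have c: "continuous_on {0..T} \<phi>'" using assms(2) by (rule continuous_on_subset) auto
  have "(\<phi>' has_integral (\<phi> T - \<phi> 0)) {0..T}"
    using assms by (intro fundamental_theorem_of_calculus)
      (auto intro!: has_vector_derivative_within_subset[OF assms(1)[unfolded has_real_derivative_iff_has_vector_derivative]])
  then show ?thesis
    using lebesgue_integral_eq_integral[OF continuous_imp_integrable_real[OF c]] by (simp add: integral_unique)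
qed

section \<open>Classical and weak trajectories\<close>

text \<open>The differential equation in inverse form: the state is computed from its derivative and
  the input. The velocity at the tip is a bounded functional of X' but not of X, which is why X' is
  part of the data.\<close>

definition trajectory :: "(real \<Rightarrow> l2 \<times> l2) \<Rightarrow> (real \<Rightarrow> l2 \<times> l2) \<Rightarrow> (real \<Rightarrow> complex) \<Rightarrow> bool" where
  "trajectory X X' u \<longleftrightarrow>
     (\<forall>t\<ge>0. (X has_vector_derivative X' t) (at t within {0..})) \<and>
     continuous_on {0..} X' \<and> continuous_on {0..} u \<and>
     (\<forall>t\<ge>0. X t = beam_state (X' t) (u t))"

lemma beam_state_diff: "beam_state (X - Y) (u - w) = beam_state X u - beam_state Y w"
  by (simp add: beam_state_def linear_diff[OF linear_volterra] linear_diff[OF linear_const_l2]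
      bounded_linear.linear[OF bounded_linear_covolterra, THEN linear_diff]
      bounded_linear.linear[OF bounded_linear_covolterra, THEN linear_add] prod_eq_iff)

lemma trajectory_diff:
  assumes "trajectory X X' u" "trajectory Y Y' w"
  shows "trajectory (\<lambda>t. X t - Y t) (\<lambda>t. X' t - Y' t) (\<lambda>t. u t - w t)"
  using assms by (auto simp: trajectory_def beam_state_diff intro!: has_vector_derivative_diff continuous_intros)

lemma trajectory_continuous:
  assumes "trajectory X X' u"
  shows "continuous_on {0..} X"
  using assms
  by (auto simp: trajectory_def continuous_on_eq_continuous_within intro: has_vector_derivative_continuous)

lemma trajectory_L2_loc:
  assumes "trajectory X X' u"
  shows "L2_loc u" "L2_loc (\<lambda>t. tip_velocity (X' t))"
  using assms
  by (auto simp: trajectory_def intro!: L2_loc_continuous bounded_linear.continuous_on[OF bounded_linear_tip_velocity])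

lemma cmod_diff_square: "(cmod (a - b))\<^sup>2 = (cmod a)\<^sup>2 + (cmod b)\<^sup>2 - 2 * Re (a * cnj b)"
  unfolding cmod_power2 by (simp add: power2_eq_square algebra_simps)

text \<open>The supplied power - 2 Re (u cnj v) is rewritten as |u - v|^2 - |u|^2 - |v|^2. In this
  form the balance consists of square integrals, which converge under
  \<open>L2_loc_limit\<close>.\<close>

theorem trajectory_energy:
  assumes "trajectory X X' u" "0 < T"
  defines "v \<equiv> \<lambda>t. tip_velocity (X' t)"
  shows "(norm (X T))\<^sup>2 - (norm (X 0))\<^sup>2 = sq_int T (\<lambda>t. u t - v t) - sq_int T u - sq_int T v"
proof -
  have X: "(X has_vector_derivative X' t) (at t within {0..})" "X t = beam_state (X' t) (u t)" if "0 \<le> t" for t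
    using assms(1) that by (auto simp: trajectory_def)
  have cont: "continuous_on {0..} X" "continuous_on {0..} X'"
    using assms(1) trajectory_continuous by (auto simp: trajectory_def)
  have L: "L2_loc u" "L2_loc v" using trajectory_L2_loc[OF assms(1)] by (auto simp: v_def)
  have pt: "2 * (X t \<bullet> X' t) = (cmod (u t - v t))\<^sup>2 - (cmod (u t))\<^sup>2 - (cmod (v t))\<^sup>2" if "0 \<le> t" for t
    using beam_state_energy[of "X' t" "u t"] X(2)[OF that] by (simp add: cmod_diff_square v_def)
  have "(LINT t|lebesgue_on {0..T}. 2 * (X t \<bullet> X' t)) = X T \<bullet> X T - X 0 \<bullet> X 0"
  proof (rule FTC_lebesgue)
    show "((\<lambda>t. X t \<bullet> X t) has_real_derivative 2 * (X t \<bullet> X' t)) (at t within {0..})" if "0 \<le> t" for t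
      using bounded_bilinear.has_vector_derivative[OF bounded_bilinear_inner X(1)[OF that] X(1)[OF that]]
      by (simp add: has_real_derivative_iff_has_vector_derivative inner_commute)
  qed (use assms(2) in \<open>auto intro!: continuous_intros cont\<close>)
  also have "(LINT t|lebesgue_on {0..T}. 2 * (X t \<bullet> X' t)) =
      (LINT t|lebesgue_on {0..T}. (cmod (u t - v t))\<^sup>2 - (cmod (u t))\<^sup>2 - (cmod (v t))\<^sup>2)"
    by (intro Bochner_Integration.integral_cong refl pt) simp
  also have "\<dots> = sq_int T (\<lambda>t. u t - v t) - sq_int T u - sq_int T v"
    unfolding sq_int_def using L2_loc_integrable[OF L2_loc_diff[OF L] assms(2)]
      L2_loc_integrable[OF L(1) assms(2)] L2_loc_integrable[OF L(2) assms(2)] by simp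
  finally show ?thesis by (simp add: power2_norm_eq_inner)
qed

lemma integrable_continuous_power2:
  fixes X :: "real \<Rightarrow> 'a::real_normed_vector"
  assumes "continuous_on {0..} X"
  shows "integrable (lebesgue_on {0..T}) (\<lambda>t. (norm (X t))\<^sup>2)"
  by (intro continuous_imp_integrable_real continuous_intros continuous_on_subset[OF assms]) auto

text \<open>Integrate the rate of change of the multiplier form; each end value costs at most 3
  |X|^2. The first inequality bounds the state by the boundary data. The second is a hidden
  regularity estimate: it bounds the velocity trace by state and input.\<close>

theorem trajectory_observation:
  assumes "trajectory X X' u" "0 < T"
  defines "v \<equiv> \<lambda>t. tip_velocity (X' t)"
  shows "(LINT t|lebesgue_on {0..T}. (norm (X t))\<^sup>2) \<le>
      3 * ((norm (X 0))\<^sup>2 + (norm (X T))\<^sup>2) + sq_int T u + sq_int T v"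
    and "sq_int T v \<le> 3 * ((norm (X 0))\<^sup>2 + (norm (X T))\<^sup>2)
      + 4 * (LINT t|lebesgue_on {0..T}. (norm (X t))\<^sup>2) + sq_int T u"
proof -
  have X: "(X has_vector_derivative X' t) (at t within {0..})" "X t = beam_state (X' t) (u t)" if "0 \<le> t" for t
    using assms(1) that by (auto simp: trajectory_def)
  have cont: "continuous_on {0..} X" "continuous_on {0..} X'"
    using assms(1) trajectory_continuous by (auto simp: trajectory_def)
  have L: "L2_loc u" "L2_loc v" using trajectory_L2_loc[OF assms(1)] by (auto simp: v_def)
  have B: "bounded_linear (\<lambda>X. mult_id (volterra (fst X)))"
    by (intro bounded_linear_compose[OF bounded_linear_mult_id]
        bounded_linear_compose[OF bounded_linear_volterra] bounded_linear_fst)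
  define \<phi>' where "\<phi>' t = multiplier_form (X' t) (X t) + multiplier_form (X t) (X' t)" for t
  have der: "((\<lambda>t. multiplier_form (X t) (X t)) has_real_derivative \<phi>' t) (at t within {0..})" if "0 \<le> t" for t
  proof -
    have "((\<lambda>t. snd (X t) \<bullet> mult_id (volterra (fst (X t)))) has_vector_derivative
        snd (X t) \<bullet> mult_id (volterra (fst (X' t))) + snd (X' t) \<bullet> mult_id (volterra (fst (X t)))) (at t within {0..})"
      by (intro bounded_bilinear.has_vector_derivative[OF bounded_bilinear_inner]
          bounded_linear.has_vector_derivative[OF bounded_linear_snd]
          bounded_linear.has_vector_derivative[OF B] X that)
    then show ?thesis
      unfolding multiplier_form_def \<phi>'_def has_real_derivative_iff_has_vector_derivative[symmetric]
      by (auto intro!: derivative_eq_intros)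
  qed
  have c\<phi>': "continuous_on {0..} \<phi>'"
    unfolding \<phi>'_def multiplier_form_def
    by (intro continuous_intros cont bounded_linear.continuous_on[OF B])
  have FTC: "(LINT t|lebesgue_on {0..T}. \<phi>' t) = multiplier_form (X T) (X T) - multiplier_form (X 0) (X 0)"
    by (rule FTC_lebesgue[OF der c\<phi>' assms(2)])
  have i\<phi>': "integrable (lebesgue_on {0..T}) \<phi>'"
    by (intro continuous_imp_integrable_real continuous_on_subset[OF c\<phi>']) auto
  have bnd: "\<bar>(LINT t|lebesgue_on {0..T}. \<phi>' t)\<bar> \<le> 3 * ((norm (X 0))\<^sup>2 + (norm (X T))\<^sup>2)"
    using FTC multiplier_form_bound[of "X T"] multiplier_form_bound[of "X 0"]
    unfolding abs_le_iff by (simp add: algebra_simps)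
  have pt: "(norm (X t))\<^sup>2 \<le> (cmod (u t))\<^sup>2 + (cmod (v t))\<^sup>2 - \<phi>' t"
    "(cmod (v t))\<^sup>2 \<le> \<phi>' t + 4 * (norm (X t))\<^sup>2 + (cmod (u t))\<^sup>2" if "0 \<le> t" for t
  proof -
    let ?p = "fst (X t)" and ?q = "snd (X t)"
    have "\<phi>' t = (cmod (v t))\<^sup>2 - (norm ?q)\<^sup>2 - 3 * (norm ?p)\<^sup>2 - 2 * Re (u t * cnj (integral_l2 ?p))"
      unfolding \<phi>'_def v_def using X(2)[OF that] by (rule beam_state_multiplier)
    \<comment> \<open>Young's inequality absorbs the cross term at the price of one unit of |p|^2:
      out of the three units at least two remain for the first estimate, and at most four are spent
      in the second.\<close>
    moreover have "\<bar>2 * Re (u t * cnj (integral_l2 ?p))\<bar> \<le> (cmod (u t))\<^sup>2 + (norm ?p)\<^sup>2"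
    proof -
      have "\<bar>Re (u t * cnj (integral_l2 ?p))\<bar> \<le> cmod (u t) * cmod (integral_l2 ?p)"
        using abs_Re_le_cmod[of "u t * cnj (integral_l2 ?p)"] by (simp add: norm_mult)
      also have "\<dots> \<le> cmod (u t) * norm ?p" by (intro mult_left_mono norm_integral_l2_le) auto
      finally have "\<bar>2 * Re (u t * cnj (integral_l2 ?p))\<bar> \<le> 2 * cmod (u t) * norm ?p" by linarith
      also have "\<dots> \<le> (cmod (u t))\<^sup>2 + (norm ?p)\<^sup>2" by (rule sum_squares_bound)
      finally show ?thesis .
    qed
    moreover have "(norm (X t))\<^sup>2 = (norm ?p)\<^sup>2 + (norm ?q)\<^sup>2" by (simp add: norm_prod_def)
    moreover have "0 \<le> (norm ?p)\<^sup>2" "0 \<le> (norm ?q)\<^sup>2" by auto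
    ultimately show "(norm (X t))\<^sup>2 \<le> (cmod (u t))\<^sup>2 + (cmod (v t))\<^sup>2 - \<phi>' t"
      "(cmod (v t))\<^sup>2 \<le> \<phi>' t + 4 * (norm (X t))\<^sup>2 + (cmod (u t))\<^sup>2" by linarith+
  qed
  note int = L2_loc_integrable[OF L(1) assms(2)] L2_loc_integrable[OF L(2) assms(2)]
    integrable_continuous_power2[OF cont(1), of T] i\<phi>'
  have "(LINT t|lebesgue_on {0..T}. (norm (X t))\<^sup>2) \<le>
      (LINT t|lebesgue_on {0..T}. (cmod (u t))\<^sup>2 + (cmod (v t))\<^sup>2 - \<phi>' t)"
    using int pt by (intro integral_mono) auto
  also have "\<dots> = sq_int T u + sq_int T v - (LINT t|lebesgue_on {0..T}. \<phi>' t)"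
    unfolding sq_int_def using int by simp
  finally show "(LINT t|lebesgue_on {0..T}. (norm (X t))\<^sup>2) \<le>
      3 * ((norm (X 0))\<^sup>2 + (norm (X T))\<^sup>2) + sq_int T u + sq_int T v" using bnd by linarith
  have "sq_int T v \<le> (LINT t|lebesgue_on {0..T}. \<phi>' t + 4 * (norm (X t))\<^sup>2 + (cmod (u t))\<^sup>2)"
    unfolding sq_int_def using int pt by (intro integral_mono) auto
  also have "\<dots> = (LINT t|lebesgue_on {0..T}. \<phi>' t) + 4 * (LINT t|lebesgue_on {0..T}. (norm (X t))\<^sup>2) + sq_int T u"
    unfolding sq_int_def using int by simp
  finally show "sq_int T v \<le> 3 * ((norm (X 0))\<^sup>2 + (norm (X T))\<^sup>2)
      + 4 * (LINT t|lebesgue_on {0..T}. (norm (X t))\<^sup>2) + sq_int T u" using bnd by linarith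
qed

text \<open>A limit has no derivative X' from which the tip velocity could be computed, so the limit
  \<open>v\<close> of the traces is carried along as separate data.\<close>

definition weak_trajectory :: "(real \<Rightarrow> l2 \<times> l2) \<Rightarrow> (real \<Rightarrow> complex) \<Rightarrow> (real \<Rightarrow> complex) \<Rightarrow> bool" where
  "weak_trajectory X u v \<longleftrightarrow> continuous_on {0..} X \<and>
     (\<exists>Xk Xk' uk. (\<forall>k. trajectory (Xk k) (Xk' k) (uk k)) \<and>
        (\<forall>T>0. uniform_limit {0..T} Xk X sequentially) \<and>
        L2_loc_limit uk u \<and> L2_loc_limit (\<lambda>k t. tip_velocity (Xk' k t)) v)"

lemma weak_trajectory_L2_loc: "weak_trajectory X u v \<Longrightarrow> L2_loc u \<and> L2_loc v"
  by (auto simp: weak_trajectory_def L2_loc_limit_def)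

lemma weak_trajectory_diff:
  assumes "weak_trajectory X u v" "weak_trajectory Y w z"
  shows "weak_trajectory (\<lambda>t. X t - Y t) (\<lambda>t. u t - w t) (\<lambda>t. v t - z t)"
proof -
  obtain Xk Xk' uk where 1: "\<And>k. trajectory (Xk k) (Xk' k) (uk k)"
      "\<And>T. 0 < T \<Longrightarrow> uniform_limit {0..T} Xk X sequentially"
      "L2_loc_limit uk u" "L2_loc_limit (\<lambda>k t. tip_velocity (Xk' k t)) v"
    using assms(1) by (auto simp: weak_trajectory_def)
  obtain Yk Yk' wk where 2: "\<And>k. trajectory (Yk k) (Yk' k) (wk k)"
      "\<And>T. 0 < T \<Longrightarrow> uniform_limit {0..T} Yk Y sequentially"
      "L2_loc_limit wk w" "L2_loc_limit (\<lambda>k t. tip_velocity (Yk' k t)) z"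
    using assms(2) by (auto simp: weak_trajectory_def)
  have cont: "continuous_on {0..} X" "continuous_on {0..} Y" using assms by (auto simp: weak_trajectory_def)
  have "L2_loc_limit (\<lambda>k t. tip_velocity (Xk' k t - Yk' k t)) (\<lambda>t. v t - z t)"
    using L2_loc_limit_diff[OF 1(4) 2(4)]
    by (simp add: bounded_linear.linear[OF bounded_linear_tip_velocity, THEN linear_diff])
  moreover have "\<forall>T>0. uniform_limit {0..T} (\<lambda>k t. Xk k t - Yk k t) (\<lambda>t. X t - Y t) sequentially"
    using 1(2) 2(2) by (auto intro!: uniform_limit_intros)
  ultimately show ?thesis
    unfolding weak_trajectory_def
    using trajectory_diff[OF 1(1) 2(1)] L2_loc_limit_diff[OF 1(3) 2(3)] cont
    by (intro conjI continuous_intros exI[of _ "\<lambda>k t. Xk k t - Yk k t"]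
        exI[of _ "\<lambda>k t. Xk' k t - Yk' k t"] exI[of _ "\<lambda>k t. uk k t - wk k t"]) auto
qed

lemma weak_trajectory_limits:
  assumes "weak_trajectory X u v" "0 < T"
  shows weak_trajectory_energy:
      "(norm (X T))\<^sup>2 - (norm (X 0))\<^sup>2 = sq_int T (\<lambda>t. u t - v t) - sq_int T u - sq_int T v"
    and weak_trajectory_observation:
      "(LINT t|lebesgue_on {0..T}. (norm (X t))\<^sup>2) \<le>
        3 * ((norm (X 0))\<^sup>2 + (norm (X T))\<^sup>2) + sq_int T u + sq_int T v"
    and weak_trajectory_trace:
      "sq_int T v \<le> 3 * ((norm (X 0))\<^sup>2 + (norm (X T))\<^sup>2)
        + 4 * (LINT t|lebesgue_on {0..T}. (norm (X t))\<^sup>2) + sq_int T u"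
proof -
  obtain Xk Xk' uk where traj: "\<And>k. trajectory (Xk k) (Xk' k) (uk k)"
    and unif: "uniform_limit {0..T} Xk X sequentially"
    and u: "L2_loc_limit uk u" and v: "L2_loc_limit (\<lambda>k t. tip_velocity (Xk' k t)) v"
    using assms unfolding weak_trajectory_def by blast
  have cont: "continuous_on {0..} X" using assms by (simp add: weak_trajectory_def)
  have contT: "continuous_on {0..T} X" using cont by (rule continuous_on_subset) auto
  have contk: "continuous_on {0..T} (Xk k)" for k
    using trajectory_continuous[OF traj] by (rule continuous_on_subset) auto
  note lims = L2_loc_limit_sq_int[OF u assms(2)] L2_loc_limit_sq_int[OF v assms(2)]
    L2_loc_limit_sq_int[OF L2_loc_limit_diff[OF u v] assms(2)]
  have Xlim: "(\<lambda>k. (norm (Xk k t))\<^sup>2) \<longlonglongrightarrow> (norm (X t))\<^sup>2" if "t \<in> {0..T}" for t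
    by (intro tendsto_intros tendsto_uniform_limitI[OF unif that])
  have bdd: "bounded ((\<lambda>t. norm (X t)) ` {0..T})"
    by (intro compact_imp_bounded compact_continuous_image continuous_intros contT) auto
  have "uniform_limit {0..T} (\<lambda>k t. norm (Xk k t) * norm (Xk k t)) (\<lambda>t. norm (X t) * norm (X t)) sequentially"
    by (intro uniform_lim_mult uniform_limit_intros unif bdd)
  then have U: "uniform_limit {0..T} (\<lambda>k t. (norm (Xk k t))\<^sup>2) (\<lambda>t. (norm (X t))\<^sup>2) sequentially"
    by (simp add: power2_eq_square)
  obtain I J where I: "\<And>k. ((\<lambda>t. (norm (Xk k t))\<^sup>2) has_integral I k) {0..T}"
    and J: "((\<lambda>t. (norm (X t))\<^sup>2) has_integral J) {0..T}" and IJ: "I \<longlonglongrightarrow> J"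
    using uniform_limit_integral[OF U] contk by (force intro: continuous_intros)
  have "(LINT t|lebesgue_on {0..T}. (norm (Xk k t))\<^sup>2) = I k" for k
    using lebesgue_integral_eq_integral[OF integrable_continuous_power2[OF trajectory_continuous[OF traj]]] I
    by (simp add: integral_unique)
  moreover have "(LINT t|lebesgue_on {0..T}. (norm (X t))\<^sup>2) = J"
    using lebesgue_integral_eq_integral[OF integrable_continuous_power2[OF cont]] J
    by (simp add: integral_unique)
  ultimately have int: "(\<lambda>k. LINT t|lebesgue_on {0..T}. (norm (Xk k t))\<^sup>2) \<longlonglongrightarrow> (LINT t|lebesgue_on {0..T}. (norm (X t))\<^sup>2)"
    using IJ by simp
  have X0: "(\<lambda>k. (norm (Xk k 0))\<^sup>2) \<longlonglongrightarrow> (norm (X 0))\<^sup>2" and XT: "(\<lambda>k. (norm (Xk k T))\<^sup>2) \<longlonglongrightarrow> (norm (X T))\<^sup>2"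
    using Xlim assms(2) by auto
  show "(norm (X T))\<^sup>2 - (norm (X 0))\<^sup>2 = sq_int T (\<lambda>t. u t - v t) - sq_int T u - sq_int T v"
    by (rule LIMSEQ_unique[where X="\<lambda>k. (norm (Xk k T))\<^sup>2 - (norm (Xk k 0))\<^sup>2"])
      (intro tendsto_diff X0 XT, unfold trajectory_energy[OF traj assms(2)], intro tendsto_diff lims)
  show "(LINT t|lebesgue_on {0..T}. (norm (X t))\<^sup>2) \<le>
        3 * ((norm (X 0))\<^sup>2 + (norm (X T))\<^sup>2) + sq_int T u + sq_int T v"
    by (rule LIMSEQ_le[OF int tendsto_add[OF tendsto_add[OF tendsto_mult_left[OF tendsto_add[OF X0 XT]] lims(1)] lims(2)]])
      (use trajectory_observation(1)[OF traj assms(2)] in blast)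
  show "sq_int T v \<le> 3 * ((norm (X 0))\<^sup>2 + (norm (X T))\<^sup>2)
        + 4 * (LINT t|lebesgue_on {0..T}. (norm (X t))\<^sup>2) + sq_int T u"
    by (rule LIMSEQ_le[OF lims(2) tendsto_add[OF tendsto_add[OF tendsto_mult_left[OF tendsto_add[OF X0 XT]]
            tendsto_mult_left[OF int]] lims(1)]])
      (use trajectory_observation(2)[OF traj assms(2)] in blast)
qed

text \<open>The difference has input 0 and initial state 0, so its energy stays 0, and the trace
  inequality then annihilates the velocity trace. Thus the trace does not depend on the
  approximating sequence.\<close>

lemma weak_trajectory_unique:
  assumes "weak_trajectory X u v" "weak_trajectory Y w z"
    and "X 0 = Y 0" and uw: "AE t in lebesgue_on {0..}. u t = w t"
  shows "AE t in lebesgue_on {0..}. v t = z t"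
  unfolding AE_atLeast_0_iff
proof (intro allI impI)
  define D d e where "D t = X t - Y t" and "d t = u t - w t" and "e t = v t - z t" for t
  have D: "weak_trajectory D d e"
    unfolding D_def d_def e_def by (rule weak_trajectory_diff[OF assms(1,2)])
  have L: "L2_loc d" "L2_loc e" using weak_trajectory_L2_loc[OF D] by auto
  have D0: "D 0 = 0" using assms(3) by (simp add: D_def)
  have d: "AE t in lebesgue_on {0..T}. d t = 0" if "0 < T" for T
    using uw that by (simp add: AE_atLeast_0_iff d_def)
  have dT: "sq_int T d = 0" if "0 < T" for T using sq_int_eq_zero_iff[OF L(1) that] d[OF that] by simp
  have D_eq: "D T = 0" if "0 \<le> T" for T
  proof (cases "T = 0")
    case False
    then have T: "0 < T" using that by simp
    \<comment> \<open>With input 0 the square integrals of d - e and of e cancel in the energy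
      balance.\<close>
    have "sq_int T (\<lambda>t. d t - e t) = sq_int T (\<lambda>t. - 1 * e t)"
    proof (rule sq_int_cong_AE)
      show "AE t in lebesgue_on {0..T}. d t - e t = - 1 * e t" using d[OF T] by eventually_elim simp
    qed (use L T L2_loc_cmult[of e "-1"] in \<open>auto intro: L2_loc_diff\<close>)
    then have "sq_int T (\<lambda>t. d t - e t) = sq_int T e" unfolding sq_int_cmult by simp
    then show ?thesis using weak_trajectory_energy[OF D T] dT[OF T] by (simp add: D0)
  qed (simp add: D0)
  fix T :: real assume T: "0 < T"
  have "(LINT t|lebesgue_on {0..T}. (norm (D t))\<^sup>2) = (LINT t|lebesgue_on {0..T}. 0)"
    by (rule Bochner_Integration.integral_cong) (auto simp: D_eq)
  then have "sq_int T e \<le> 0"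
    using weak_trajectory_trace[OF D T] dT[OF T] D_eq[of T] D0 T by simp
  then have "sq_int T e = 0" using sq_int_nonneg[of T e] by linarith
  then show "AE t in lebesgue_on {0..T}. v t = z t"
    using sq_int_eq_zero_iff[OF L(2) T] by (simp add: e_def)
qed

section \<open>Optimal cost and closed loop\<close>

lemma L2_loc_measurable:
  assumes "L2_loc f"
  shows "f \<in> borel_measurable (lebesgue_on {0..})"
proof -
  have "(\<lambda>t. indicator {0..real (Suc n)} t *\<^sub>R f t) \<in> borel_measurable lebesgue" for n
    using square_integrable_measurable[OF L2_loc_square_integrable[OF assms, of "real (Suc n)"]]
    by (subst borel_measurable_restrict_space_iff[symmetric]) auto
  then have "(\<lambda>t. indicator {0..} t *\<^sub>R f t) \<in> borel_measurable lebesgue"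
  proof (rule borel_measurable_LIMSEQ_metric)
    fix t :: real
    obtain n where n: "t \<le> real n" using real_arch_simple by blast
    have "indicator {0..real (Suc m)} t = (indicator {0..} t :: real)" if "m \<ge> n" for m
      using that n by (auto simp: indicator_def)
    then show "(\<lambda>n. indicator {0..real (Suc n)} t *\<^sub>R f t) \<longlonglongrightarrow> indicator {0..} t *\<^sub>R f t"
      by (intro tendsto_eventually) (auto simp: eventually_sequentially)
  qed
  then show ?thesis by (subst borel_measurable_restrict_space_iff) auto
qed

lemma nn_integral_Icc_le_atLeast:
  "(\<integral>\<^sup>+t. g t \<partial>lebesgue_on {0..T}) \<le> (\<integral>\<^sup>+t. g t \<partial>lebesgue_on {0::real..})"
  by (subst (1 2) nn_integral_restrict_space) (auto intro!: nn_integral_mono simp: indicator_def)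

lemma nn_integral_atLeast_le:
  fixes g :: "real \<Rightarrow> ennreal"
  assumes "g \<in> borel_measurable (lebesgue_on {0..})"
    and le: "\<And>T. 0 < T \<Longrightarrow> (\<integral>\<^sup>+t. g t \<partial>lebesgue_on {0..T}) \<le> C"
  shows "(\<integral>\<^sup>+t. g t \<partial>lebesgue_on {0..}) \<le> C"
proof -
  define M where "M = density lebesgue (\<lambda>t. g t * indicator {0..} t)"
  define J where "J n = {0..real (Suc n)}" for n
  have g: "(\<lambda>t. g t * indicator {0..} t) \<in> borel_measurable lebesgue"
    using assms(1) by (subst (asm) borel_measurable_restrict_space_iff_ennreal) auto
  have eq: "(\<integral>\<^sup>+t. g t \<partial>lebesgue_on S) = emeasure M S" if "S \<subseteq> {0..}" "S \<in> sets lebesgue" for S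
    unfolding M_def emeasure_density[OF g that(2)] using that
    by (subst nn_integral_restrict_space) (auto intro!: nn_integral_cong simp: indicator_def)
  have "incseq J" by (rule incseq_SucI) (auto simp: J_def)
  have "(SUP n. emeasure M (J n)) = emeasure M (\<Union>n. J n)"
    by (intro SUP_emeasure_incseq \<open>incseq J\<close>) (auto simp: M_def J_def)
  moreover have "(\<Union>n. J n) = {0..}"
  proof (intro equalityI subsetI)
    fix t :: real assume "t \<in> {0..}"
    moreover obtain n where "t \<le> real n" using real_arch_simple by blast
    ultimately have "t \<in> J n" by (simp add: J_def)
    then show "t \<in> (\<Union>n. J n)" by blast
  qed (auto simp: J_def)
  moreover have "emeasure M (J n) \<le> C" for n
    using le[of "real (Suc n)"] eq[of "J n"] by (simp add: J_def)
  ultimately have "emeasure M {0..} \<le> C" by (metis SUP_least)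
  then show ?thesis using eq[of "{0..}"] by simp
qed

lemma nn_integral_cost_Icc:
  assumes "L2_loc u" "L2_loc y" "0 < T"
  shows "(\<integral>\<^sup>+t. ennreal ((cmod (u t))\<^sup>2 + (cmod (y t))\<^sup>2) \<partial>lebesgue_on {0..T}) = ennreal (sq_int T u + sq_int T y)"
  unfolding sq_int_def
  using L2_loc_integrable[OF assms(1,3)] L2_loc_integrable[OF assms(2,3)]
  by (subst nn_integral_eq_integral) auto

lemma cost_ge:
  assumes "L2_loc u" "L2_loc y" "0 < T"
  shows "ennreal (sq_int T u + sq_int T y) \<le> cost u y"
  unfolding cost_def nn_integral_cost_Icc[OF assms, symmetric] by (rule nn_integral_Icc_le_atLeast)

lemma cost_le:
  assumes "L2_loc u" "L2_loc y" "\<And>T. 0 < T \<Longrightarrow> sq_int T u + sq_int T y \<le> C"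
  shows "cost u y \<le> ennreal C"
  unfolding cost_def
proof (rule nn_integral_atLeast_le)
  have [measurable]: "u \<in> borel_measurable (lebesgue_on {0..})" "y \<in> borel_measurable (lebesgue_on {0..})"
    using assms(1,2) by (auto intro: L2_loc_measurable)
  show "(\<lambda>t. ennreal ((cmod (u t))\<^sup>2 + (cmod (y t))\<^sup>2)) \<in> borel_measurable (lebesgue_on {0..})"
    by measurable
  show "(\<integral>\<^sup>+t. ennreal ((cmod (u t))\<^sup>2 + (cmod (y t))\<^sup>2) \<partial>lebesgue_on {0..T}) \<le> ennreal C" if "0 < T" for T
    unfolding nn_integral_cost_Icc[OF assms(1,2) that] by (intro ennreal_leI assms(3) that)
qed

lemma sq_int_mono:
  assumes "L2_loc f" "0 < S" "S \<le> T"
  shows "sq_int S f \<le> sq_int T f"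
  unfolding sq_int_def
  by (rule integral_mono_set[OF L2_loc_integrable[OF assms(1)]]) (use assms in auto)

lemma square_integrable_atLeastI:
  assumes "L2_loc f" "\<And>T. 0 < T \<Longrightarrow> sq_int T f \<le> C"
  shows "square_integrable {0..} f" "(LINT t|lebesgue_on {0..}. (cmod (f t))\<^sup>2) \<le> C"
proof -
  have C: "0 \<le> C" using assms(2)[of 1] sq_int_nonneg[of 1 f] by simp
  have [measurable]: "f \<in> borel_measurable (lebesgue_on {0..})" by (rule L2_loc_measurable[OF assms(1)])
  have "(\<integral>\<^sup>+t. ennreal ((cmod (f t))\<^sup>2) \<partial>lebesgue_on {0..}) \<le> ennreal C"
  proof (rule nn_integral_atLeast_le)
    show "(\<integral>\<^sup>+t. ennreal ((cmod (f t))\<^sup>2) \<partial>lebesgue_on {0..T}) \<le> ennreal C" if "0 < T" for T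
      using assms(2)[OF that] L2_loc_integrable[OF assms(1) that]
      by (subst nn_integral_eq_integral) (auto simp: sq_int_def ennreal_leI)
  qed simp
  then have bound: "(\<integral>\<^sup>+t. ennreal ((cmod (f t))\<^sup>2) \<partial>lebesgue_on {0..}) \<le> ennreal C" .
  then have int: "integrable (lebesgue_on {0..}) (\<lambda>t. (cmod (f t))\<^sup>2)"
    by (intro integrableI_bounded) (auto simp: le_less_trans[OF _ ennreal_less_top])
  then show "square_integrable {0..} f" by (simp add: square_integrable_def)
  show "(LINT t|lebesgue_on {0..}. (cmod (f t))\<^sup>2) \<le> C"
    using bound C int by (subst (asm) nn_integral_eq_integral) (auto simp: ennreal_le_iff)
qed

lemma square_integrable_atLeast_L2_loc: "square_integrable {0..} f \<Longrightarrow> L2_loc f"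
  by (auto simp: L2_loc_def intro: square_integrable_subset)

section \<open>Completing the square in the cost\<close>

locale output_weights =
  fixes \<epsilon> \<nu> :: real
  assumes eps: "0 < \<epsilon>" and lam: "\<nu> = sqrt (1 + \<epsilon>\<^sup>2) - \<epsilon>"
begin

lemma lam_pos: "0 < \<nu>"
proof -
  have "sqrt (\<epsilon>\<^sup>2) < sqrt (1 + \<epsilon>\<^sup>2)" by (rule real_sqrt_less_mono) simp
  then show ?thesis using eps by (simp add: lam)
qed

text \<open>The scalar Riccati equation: |u|^2 + |\<epsilon> u - v|^2 - 2 \<nu> Re (u cnj v) is a
  perfect square exactly if (\<epsilon> + \<nu>)^2 = 1 + \<epsilon>^2.\<close>

lemma lam_quadratic: "\<nu>\<^sup>2 + 2 * \<epsilon> * \<nu> = 1"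
proof -
  have "(\<nu> + \<epsilon>)\<^sup>2 = 1 + \<epsilon>\<^sup>2" by (simp add: lam)
  then show ?thesis by (simp add: power2_eq_square algebra_simps)
qed

lemma cost_completion_square:
  fixes u v :: complex
  shows "(cmod u)\<^sup>2 + (cmod (of_real \<epsilon> * u - v))\<^sup>2 + \<nu> * ((cmod (u - v))\<^sup>2 - (cmod u)\<^sup>2 - (cmod v)\<^sup>2)
    = (cmod (of_real \<nu> * u + (of_real \<epsilon> * u - v)))\<^sup>2"
proof -
  have "(cmod (of_real \<nu> * u + (of_real \<epsilon> * u - v)))\<^sup>2 - (cmod (of_real \<epsilon> * u - v))\<^sup>2
      = (\<nu>\<^sup>2 + 2 * \<epsilon> * \<nu>) * (cmod u)\<^sup>2 - 2 * \<nu> * Re (u * cnj v)"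
    unfolding cmod_power2 by (simp add: power2_eq_square algebra_simps)
  then show ?thesis unfolding cmod_diff_square[of u v] lam_quadratic by (simp add: algebra_simps)
qed

lemma weak_trajectory_cost_Icc:
  assumes "weak_trajectory X u v" "0 < T"
  defines "y \<equiv> \<lambda>t. of_real \<epsilon> * u t - v t"
  shows "sq_int T u + sq_int T y
    = \<nu> * ((norm (X 0))\<^sup>2 - (norm (X T))\<^sup>2) + sq_int T (\<lambda>t. of_real \<nu> * u t + y t)"
proof -
  have L: "L2_loc u" "L2_loc v" using weak_trajectory_L2_loc[OF assms(1)] by auto
  have Ly: "L2_loc y" unfolding y_def by (intro L2_loc_diff L2_loc_cmult L)
  note int = L2_loc_integrable[OF L(1) assms(2)] L2_loc_integrable[OF L(2) assms(2)]
    L2_loc_integrable[OF Ly assms(2)] L2_loc_integrable[OF L2_loc_diff[OF L] assms(2)]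
  have "sq_int T (\<lambda>t. of_real \<nu> * u t + y t) = (LINT t|lebesgue_on {0..T}.
      (cmod (u t))\<^sup>2 + (cmod (y t))\<^sup>2 + \<nu> * ((cmod (u t - v t))\<^sup>2 - (cmod (u t))\<^sup>2 - (cmod (v t))\<^sup>2))"
    unfolding sq_int_def y_def by (simp only: cost_completion_square)
  also have "\<dots> = sq_int T u + sq_int T y + \<nu> * (sq_int T (\<lambda>t. u t - v t) - sq_int T u - sq_int T v)"
    unfolding sq_int_def using int by simp
  also have "sq_int T (\<lambda>t. u t - v t) - sq_int T u - sq_int T v = (norm (X T))\<^sup>2 - (norm (X 0))\<^sup>2"
    using weak_trajectory_energy[OF assms(1,2)] by simp
  finally show ?thesis by (simp add: algebra_simps)
qed

text \<open>If the cost is finite, the observation inequality bounds \<open>\<integral> |X|\<^sup>2\<close>, so the energy cannot stay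
  away from zero and all of \<open>\<nu> |X 0|\<^sup>2\<close> has to be paid.\<close>

theorem cost_lower_bound:
  assumes traj: "weak_trajectory X u v" and T0: "0 < T0"
  defines "y \<equiv> \<lambda>t. of_real \<epsilon> * u t - v t"
  shows "ennreal (\<nu> * (norm (X 0))\<^sup>2 + sq_int T0 (\<lambda>t. of_real \<nu> * u t + y t)) \<le> cost u y"
proof (rule ccontr)
  assume neg: "\<not> ?thesis"
  have L: "L2_loc u" "L2_loc v" using weak_trajectory_L2_loc[OF traj] by auto
  have Ly: "L2_loc y" unfolding y_def by (intro L2_loc_diff L2_loc_cmult L)
  have Lz: "L2_loc (\<lambda>t. of_real \<nu> * u t + y t)" by (intro L2_loc_add L2_loc_cmult L Ly)
  have cont: "continuous_on {0..} X" using traj by (simp add: weak_trajectory_def)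
  \<comment> \<open>If the bound fails, the cost is finite. The square up to \<open>T0\<close> is
    kept in the bound for the equality case: a trajectory of cost \<nu> |X 0|^2 then has a vanishing
    square on every bounded interval.\<close>
  from neg obtain C where C: "cost u y = ennreal C" "0 \<le> C"
    by (metis ennreal_cases top_greatest)
  define \<delta> where "\<delta> = \<nu> * (norm (X 0))\<^sup>2 + sq_int T0 (\<lambda>t. of_real \<nu> * u t + y t) - C"
  have \<delta>: "0 < \<delta>" using neg C by (simp add: \<delta>_def ennreal_leI not_le)
  have uy: "sq_int T u + sq_int T y \<le> C" if "0 < T" for T
    using cost_ge[OF L(1) Ly that] C by (simp add: ennreal_le_iff)
  define D where "D = 2 * C + (2 * \<epsilon>\<^sup>2 * C + 2 * C)"
  have v: "sq_int T v \<le> 2 * \<epsilon>\<^sup>2 * C + 2 * C" and u: "sq_int T u \<le> C" if "0 < T" for T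
  proof -
    show u: "sq_int T u \<le> C" using uy[OF that] sq_int_nonneg[of T y] by linarith
    have "sq_int T (\<lambda>t. of_real \<epsilon> * u t + - 1 * y t) \<le> 2 * sq_int T (\<lambda>t. of_real \<epsilon> * u t) + 2 * sq_int T (\<lambda>t. - 1 * y t)"
      by (intro sq_int_add_le L2_loc_cmult L Ly that)
    also have "(\<lambda>t. of_real \<epsilon> * u t + - 1 * y t) = v" by (simp add: y_def fun_eq_iff)
    finally have "sq_int T v \<le> 2 * \<epsilon>\<^sup>2 * sq_int T u + 2 * sq_int T y" unfolding sq_int_cmult by simp
    also have "\<dots> \<le> 2 * \<epsilon>\<^sup>2 * C + 2 * C"
      using uy[OF that] u sq_int_nonneg[of T u] by (intro add_mono mult_left_mono) auto
    finally show "sq_int T v \<le> 2 * \<epsilon>\<^sup>2 * C + 2 * C" .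
  qed
  have XT: "(norm (X T))\<^sup>2 \<le> (norm (X 0))\<^sup>2 + D" if "0 < T" for T
  proof -
    have "sq_int T (\<lambda>t. u t + - 1 * v t) \<le> 2 * sq_int T u + 2 * sq_int T (\<lambda>t. - 1 * v t)"
      by (intro sq_int_add_le L2_loc_cmult L that)
    then have "sq_int T (\<lambda>t. u t - v t) \<le> 2 * sq_int T u + 2 * sq_int T v" unfolding sq_int_cmult by simp
    then show ?thesis
      using weak_trajectory_energy[OF traj that] u[OF that] v[OF that] C(2) by (simp add: D_def)
  qed
  define D' where "D' = 3 * ((norm (X 0))\<^sup>2 + ((norm (X 0))\<^sup>2 + D)) + D"
  have obs: "(LINT t|lebesgue_on {0..T}. (norm (X t))\<^sup>2) \<le> D'" if "0 < T" for T
  proof -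
    have "sq_int T u + sq_int T v \<le> D" using u[OF that] v[OF that] C(2) by (simp add: D_def)
    then show ?thesis
      using weak_trajectory_observation[OF traj that] XT[OF that] unfolding D'_def
      by (simp add: algebra_simps)
  qed
  \<comment> \<open>After \<open>T0\<close> the accumulated square only grows, so a cost that stays
    below the bound by \<delta> leaves a residual energy with \<nu> |X T|^2 \<ge> \<delta>.\<close>
  have low: "\<delta> / \<nu> \<le> (norm (X T))\<^sup>2" if "T0 \<le> T" for T
  proof -
    have T: "0 < T" using that T0 by simp
    have "sq_int T0 (\<lambda>t. of_real \<nu> * u t + y t) \<le> sq_int T (\<lambda>t. of_real \<nu> * u t + y t)"
      by (rule sq_int_mono[OF Lz T0 that])
    moreover have "sq_int T u + sq_int T y = \<nu> * ((norm (X 0))\<^sup>2 - (norm (X T))\<^sup>2)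
        + sq_int T (\<lambda>t. of_real \<nu> * u t + y t)"
      using weak_trajectory_cost_Icc[OF traj T] unfolding y_def .
    ultimately have "\<delta> \<le> \<nu> * (norm (X T))\<^sup>2"
      using uy[OF T] by (simp add: \<delta>_def algebra_simps)
    then show ?thesis using lam_pos by (simp add: field_simps)
  qed
  \<comment> \<open>Long enough for an energy of at least \<delta> / \<nu> on [T0, T] to integrate
    to |D'| + 1, beyond the bound \<open>D'\<close> from the observation inequality.\<close>
  define T where "T = T0 + (\<bar>D'\<bar> + 1) / (\<delta> / \<nu>)"
  have pos: "0 < \<delta> / \<nu>" using \<delta> lam_pos by simp
  have "0 \<le> (\<bar>D'\<bar> + 1) / (\<delta> / \<nu>)" by (rule divide_nonneg_pos[OF _ pos]) simp
  then have T: "T0 \<le> T" "0 < T" using T0 unfolding T_def by linarith+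
  have "\<bar>D'\<bar> + 1 = (T - T0) * (\<delta> / \<nu>)" using \<delta> lam_pos by (simp add: T_def)
  also have "\<dots> = (LINT t|lebesgue_on {T0..T}. \<delta> / \<nu>)"
    using T by (simp add: measure_restrict_space)
  also have "\<dots> \<le> (LINT t|lebesgue_on {T0..T}. (norm (X t))\<^sup>2)"
  proof (rule integral_mono)
    show "integrable (lebesgue_on {T0..T}) (\<lambda>t. \<delta> / \<nu>)"
      by (rule finite_measure.integrable_const[OF finite_measure_Icc])
    show "integrable (lebesgue_on {T0..T}) (\<lambda>t. (norm (X t))\<^sup>2)"
      using T0 by (intro continuous_imp_integrable_real continuous_intros continuous_on_subset[OF cont]) auto
  qed (use low in auto)
  also have "\<dots> \<le> (LINT t|lebesgue_on {0..T}. (norm (X t))\<^sup>2)"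
    using T0 by (intro integral_mono_set integrable_continuous_power2[OF cont]) auto
  also have "\<dots> \<le> D'" by (rule obs[OF T(2)])
  finally show False by linarith
qed

text \<open>The lower bound contains the square on every horizon, so equality forces it to vanish.
  Conversely, without the square the cost up to T is \<nu> |X 0|^2 minus the final energy; dropping
  the latter gives the upper bound, and the lower bound closes the gap.\<close>

lemma cost_of_feedback:
  assumes traj: "weak_trajectory X u v"
  defines "y \<equiv> \<lambda>t. of_real \<epsilon> * u t - v t"
  shows "cost u y = ennreal (\<nu> * (norm (X 0))\<^sup>2) \<longleftrightarrow> (AE t in lebesgue_on {0..}. of_real \<nu> * u t + y t = 0)"
    and "ennreal (\<nu> * (norm (X 0))\<^sup>2) \<le> cost u y"
proof -
  have L: "L2_loc u" "L2_loc v" using weak_trajectory_L2_loc[OF traj] by auto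
  have Ly: "L2_loc y" unfolding y_def by (intro L2_loc_diff L2_loc_cmult L)
  have Lz: "L2_loc (\<lambda>t. of_real \<nu> * u t + y t)" by (intro L2_loc_add L2_loc_cmult L Ly)
  have lower: "ennreal (\<nu> * (norm (X 0))\<^sup>2 + sq_int T (\<lambda>t. of_real \<nu> * u t + y t)) \<le> cost u y" if "0 < T" for T
    using cost_lower_bound[OF traj that] unfolding y_def .
  have "ennreal (\<nu> * (norm (X 0))\<^sup>2) \<le> ennreal (\<nu> * (norm (X 0))\<^sup>2 + sq_int 1 (\<lambda>t. of_real \<nu> * u t + y t))"
    using sq_int_nonneg[of 1] by (intro ennreal_leI) simp
  also have "\<dots> \<le> cost u y" by (rule lower) simp
  finally show ge: "ennreal (\<nu> * (norm (X 0))\<^sup>2) \<le> cost u y" .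
  show "cost u y = ennreal (\<nu> * (norm (X 0))\<^sup>2) \<longleftrightarrow> (AE t in lebesgue_on {0..}. of_real \<nu> * u t + y t = 0)"
  proof
    assume eq: "cost u y = ennreal (\<nu> * (norm (X 0))\<^sup>2)"
    show "AE t in lebesgue_on {0..}. of_real \<nu> * u t + y t = 0"
      unfolding AE_atLeast_0_iff
    proof (intro allI impI)
      fix T :: real assume T: "0 < T"
      have "\<nu> * (norm (X 0))\<^sup>2 + sq_int T (\<lambda>t. of_real \<nu> * u t + y t) \<le> \<nu> * (norm (X 0))\<^sup>2"
        using lower[OF T] lam_pos unfolding eq by (subst (asm) ennreal_le_iff) auto
      then have "sq_int T (\<lambda>t. of_real \<nu> * u t + y t) = 0" using sq_int_nonneg[of T] by (smt (verit))
      then show "AE t in lebesgue_on {0..T}. of_real \<nu> * u t + y t = 0"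
        using sq_int_eq_zero_iff[OF Lz T] by simp
    qed
  next
    assume ae: "AE t in lebesgue_on {0..}. of_real \<nu> * u t + y t = 0"
    have "cost u y \<le> ennreal (\<nu> * (norm (X 0))\<^sup>2)"
    proof (rule cost_le[OF L(1) Ly])
      fix T :: real assume T: "0 < T"
      have "AE t in lebesgue_on {0..T}. of_real \<nu> * u t + y t = 0" using ae T by (simp add: AE_atLeast_0_iff)
      then have "sq_int T (\<lambda>t. of_real \<nu> * u t + y t) = 0" using sq_int_eq_zero_iff[OF Lz T] by simp
      then have "sq_int T u + sq_int T y = \<nu> * ((norm (X 0))\<^sup>2 - (norm (X T))\<^sup>2)"
        using weak_trajectory_cost_Icc[OF traj T] unfolding y_def by simp
      also have "\<dots> \<le> \<nu> * (norm (X 0))\<^sup>2"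
        using lam_pos by (intro mult_left_mono) auto
      finally show "sq_int T u + sq_int T y \<le> \<nu> * (norm (X 0))\<^sup>2" .
    qed
    with ge show "cost u y = ennreal (\<nu> * (norm (X 0))\<^sup>2)" by (rule antisym[rotated])
  qed
qed

end


section \<open>The beam closed by boundary damping\<close>

locale damped_beam =
  fixes \<kappa> :: real
  assumes kappa: "0 < \<kappa>"
begin

definition feedback :: "l2 \<times> l2 \<Rightarrow> complex" where
  "feedback X' = tip_velocity X' /\<^sub>R \<kappa>"

text \<open>The inverse of the generator of the closed loop \<open>w\<^sub>t(1) = \<kappa> w\<^sub>\<zeta>\<^sub>\<zeta>\<^sub>\<zeta>(1)\<close>.\<close>

definition inverse_generator :: "l2 \<times> l2 \<Rightarrow> l2 \<times> l2" where
  "inverse_generator X' = beam_state X' (feedback X')"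

lemma bounded_linear_feedback: "bounded_linear feedback"
  unfolding feedback_def[abs_def] by (intro bounded_linear_scaleR_const bounded_linear_tip_velocity
      bounded_linear_compose[OF bounded_linear_scaleR_right bounded_linear_tip_velocity])

lemma bounded_linear_inverse_generator: "bounded_linear inverse_generator"
  unfolding inverse_generator_def[abs_def] beam_state_def
  by (intro bounded_linear_Pair bounded_linear_minus bounded_linear_add
      bounded_linear_compose[OF bounded_linear_covolterra]
      bounded_linear_compose[OF bounded_linear_volterra]
      bounded_linear_compose[OF bounded_linear_const_l2]
      bounded_linear_feedback bounded_linear_fst bounded_linear_snd)

text \<open>By the energy identity the form equals - |v|^2 / \<kappa>, with v the tip
  velocity.\<close>

sublocale dissipative inverse_generator
proof (rule dissipative.intro)
  show "bounded_linear inverse_generator" by (rule bounded_linear_inverse_generator)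
  fix X :: "l2 \<times> l2"
  have "feedback X * cnj (tip_velocity X) = of_real ((cmod (tip_velocity X))\<^sup>2 / \<kappa>)"
    by (simp add: feedback_def scaleR_conv_of_real divide_inverse mult.assoc mult.commute
        flip: complex_norm_square of_real_power)
  then show "inverse_generator X \<bullet> X \<le> 0"
    using kappa by (simp add: inverse_generator_def beam_state_energy)
qed

lemma inverse_generator_eq_zero:
  assumes "inverse_generator X = 0"
  shows "X = 0"
proof -
  have "volterra (volterra (fst X)) = 0"
    and p: "covolterra (covolterra (snd X) + const_l2 (feedback X)) = 0"
    using assms by (auto simp: inverse_generator_def beam_state_def prod_eq_iff)
  then have fst0: "fst X = 0" by (auto dest!: volterra_eq_zero)
  then have "feedback X = 0"
    by (simp add: feedback_def tip_velocity_def linear_0[OF linear_volterra] linear_0[OF linear_integral_l2])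
  then have "covolterra (snd X) = 0"
    using covolterra_eq_zero[OF p] by (simp add: linear_0[OF linear_const_l2])
  then show ?thesis using fst0 covolterra_eq_zero by (simp add: prod_eq_iff)
qed

text \<open>With K the inverse generator, \<open>abstract_cauchy_problem\<close> yields classical
  solutions that start in the range of K^2. This range is reached by approximating twice, the second
  error being damped by the continuity of K.\<close>

lemma dense_domain_square: "\<exists>z. (\<lambda>n. inverse_generator (inverse_generator (z n))) \<longlonglongrightarrow> x"
proof -
  obtain w where w: "(\<lambda>n. inverse_generator (w n)) \<longlonglongrightarrow> x"
    using dense_range[OF inverse_generator_eq_zero] by blast
  have "\<exists>z. norm (inverse_generator z - w n) \<le> inverse (Suc n)" for n
  proof -
    obtain z where "(\<lambda>k. inverse_generator (z k)) \<longlonglongrightarrow> w n"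
      using dense_range[OF inverse_generator_eq_zero] by blast
    from LIMSEQ_D[OF this, of "inverse (Suc n)"] show ?thesis
      by (meson inverse_positive_iff_positive less_imp_le of_nat_0_less_iff order_refl zero_less_Suc)
  qed
  then obtain z where z: "\<And>n. norm (inverse_generator (z n) - w n) \<le> inverse (Suc n)" by metis
  have "(\<lambda>n. inverse_generator (z n) - w n) \<longlonglongrightarrow> 0"
    by (rule Lim_null_comparison[OF always_eventually LIMSEQ_inverse_real_of_nat]) (use z in auto)
  then have "(\<lambda>n. inverse_generator (inverse_generator (z n) - w n) + inverse_generator (w n)) \<longlonglongrightarrow> inverse_generator 0 + x"
    by (intro tendsto_add K.tendsto w)
  then show ?thesis by (auto simp: K.diff K.zero)
qed

lemma closed_loop_trajectory:
  "\<exists>X X'. trajectory X X' (\<lambda>t. feedback (X' t)) \<and> X 0 = inverse_generator (inverse_generator z)"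
proof -
  obtain y where y: "y 0 = inverse_generator z" "continuous_on {0..} y"
    "\<And>t. 0 \<le> t \<Longrightarrow> ((\<lambda>t. inverse_generator (y t)) has_vector_derivative y t) (at t within {0..})"
    using abstract_cauchy_problem[of z] by blast
  then have "trajectory (\<lambda>t. inverse_generator (y t)) y (\<lambda>t. feedback (y t))"
    by (auto simp: trajectory_def inverse_generator_def
        intro!: bounded_linear.continuous_on[OF bounded_linear_feedback])
  then show ?thesis using y(1) by (intro exI[of _ "\<lambda>t. inverse_generator (y t)"] exI[of _ y]) simp
qed

lemma tip_velocity_feedback: "tip_velocity X' = of_real \<kappa> * feedback X'"
  using kappa by (simp add: feedback_def scaleR_conv_of_real)

text \<open>Insert v = \<kappa> u into the balance: (1 - \<kappa>)^2 - 1 - \<kappa>^2 = - 2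
  \<kappa>. One identity controls both the state and the input.\<close>

lemma closed_loop_energy:
  assumes "trajectory X X' (\<lambda>t. feedback (X' t))" "0 < T"
  shows "(norm (X T))\<^sup>2 + 2 * \<kappa> * sq_int T (\<lambda>t. feedback (X' t)) = (norm (X 0))\<^sup>2"
proof -
  let ?u = "\<lambda>t. feedback (X' t)"
  have "sq_int T (\<lambda>t. ?u t - tip_velocity (X' t)) = sq_int T (\<lambda>t. of_real (1 - \<kappa>) * ?u t)"
    by (simp add: tip_velocity_feedback algebra_simps)
  also have "\<dots> = (1 - \<kappa>)\<^sup>2 * sq_int T ?u" unfolding sq_int_cmult norm_of_real by simp
  finally have "(norm (X T))\<^sup>2 - (norm (X 0))\<^sup>2 = (1 - \<kappa>)\<^sup>2 * sq_int T ?u - sq_int T ?u - \<kappa>\<^sup>2 * sq_int T ?u"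
    using trajectory_energy[OF assms] sq_int_cmult[of T "of_real \<kappa>" ?u]
    by (simp add: tip_velocity_feedback)
  then show ?thesis by (simp add: power2_eq_square algebra_simps)
qed

text \<open>Extension by density. For the difference of two classical solutions the energy identity
  bounds the states uniformly in time, and the inputs in L^2 of the half-line, by the distance of
  the initial states; hence both form Cauchy sequences.\<close>

theorem closed_loop_exists:
  "\<exists>X u. weak_trajectory X u (\<lambda>t. of_real \<kappa> * u t) \<and> X 0 = x"
proof -
  obtain z where z: "(\<lambda>n. inverse_generator (inverse_generator (z n))) \<longlonglongrightarrow> x"
    using dense_domain_square by blast
  have "\<exists>X X'. trajectory X X' (\<lambda>t. feedback (X' t)) \<and> X 0 = inverse_generator (inverse_generator (z n))" for n
    by (rule closed_loop_trajectory)
  then obtain X X' where traj: "\<And>n. trajectory (X n) (X' n) (\<lambda>t. feedback (X' n t))"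
    and X0: "\<And>n. X n 0 = inverse_generator (inverse_generator (z n))" by metis
  define u where "u n t = feedback (X' n t)" for n t
  have Lu: "L2_loc (u n)" for n using trajectory_L2_loc(1)[OF traj[of n]] by (simp add: u_def[abs_def])
  have diff: "(norm (X n T - X m T))\<^sup>2 + 2 * \<kappa> * sq_int T (\<lambda>t. u n t - u m t) = (norm (X n 0 - X m 0))\<^sup>2"
    if "0 < T" for n m T
  proof -
    have lin: "feedback (a - b) = feedback a - feedback b" for a b
      by (rule linear_diff[OF bounded_linear.linear[OF bounded_linear_feedback]])
    have "trajectory (\<lambda>t. X n t - X m t) (\<lambda>t. X' n t - X' m t) (\<lambda>t. feedback (X' n t - X' m t))"
      using trajectory_diff[OF traj[of n] traj[of m]] by (simp add: lin)
    from closed_loop_energy[OF this that] show ?thesis by (simp add: u_def lin)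
  qed
  have C0: "Cauchy (\<lambda>n. X n 0)" using z by (simp add: X0 LIMSEQ_imp_Cauchy)
  have dist: "norm (X n T - X m T) \<le> norm (X n 0 - X m 0)" if "0 \<le> T" for n m T
  proof (cases "T = 0")
    case False
    then have "(norm (X n T - X m T))\<^sup>2 \<le> (norm (X n 0 - X m 0))\<^sup>2"
      using diff[of T n m] that kappa sq_int_nonneg[of T "\<lambda>t. u n t - u m t"]
      by (smt (verit) mult_nonneg_nonneg)
    then show ?thesis by (rule power2_le_imp_le) simp
  qed simp
  have "uniformly_Cauchy_on {0..} X"
    unfolding uniformly_Cauchy_on_def
  proof (intro allI impI)
    fix e :: real assume "0 < e"
    then obtain M where "\<And>m n. m \<ge> M \<Longrightarrow> n \<ge> M \<Longrightarrow> dist (X m 0) (X n 0) < e"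
      using metric_CauchyD[OF C0] by blast
    then show "\<exists>M. \<forall>t\<in>{0..}. \<forall>m\<ge>M. \<forall>n\<ge>M. dist (X m t) (X n t) < e"
    proof (intro exI ballI allI impI)
      fix t :: real and m n assume "t \<in> {0..}" "m \<ge> M" "n \<ge> M"
      then show "dist (X m t) (X n t) < e"
        using dist[of t m n] \<open>\<And>m n. m \<ge> M \<Longrightarrow> n \<ge> M \<Longrightarrow> dist (X m 0) (X n 0) < e\<close>[of m n]
        by (simp add: dist_norm)
    qed
  qed
  then obtain Y where Y: "uniform_limit {0..} X Y sequentially"
    using Cauchy_uniformly_convergent uniformly_convergent_on_def by blast
  have cont: "continuous_on {0..} Y"
    by (rule uniform_limit_theorem[OF _ Y]) (auto intro!: always_eventually trajectory_continuous[OF traj])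
  have "(\<lambda>n. X n 0) \<longlonglongrightarrow> Y 0" by (rule tendsto_uniform_limitI[OF Y]) simp
  then have Y0: "Y 0 = x" using z LIMSEQ_unique by (simp add: X0)
  have u_int: "square_integrable {0..} (u n)" for n
  proof (rule square_integrable_atLeastI(1)[OF Lu])
    fix T :: real assume "0 < T"
    then have "2 * \<kappa> * sq_int T (u n) \<le> (norm (X n 0))\<^sup>2"
      using closed_loop_energy[OF traj[of n], of T] by (simp add: u_def[abs_def]) (smt (verit) zero_le_power2)
    then show "sq_int T (u n) \<le> (norm (X n 0))\<^sup>2 / (2 * \<kappa>)" using kappa by (simp add: field_simps)
  qed
  have u_diff: "(LINT t|lebesgue_on {0..}. (cmod (u n t - u m t))\<^sup>2) \<le> (norm (X n 0 - X m 0))\<^sup>2 / (2 * \<kappa>)" for n m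
  proof (rule square_integrable_atLeastI(2)[OF L2_loc_diff[OF Lu Lu]])
    fix T :: real assume "0 < T"
    then have "2 * \<kappa> * sq_int T (\<lambda>t. u n t - u m t) \<le> (norm (X n 0 - X m 0))\<^sup>2"
      using diff[of T n m] by (smt (verit) zero_le_power2)
    then show "sq_int T (\<lambda>t. u n t - u m t) \<le> (norm (X n 0 - X m 0))\<^sup>2 / (2 * \<kappa>)"
      using kappa by (simp add: field_simps)
  qed
  \<comment> \<open>Completeness on the whole half-line gives a single \<open>F\<close> that serves
    all bounded intervals.\<close>
  have "\<exists>F. F \<in> borel_measurable (lebesgue_on {0..}) \<and> integrable (lebesgue_on {0..}) (\<lambda>t. (cmod (F t))\<^sup>2) \<and>
    (\<lambda>n. LINT t|lebesgue_on {0..}. (cmod (u n t - F t))\<^sup>2) \<longlonglongrightarrow> 0"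
  proof (rule riesz_fischer)
    show "\<exists>N. \<forall>m\<ge>N. \<forall>n\<ge>N. (LINT t|lebesgue_on {0..}. (cmod (u m t - u n t))\<^sup>2) < e" if "0 < e" for e
    proof -
      have pos: "0 < sqrt (2 * \<kappa> * e)" using that kappa by simp
      obtain N where N: "\<And>m n. m \<ge> N \<Longrightarrow> n \<ge> N \<Longrightarrow> dist (X m 0) (X n 0) < sqrt (2 * \<kappa> * e)"
        using metric_CauchyD[OF C0 pos] by blast
      have "(LINT t|lebesgue_on {0..}. (cmod (u m t - u n t))\<^sup>2) < e" if "m \<ge> N" "n \<ge> N" for m n
      proof -
        have "(norm (X m 0 - X n 0))\<^sup>2 < (sqrt (2 * \<kappa> * e))\<^sup>2"
          using N[OF that] by (intro power_strict_mono) (auto simp: dist_norm)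
        then have "(norm (X m 0 - X n 0))\<^sup>2 / (2 * \<kappa>) < e"
          using kappa \<open>0 < e\<close> by (simp add: field_simps)
        then show ?thesis using u_diff[of m n] by simp
      qed
      then show ?thesis by blast
    qed
  qed (use u_int in \<open>auto simp: square_integrable_def\<close>)
  then obtain F where F: "square_integrable {0..} F"
    and lim: "(\<lambda>n. LINT t|lebesgue_on {0..}. (cmod (u n t - F t))\<^sup>2) \<longlonglongrightarrow> 0"
    by (auto simp: square_integrable_def)
  have limF: "L2_loc_limit u F"
    unfolding L2_loc_limit_iff
  proof (intro conjI allI impI Lu square_integrable_atLeast_L2_loc F)
    fix T :: real assume "0 < T"
    have "sq_int T (\<lambda>t. u n t - F t) \<le> (LINT t|lebesgue_on {0..}. (cmod (u n t - F t))\<^sup>2)" for n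
      unfolding sq_int_def using square_integrable_diff[OF u_int[of n] F]
      by (intro integral_mono_set) (auto simp: square_integrable_def)
    then show "(\<lambda>n. sq_int T (\<lambda>t. u n t - F t)) \<longlonglongrightarrow> 0"
      by (intro Lim_null_comparison[OF always_eventually lim]) (auto simp: sq_int_nonneg)
  qed
  have "weak_trajectory Y F (\<lambda>t. of_real \<kappa> * F t)"
    unfolding weak_trajectory_def
  proof (intro conjI cont exI allI impI)
    show "trajectory (X k) (X' k) (u k)" for k using traj by (simp add: u_def[abs_def])
    show "uniform_limit {0..T} X Y sequentially" for T
      using Y by (rule uniform_limit_on_subset) auto
    show "L2_loc_limit (\<lambda>k t. tip_velocity (X' k t)) (\<lambda>t. of_real \<kappa> * F t)"
      using L2_loc_limit_cmult[OF limF, of "of_real \<kappa>"] by (simp add: tip_velocity_feedback u_def)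
  qed (rule limF)
  with Y0 show ?thesis by blast
qed

end

section \<open>States and weak derivatives\<close>

lemma has_weak_deriv_iff:
  "has_weak_deriv f g \<longleftrightarrow> square_integrable {0..1} g \<and> (\<forall>\<zeta>\<in>{0..1}. f \<zeta> = f 0 + integral {0..\<zeta>} g)"
  unfolding has_weak_deriv_def by (intro conj_cong ball_cong refl) (simp add: integral_eq_HK)

lemma has_weak_deriv_square_integrable: "has_weak_deriv f g \<Longrightarrow> square_integrable {0..1} g"
  by (simp add: has_weak_deriv_def)

lemma has_weak_deriv_continuous:
  assumes "has_weak_deriv f g"
  shows "continuous_on {0..1} f"
proof -
  have "continuous_on {0..1} (\<lambda>\<zeta>. f 0 + integral {0..\<zeta>} g)"
    by (intro continuous_intros continuous_on_indefinite_integral has_weak_deriv_square_integrable[OF assms])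
  moreover have "f 0 + integral {0..\<zeta>} g = f \<zeta>" if "\<zeta> \<in> {0..1}" for \<zeta>
    using assms that unfolding has_weak_deriv_iff by metis
  ultimately show ?thesis by (rule continuous_on_eq)
qed

lemma has_weak_deriv_cong:
  assumes "\<And>x. x \<in> {0..1} \<Longrightarrow> f x = f' x"
  shows "has_weak_deriv f g \<longleftrightarrow> has_weak_deriv f' g"
  using assms[of 0] assms by (auto simp: has_weak_deriv_def)

lemma has_weak_deriv_diff:
  assumes "has_weak_deriv f g" "has_weak_deriv f' g'"
  shows "has_weak_deriv (\<lambda>x. f x - f' x) (\<lambda>x. g x - g' x)"
  unfolding has_weak_deriv_iff
proof (intro conjI ballI)
  show "square_integrable {0..1} (\<lambda>x. g x - g' x)"
    using assms by (intro square_integrable_diff) (auto simp: has_weak_deriv_iff)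
  fix \<zeta> :: real assume z: "\<zeta> \<in> {0..1}"
  have "integral {0..\<zeta>} (\<lambda>x. g x - g' x) = integral {0..\<zeta>} g - integral {0..\<zeta>} g'"
    using assms z by (intro Henstock_Kurzweil_Integration.integral_diff square_integrable_integrable_on)
      (auto simp: has_weak_deriv_iff)
  moreover have "f \<zeta> = f 0 + integral {0..\<zeta>} g" "f' \<zeta> = f' 0 + integral {0..\<zeta>} g'"
    using assms z unfolding has_weak_deriv_iff by blast+
  ultimately show "f \<zeta> - f' \<zeta> = f 0 - f' 0 + integral {0..\<zeta>} (\<lambda>x. g x - g' x)" by simp
qed

lemma has_weak_deriv_cmult:
  assumes "has_weak_deriv f g"
  shows "has_weak_deriv (\<lambda>x. c * f x) (\<lambda>x. c * g x)"
  unfolding has_weak_deriv_iff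
proof (intro conjI ballI)
  show "square_integrable {0..1} (\<lambda>x. c * g x)"
    using assms by (intro square_integrable_cmult) (auto simp: has_weak_deriv_iff)
  fix \<zeta> :: real assume z: "\<zeta> \<in> {0..1}"
  then have "f \<zeta> = f 0 + integral {0..\<zeta>} g" using assms unfolding has_weak_deriv_iff by blast
  then show "c * f \<zeta> = c * f 0 + integral {0..\<zeta>} (\<lambda>x. c * g x)" by (simp add: distrib_left)
qed

lemma has_weak_deriv_indefinite_integral:
  assumes "square_integrable {0..1} g"
  shows "has_weak_deriv (\<lambda>\<zeta>. c + integral {0..\<zeta>} g) g"
  using assms by (simp add: has_weak_deriv_iff)

lemma has_weak_deriv_unique:
  assumes "has_weak_deriv f g" "has_weak_deriv f h"
  shows "AE x in lebesgue_on {0..1}. g x = h x"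
proof -
  have gh: "has_weak_deriv (\<lambda>x. 0) (\<lambda>x. g x - h x)"
    using has_weak_deriv_diff[OF assms] by simp
  then have "AE x in lebesgue_on {0..1}. g x - h x = 0"
    by (intro AE_zero_if_integrals_zero) (auto simp: has_weak_deriv_iff)
  then show ?thesis by simp
qed

lemma wderiv_cong:
  assumes "\<And>x. x \<in> {0..1} \<Longrightarrow> f x = f' x"
  shows "wderiv f = wderiv f'"
  unfolding wderiv_def using has_weak_deriv_cong[of f f'] assms by simp

text \<open>Two weak derivatives agree almost everywhere, and two continuous ones agree everywhere
  on [0,1]. This pins down the choice made in \<open>wderiv\<close>, including its values at 0 and
  1.\<close>

lemma wderiv_properties:
  assumes "has_weak_deriv f g"
  shows has_weak_deriv_wderiv: "has_weak_deriv f (wderiv f)"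
    and wderiv_AE_eq: "AE x in lebesgue_on {0..1}. wderiv f x = g x"
    and wderiv_eq: "continuous_on {0..1} g \<Longrightarrow> x \<in> {0..1} \<Longrightarrow> wderiv f x = g x"
proof -
  have "\<exists>g. has_weak_deriv f g \<and> ((\<exists>h. has_weak_deriv f h \<and> continuous_on {0..1} h) \<longrightarrow> continuous_on {0..1} g)"
    using assms by blast
  then have w: "has_weak_deriv f (wderiv f) \<and>
      ((\<exists>h. has_weak_deriv f h \<and> continuous_on {0..1} h) \<longrightarrow> continuous_on {0..1} (wderiv f))"
    unfolding wderiv_def by (rule someI_ex)
  then show "has_weak_deriv f (wderiv f)" by simp
  then show ae: "AE x in lebesgue_on {0..1}. wderiv f x = g x"
    using assms by (rule has_weak_deriv_unique)
  show "wderiv f x = g x" if "continuous_on {0..1} g" "x \<in> {0..1}"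
  proof -
    have "continuous_on {0..1} (\<lambda>x. wderiv f x - g x)"
      using w assms that(1) by (auto intro!: continuous_intros)
    moreover have "AE x in lebesgue_on {0..1}. wderiv f x - g x = 0" using ae by simp
    ultimately have "wderiv f x - g x = 0" using that(2) by (rule continuous_AE_zero)
    then show ?thesis by simp
  qed
qed

lemma wderiv_wderiv:
  assumes "has_weak_deriv f g" "has_weak_deriv g h"
  shows "wderiv (wderiv f) = wderiv g" "x \<in> {0..1} \<Longrightarrow> wderiv f x = g x"
proof -
  show eq: "wderiv f x = g x" if "x \<in> {0..1}" for x
    by (rule wderiv_eq[OF assms(1) has_weak_deriv_continuous[OF assms(2)] that])
  show "wderiv (wderiv f) = wderiv g" by (rule wderiv_cong) (rule eq)
qed

lemma sobolev_cong:
  assumes "\<And>x. x \<in> {0..1} \<Longrightarrow> f x = f' x" "f \<in> sobolev k"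
  shows "f' \<in> sobolev k"
proof (cases k)
  case 0
  then show ?thesis using assms square_integrable_cong[of "{0..1}" f f'] by simp
next
  case (Suc n)
  have "has_weak_deriv f = has_weak_deriv f'"
    by (rule ext) (rule has_weak_deriv_cong[OF assms(1)])
  then show ?thesis using assms(2) Suc by simp
qed

text \<open>For k > 0 membership in \<open>sobolev k\<close> depends on pointwise values; but then
  the derivative has a continuous representative, with which \<open>wderiv\<close> coincides on
  [0,1].\<close>

lemma wderiv_sobolev:
  assumes "f \<in> sobolev (Suc k)"
  shows "has_weak_deriv f (wderiv f)" "wderiv f \<in> sobolev k"
proof -
  obtain g where g: "g \<in> sobolev k" "has_weak_deriv f g" using assms by auto
  show w: "has_weak_deriv f (wderiv f)" by (rule has_weak_deriv_wderiv[OF g(2)])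
  show "wderiv f \<in> sobolev k"
  proof (cases k)
    case 0
    then show ?thesis using w by (simp add: has_weak_deriv_def)
  next
    case (Suc n)
    then obtain h where "has_weak_deriv g h" using g(1) by auto
    then show ?thesis
      using sobolev_cong[OF _ g(1), of "wderiv f"] wderiv_eq[OF g(2) has_weak_deriv_continuous] by simp
  qed
qed

lemma sobolev_2_iff: "f \<in> sobolev 2 \<longleftrightarrow> (\<exists>g h. has_weak_deriv f g \<and> has_weak_deriv g h)"
  by (auto simp: numeral_2_eq_2 has_weak_deriv_def)

text \<open>The state \<open>(w, w\<^sub>t)\<close> is represented by \<open>(w\<^sub>\<zeta>\<^sub>\<zeta>, w\<^sub>t)\<close>, which identifies the state space with
  \<open>L\<^sup>2 \<times> L\<^sup>2\<close> isometrically.\<close>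

definition state_class :: "state \<Rightarrow> l2 \<times> l2" where
  "state_class f = (abs_l2 ((wderiv ^^ 2) (fst f)), abs_l2 (snd f))"

lemma funpow_wderiv_2: "(wderiv ^^ 2) f = wderiv (wderiv f)"
  by (simp add: numeral_2_eq_2)

section \<open>Transfer between states and their classes\<close>

lemma state_class_eq:
  assumes "has_weak_deriv f g" "has_weak_deriv g h"
  shows "abs_l2 ((wderiv ^^ 2) f) = abs_l2 h" "square_integrable {0..1} ((wderiv ^^ 2) f)"
proof -
  have "(wderiv ^^ 2) f = wderiv g" by (simp add: funpow_wderiv_2 wderiv_wderiv[OF assms])
  moreover show "square_integrable {0..1} ((wderiv ^^ 2) f)"
    unfolding calculation using has_weak_deriv_wderiv[OF assms(2)] by (simp add: has_weak_deriv_def)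
  ultimately show "abs_l2 ((wderiv ^^ 2) f) = abs_l2 h"
    using wderiv_AE_eq[OF assms(2)] has_weak_deriv_square_integrable[OF assms(2)]
    by (subst abs_l2_eq_iff) auto
qed

lemma state_spaceI:
  assumes "has_weak_deriv f1 g" "has_weak_deriv g h" "f1 0 = 0" "g 0 = 0" "square_integrable {0..1} f2"
  shows "(f1, f2) \<in> state_space" "state_class (f1, f2) = (abs_l2 h, abs_l2 f2)"
  using assms wderiv_wderiv(2)[OF assms(1,2), of 0] state_class_eq[OF assms(1,2)]
  by (auto simp: state_space_def sobolev_2_iff state_class_def)

lemma state_spaceE:
  assumes "x \<in> state_space"
  obtains g h where "has_weak_deriv (fst x) g" "has_weak_deriv g h" "fst x 0 = 0" "g 0 = 0"
    "square_integrable {0..1} (snd x)" "state_class x = (abs_l2 h, abs_l2 (snd x))"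
proof -
  obtain f1 f2 where x: "x = (f1, f2)" by (cases x)
  then obtain g h where gh: "has_weak_deriv f1 g" "has_weak_deriv g h"
    using assms by (auto simp: state_space_def sobolev_2_iff)
  show thesis
    using that[of g h] gh assms x wderiv_wderiv(2)[OF gh, of 0] state_class_eq[OF gh]
    by (auto simp: state_space_def state_class_def)
qed

lemma state_diff_class:
  assumes "x \<in> state_space" "y \<in> state_space"
  shows "state_diff x y \<in> state_space" "state_class (state_diff x y) = state_class x - state_class y"
proof -
  obtain g h where x: "has_weak_deriv (fst x) g" "has_weak_deriv g h" "fst x 0 = 0" "g 0 = 0"
    "square_integrable {0..1} (snd x)" "state_class x = (abs_l2 h, abs_l2 (snd x))"
    using assms(1) by (rule state_spaceE)
  obtain g' h' where y: "has_weak_deriv (fst y) g'" "has_weak_deriv g' h'" "fst y 0 = 0" "g' 0 = 0"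
    "square_integrable {0..1} (snd y)" "state_class y = (abs_l2 h', abs_l2 (snd y))"
    using assms(2) by (rule state_spaceE)
  note sq = has_weak_deriv_square_integrable[OF x(2)] has_weak_deriv_square_integrable[OF y(2)] x(5) y(5)
  note I = state_spaceI[OF has_weak_deriv_diff[OF x(1) y(1)] has_weak_deriv_diff[OF x(2) y(2)] _ _
      square_integrable_diff[OF x(5) y(5)]]
  show "state_diff x y \<in> state_space" unfolding state_diff_def using I(1) x y by simp
  show "state_class (state_diff x y) = state_class x - state_class y"
    unfolding state_diff_def using I(2) x y sq by (simp add: minus_l2.abs_eq l2rel_refl)
qed

lemma state_scale_class:
  assumes "x \<in> state_space"
  shows "state_scale c x \<in> state_space" "state_class (state_scale c x) = c *\<^sub>R state_class x"
proof -
  obtain g h where x: "has_weak_deriv (fst x) g" "has_weak_deriv g h" "fst x 0 = 0" "g 0 = 0"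
    "square_integrable {0..1} (snd x)" "state_class x = (abs_l2 h, abs_l2 (snd x))"
    using assms(1) by (rule state_spaceE)
  note I = state_spaceI[OF has_weak_deriv_cmult[OF x(1), of "of_real c"]
      has_weak_deriv_cmult[OF x(2), of "of_real c"] _ _ square_integrable_cmult[OF x(5), of "of_real c"]]
  show "state_scale c x \<in> state_space" unfolding state_scale_def using I(1) x by simp
  show "state_class (state_scale c x) = c *\<^sub>R state_class x"
    unfolding state_scale_def using I(2) x has_weak_deriv_square_integrable[OF x(2)]
    by (simp add: scaleR_l2.abs_eq l2rel_refl)
qed

lemma state_norm_class:
  assumes "x \<in> state_space"
  shows "state_norm x = norm (state_class x)"
proof -
  let ?w = "(wderiv ^^ 2) (fst x)"
  have sq: "square_integrable {0..1} ?w" "square_integrable {0..1} (snd x)"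
    using assms by (auto elim!: state_spaceE simp: state_class_eq(2))
  have "Re (state_inner x x) = Re (LINT \<zeta>|lebesgue_on {0..1}. ?w \<zeta> * cnj (?w \<zeta>))
      + Re (LINT \<zeta>|lebesgue_on {0..1}. snd x \<zeta> * cnj (snd x \<zeta>))"
    unfolding state_inner_def using sq by (subst Bochner_Integration.integral_add) (auto intro: square_integrable_mult_cnj)
  also have "\<dots> = (norm (abs_l2 ?w))\<^sup>2 + (norm (abs_l2 (snd x)))\<^sup>2"
    using sq by (simp add: norm_abs_l2 integral_square)
  finally show ?thesis by (simp add: state_norm_def state_class_def norm_prod_def)
qed

lemma state_norm_diff:
  "x \<in> state_space \<Longrightarrow> y \<in> state_space \<Longrightarrow> state_norm (state_diff x y) = norm (state_class x - state_class y)"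
  by (simp add: state_norm_class state_diff_class)

text \<open>A right inverse of \<open>state_class\<close>: the double primitive from 0 meets the
  clamped conditions automatically.\<close>

definition state_of :: "l2 \<times> l2 \<Rightarrow> state" where
  "state_of X = (\<lambda>\<zeta>. integral {0..\<zeta>} (\<lambda>s. integral {0..s} (rep_l2 (fst X))), rep_l2 (snd X))"

lemma state_of: "state_of X \<in> state_space" "state_class (state_of X) = X"
proof -
  define h where "h = rep_l2 (fst X)"
  have h: "square_integrable {0..1} h" by (simp add: h_def square_integrable_rep_l2)
  note I = state_spaceI[OF has_weak_deriv_indefinite_integral[OF square_integrable_indefinite_integral[OF h], of 0, simplified]
      has_weak_deriv_indefinite_integral[OF h, of 0, simplified] _ _ square_integrable_rep_l2[of "snd X"], simplified]
  show "state_of X \<in> state_space" "state_class (state_of X) = X"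
    using I by (auto simp: state_of_def h_def)
qed

lemma state_continuous_iff:
  "state_continuous x \<longleftrightarrow> (\<forall>t\<ge>0. x t \<in> state_space) \<and> continuous_on {0..} (\<lambda>t. state_class (x t))"
proof (cases "\<forall>t\<ge>0. x t \<in> state_space")
  case True
  have "((\<lambda>s. state_norm (state_diff (x s) (x t))) \<longlongrightarrow> 0) (at t within {0..}) \<longleftrightarrow>
      ((\<lambda>s. state_class (x s)) \<longlongrightarrow> state_class (x t)) (at t within {0..})" if "0 \<le> t" for t
  proof -
    have "((\<lambda>s. state_norm (state_diff (x s) (x t))) \<longlongrightarrow> 0) (at t within {0..}) \<longleftrightarrow>
        ((\<lambda>s. norm (state_class (x s) - state_class (x t))) \<longlongrightarrow> 0) (at t within {0..})"
      using True that by (intro Lim_cong_within) (auto simp: state_norm_diff)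
    then show ?thesis by (simp add: tendsto_norm_zero_iff LIM_zero_iff)
  qed
  with True show ?thesis by (auto simp: state_continuous_def continuous_on_def)
qed (auto simp: state_continuous_def)

lemma state_C1_iff:
  "state_C1 x x' \<longleftrightarrow> state_continuous x \<and> state_continuous x' \<and>
    (\<forall>t\<ge>0. ((\<lambda>t. state_class (x t)) has_vector_derivative state_class (x' t)) (at t within {0..}))"
proof (cases "state_continuous x \<and> state_continuous x'")
  case True
  then have x: "\<And>t. 0 \<le> t \<Longrightarrow> x t \<in> state_space" "\<And>t. 0 \<le> t \<Longrightarrow> x' t \<in> state_space"
    by (auto simp: state_continuous_def)
  let ?N = "\<lambda>s t. state_norm (state_diff (state_scale (1 / (s - t)) (state_diff (x s) (x t))) (x' t))"
  have "((\<lambda>s. ?N s t) \<longlongrightarrow> 0) (at t within {0..})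
    \<longleftrightarrow> ((\<lambda>t. state_class (x t)) has_vector_derivative state_class (x' t)) (at t within {0..})" if t: "0 \<le> t" for t
  proof -
    let ?F = "\<lambda>t. state_class (x t)" and ?D = "state_class (x' t)"
    have "?N s t
        = norm (?F s - ?F t - (s - t) *\<^sub>R ?D) / norm (s - t)" if s: "0 \<le> s" "s \<noteq> t" for s
    proof -
      have "?N s t
          = norm ((1 / (s - t)) *\<^sub>R (?F s - ?F t) - ?D)"
        using x s t by (simp add: state_norm_diff state_scale_class state_diff_class)
      also have "(1 / (s - t)) *\<^sub>R (?F s - ?F t) - ?D = (1 / (s - t)) *\<^sub>R (?F s - ?F t - (s - t) *\<^sub>R ?D)"
        using s by (simp add: scaleR_diff_right)
      finally show ?thesis by (simp add: divide_inverse)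
    qed
    then have "((\<lambda>s. ?N s t) \<longlongrightarrow> 0) (at t within {0..})
      \<longleftrightarrow> ((\<lambda>s. norm (?F s - ?F t - (s - t) *\<^sub>R ?D) / norm (s - t)) \<longlongrightarrow> 0) (at t within {0..})"
      by (intro Lim_cong_within) auto
    then show ?thesis
      by (simp add: has_vector_derivative_def has_derivative_iff_norm bounded_linear_scaleR_left)
  qed
  with True show ?thesis by (simp add: state_C1_def)
qed (auto simp: state_C1_def)

text \<open>The fundamental theorem of calculus in \<open>l2\<close>, and the bridge from point
  values to operators: \<open>volterra\<close> uses the value at 0, \<open>covolterra\<close> the
  value at 1.\<close>

lemma has_weak_deriv_l2:
  assumes "has_weak_deriv f g"
  shows "volterra (abs_l2 g) = abs_l2 f - const_l2 (f 0)" "integral_l2 (abs_l2 g) = f 1 - f 0"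
    "covolterra (abs_l2 g) = const_l2 (f 1) - abs_l2 f"
proof -
  have g: "square_integrable {0..1} g" by (rule has_weak_deriv_square_integrable[OF assms])
  have f: "square_integrable {0..1} f" by (rule square_integrable_continuous[OF has_weak_deriv_continuous[OF assms]])
  have eq: "integral {0..\<zeta>} g = f \<zeta> - f 0" if "\<zeta> \<in> {0..1}" for \<zeta>
  proof -
    have "f \<zeta> = f 0 + integral {0..\<zeta>} g" using assms that unfolding has_weak_deriv_iff by blast
    then show ?thesis by simp
  qed
  have "volterra (abs_l2 g) = abs_l2 (\<lambda>\<zeta>. integral {0..\<zeta>} g)"
    using g by (simp add: volterra.abs_eq l2rel_refl)
  also have "\<dots> = abs_l2 (\<lambda>\<zeta>. f \<zeta> - f 0)"
    by (rule abs_l2_cong[OF square_integrable_indefinite_integral[OF g] eq])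
  also have "\<dots> = abs_l2 f - const_l2 (f 0)"
    using f by (simp add: const_l2.abs_eq minus_l2.abs_eq l2rel_refl square_integrable_const)
  finally show V: "volterra (abs_l2 g) = abs_l2 f - const_l2 (f 0)" .
  show T: "integral_l2 (abs_l2 g) = f 1 - f 0"
    using g eq[of 1] by (simp add: integral_l2.abs_eq l2rel_refl)
  show "covolterra (abs_l2 g) = const_l2 (f 1) - abs_l2 f"
    by (simp add: covolterra_def V T linear_diff[OF linear_const_l2])
qed

text \<open>Integrate back from the image. The fourth derivative of w is integrated from the free
  end, where the third equals u and the second equals 0; the second derivative of w_t from the
  clamped end, where w_t and its slope vanish.\<close>

lemma beam_domain_state:
  assumes "(x, u) \<in> beam_domain"
  shows "state_class x = beam_state (state_class (beam_AB x u)) u"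
    "snd x 1 = tip_velocity (state_class (beam_AB x u))"
proof -
  define d where "d k = (wderiv ^^ k) (fst x)" for k
  have d0: "fst x \<in> sobolev (Suc (Suc (Suc (Suc 0))))" "snd x \<in> sobolev (Suc (Suc 0))"
    using assms by (simp_all add: beam_domain_def numeral_eq_Suc)
  note d1 = wderiv_sobolev[OF d0(1)] note d2 = wderiv_sobolev[OF d1(2)]
  note d3 = wderiv_sobolev[OF d2(2)] note d4 = wderiv_sobolev[OF d3(2)]
  note e1 = wderiv_sobolev[OF d0(2)] note e2 = wderiv_sobolev[OF e1(2)]
  have D: "has_weak_deriv (d 2) (d 3)" "has_weak_deriv (d 3) (d 4)"
    using d3(1) d4(1) by (simp_all add: d_def numeral_eq_Suc)
  have bc: "snd x 0 = 0" "wderiv (snd x) 0 = 0" "d 2 1 = 0" "d 3 1 = u"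
    using assms by (simp_all add: beam_domain_def d_def)
  have cls: "state_class (beam_AB x u) = (abs_l2 (wderiv (wderiv (snd x))), - abs_l2 (d 4))"
    using has_weak_deriv_square_integrable[OF D(2)]
    by (simp add: state_class_def beam_AB_def d_def funpow_wderiv_2 uminus_l2.abs_eq l2rel_refl)
  have "covolterra (- abs_l2 (d 4)) + const_l2 u = abs_l2 (d 3)"
    using has_weak_deriv_l2(3)[OF D(2)] bc(4)
    by (simp add: linear_neg[OF bounded_linear.linear[OF bounded_linear_covolterra]])
  moreover have "- covolterra (abs_l2 (d 3)) = abs_l2 (d 2)"
    using has_weak_deriv_l2(3)[OF D(1)] bc(3) by (simp add: linear_0[OF linear_const_l2])
  moreover have V: "volterra (abs_l2 (wderiv (wderiv (snd x)))) = abs_l2 (wderiv (snd x))"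
    using has_weak_deriv_l2(1)[OF e2(1)] bc(2) by (simp add: linear_0[OF linear_const_l2])
  moreover have "volterra (abs_l2 (wderiv (snd x))) = abs_l2 (snd x)"
    using has_weak_deriv_l2(1)[OF e1(1)] bc(1) by (simp add: linear_0[OF linear_const_l2])
  ultimately show "state_class x = beam_state (state_class (beam_AB x u)) u"
    unfolding cls beam_state_def by (simp add: state_class_def d_def)
  show "snd x 1 = tip_velocity (state_class (beam_AB x u))"
    unfolding cls tip_velocity_def using has_weak_deriv_l2(2)[OF e1(1)] bc(1) V by simp
qed

text \<open>The converse construction: any derivative X' together with any input comes from an
  element of the domain. This lifts trajectories in \<open>l2\<close> to classical
  solutions.\<close>

lemma beam_domain_exists:
  "\<exists>x. (x, u) \<in> beam_domain \<and> beam_AB x u \<in> state_space \<and> state_class (beam_AB x u) = X'"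
proof -
  define e2 where "e2 = rep_l2 (fst X')"
  define e1 where "e1 \<zeta> = 0 + integral {0..\<zeta>} e2" for \<zeta>
  define f2 where "f2 \<zeta> = 0 + integral {0..\<zeta>} e1" for \<zeta>
  define d4 where "d4 \<zeta> = - rep_l2 (snd X') \<zeta>" for \<zeta>
  \<comment> \<open>The constants of integration are chosen to give d3(1) = u and d2(1) = 0.\<close>
  define d3 where "d3 \<zeta> = (u - integral {0..1} d4) + integral {0..\<zeta>} d4" for \<zeta>
  define d2 where "d2 \<zeta> = - integral {0..1} d3 + integral {0..\<zeta>} d3" for \<zeta>
  define d1 where "d1 \<zeta> = 0 + integral {0..\<zeta>} d2" for \<zeta>
  define f1 where "f1 \<zeta> = 0 + integral {0..\<zeta>} d1" for \<zeta>
  have cont: "square_integrable {0..1} f" if "has_weak_deriv f g" for f g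
    using that by (intro square_integrable_continuous has_weak_deriv_continuous)
  have sq: "square_integrable {0..1} e2" "square_integrable {0..1} d4"
    unfolding e2_def d4_def by (intro square_integrable_uminus square_integrable_rep_l2)+
  have e1: "has_weak_deriv e1 e2"
    unfolding e1_def[abs_def] by (rule has_weak_deriv_indefinite_integral[OF sq(1)])
  have f2: "has_weak_deriv f2 e1"
    unfolding f2_def[abs_def] by (rule has_weak_deriv_indefinite_integral[OF cont[OF e1]])
  have d3: "has_weak_deriv d3 d4"
    unfolding d3_def[abs_def] by (rule has_weak_deriv_indefinite_integral[OF sq(2)])
  have d2: "has_weak_deriv d2 d3"
    unfolding d2_def[abs_def] by (rule has_weak_deriv_indefinite_integral[OF cont[OF d3]])
  have d1: "has_weak_deriv d1 d2"
    unfolding d1_def[abs_def] by (rule has_weak_deriv_indefinite_integral[OF cont[OF d2]])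
  have f1: "has_weak_deriv f1 d1"
    unfolding f1_def[abs_def] by (rule has_weak_deriv_indefinite_integral[OF cont[OF d1]])
  have w2: "(wderiv ^^ 2) f1 = wderiv d1" by (simp add: funpow_wderiv_2 wderiv_wderiv[OF f1 d1])
  have w3: "(wderiv ^^ 3) f1 = wderiv d2"
    using w2 wderiv_wderiv(1)[OF d1 d2] by (simp add: numeral_eq_Suc)
  have w4: "(wderiv ^^ 4) f1 = wderiv d3"
    using w3 wderiv_wderiv(1)[OF d2 d3] by (simp add: numeral_eq_Suc)
  have s4: "f1 \<in> sobolev 4"
    using f1 d1 d2 d3 sq(2) by (auto simp: numeral_eq_Suc)
  have s2: "f2 \<in> sobolev 2" using f2 e1 by (auto simp: sobolev_2_iff)
  have X: "(f1, f2) \<in> state_space"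
    by (rule state_spaceI(1)[OF f1 d1 _ _ cont[OF f2]]) (simp_all add: f1_def d1_def)
  have "((f1, f2), u) \<in> beam_domain"
    using X s4 s2 wderiv_wderiv(2)[OF f2 e1, of 0] wderiv_wderiv(2)[OF d1 d2, of 1] wderiv_wderiv(2)[OF d2 d3, of 1]
    by (auto simp: beam_domain_def w2 w3 f2_def e1_def d2_def d3_def)
  moreover have w4sq: "square_integrable {0..1} (\<lambda>\<zeta>. - (wderiv ^^ 4) f1 \<zeta>)"
    unfolding w4 using has_weak_deriv_wderiv[OF d3]
    by (intro square_integrable_uminus has_weak_deriv_square_integrable)
  note I = state_spaceI[OF f2 e1 _ _ w4sq]
  \<comment> \<open>\<open>beam_AB\<close> contains the fourth derivative as chosen by
    \<open>wderiv\<close>, which is known to agree with \<open>d4\<close> almost everywhere; the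
    class is the same.\<close>
  have "AE \<zeta> in lebesgue_on {0..1}. - (wderiv ^^ 4) f1 \<zeta> = rep_l2 (snd X') \<zeta>"
    using wderiv_AE_eq[OF d3] by eventually_elim (simp add: w4 d4_def)
  then have "abs_l2 (\<lambda>\<zeta>. - (wderiv ^^ 4) f1 \<zeta>) = abs_l2 (rep_l2 (snd X'))"
    by (simp only: abs_l2_eq_iff[OF w4sq square_integrable_rep_l2])
  then have "beam_AB (f1, f2) u \<in> state_space" "state_class (beam_AB (f1, f2) u) = X'"
    using I by (auto simp: beam_AB_def f2_def e1_def e2_def)
  ultimately show ?thesis by blast
qed

section \<open>Optimal inputs\<close>

lemma L2_loc_cong:
  assumes "\<And>t. 0 \<le> t \<Longrightarrow> f t = g t"
  shows "L2_loc f \<longleftrightarrow> L2_loc g"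
proof -
  have "square_integrable {0..T} f \<longleftrightarrow> square_integrable {0..T} g" for T
  proof
    show "square_integrable {0..T} g" if "square_integrable {0..T} f"
      using that by (rule square_integrable_cong) (simp add: assms)
    show "square_integrable {0..T} f" if "square_integrable {0..T} g"
      using that by (rule square_integrable_cong) (simp add: assms)
  qed
  then show ?thesis by (simp add: L2_loc_def)
qed

lemma L2_loc_limit_cong:
  assumes "\<And>k t. 0 \<le> t \<Longrightarrow> fk k t = gk k t" "\<And>t. 0 \<le> t \<Longrightarrow> f t = g t"
  shows "L2_loc_limit fk f \<longleftrightarrow> L2_loc_limit gk g"
proof -
  have "L2_loc (fk k) = L2_loc (gk k)" for k by (rule L2_loc_cong[OF assms(1)])
  moreover have "L2_loc f = L2_loc g" by (rule L2_loc_cong[OF assms(2)])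
  moreover have "sq_int T (\<lambda>t. fk k t - f t) = sq_int T (\<lambda>t. gk k t - g t)" for k T
    unfolding sq_int_def using assms by (intro Bochner_Integration.integral_cong) auto
  ultimately show ?thesis by (simp add: L2_loc_limit_iff)
qed

lemma classical_solution_trajectory:
  assumes "classical_solution \<epsilon> x u y"
  defines "X' \<equiv> \<lambda>t. state_class (beam_AB (x t) (u t))"
  shows "trajectory (\<lambda>t. state_class (x t)) X' u"
    and "\<And>t. 0 \<le> t \<Longrightarrow> x t \<in> state_space"
    and "\<And>t. 0 \<le> t \<Longrightarrow> snd (x t) 1 = tip_velocity (X' t)"
    and "\<And>t. 0 \<le> t \<Longrightarrow> (wderiv ^^ 3) (fst (x t)) 1 = u t"
    and "\<And>t. 0 \<le> t \<Longrightarrow> y t = of_real \<epsilon> * u t - tip_velocity (X' t)"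
proof -
  have C1: "state_C1 x (\<lambda>t. beam_AB (x t) (u t))" and u: "continuous_on {0..} u"
    and dom: "\<And>t. 0 \<le> t \<Longrightarrow> (x t, u t) \<in> beam_domain"
    and y: "\<And>t. 0 \<le> t \<Longrightarrow> y t = beam_CD \<epsilon> (x t) (u t)"
    using assms by (auto simp: classical_solution_def)
  show "trajectory (\<lambda>t. state_class (x t)) X' u"
    using C1 u beam_domain_state(1)[OF dom] unfolding X'_def
    by (auto simp: trajectory_def state_C1_iff state_continuous_iff)
  show "x t \<in> state_space" if "0 \<le> t" for t
    using C1 that by (auto simp: state_C1_def state_continuous_def)
  show v: "snd (x t) 1 = tip_velocity (X' t)" if "0 \<le> t" for t
    unfolding X'_def by (rule beam_domain_state(2)[OF dom[OF that]])
  show q: "(wderiv ^^ 3) (fst (x t)) 1 = u t" if "0 \<le> t" for t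
    using dom[OF that] by (simp add: beam_domain_def)
  show "y t = of_real \<epsilon> * u t - tip_velocity (X' t)" if "0 \<le> t" for t
    using y[OF that] v[OF that] q[OF that] by (simp add: beam_CD_def)
qed

text \<open>A representative of the state is chosen separately for each time. This does no harm,
  since continuity and differentiability in time depend on the class alone.\<close>

lemma trajectory_classical_solution:
  assumes "trajectory X X' u"
  shows "\<exists>x. classical_solution \<epsilon> x u (\<lambda>t. of_real \<epsilon> * u t - tip_velocity (X' t)) \<and>
    (\<forall>t\<ge>0. state_class (x t) = X t \<and> state_class (beam_AB (x t) (u t)) = X' t)"
proof -
  have "\<forall>t. \<exists>x. (x, u t) \<in> beam_domain \<and> beam_AB x (u t) \<in> state_space \<and> state_class (beam_AB x (u t)) = X' t"
    by (intro allI beam_domain_exists)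
  from choice[OF this] obtain x where dom: "\<And>t. (x t, u t) \<in> beam_domain"
    and sp: "\<And>t. beam_AB (x t) (u t) \<in> state_space"
    and cls: "\<And>t. state_class (beam_AB (x t) (u t)) = X' t"
    by auto
  have tr: "\<And>t. 0 \<le> t \<Longrightarrow> (X has_vector_derivative X' t) (at t within {0..})" "continuous_on {0..} X'"
    "continuous_on {0..} u" "\<And>t. 0 \<le> t \<Longrightarrow> X t = beam_state (X' t) (u t)"
    using assms by (auto simp: trajectory_def)
  have clsx: "state_class (x t) = X t" if "0 \<le> t" for t
    using beam_domain_state(1)[OF dom[of t]] tr(4)[OF that] by (simp add: cls)
  have xsp: "x t \<in> state_space" for t using dom[of t] by (simp add: beam_domain_def)
  have "continuous_on {0..} (\<lambda>t. state_class (x t))"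
    using trajectory_continuous[OF assms] by (rule continuous_on_eq) (simp add: clsx)
  moreover have "((\<lambda>t. state_class (x t)) has_vector_derivative X' t) (at t within {0..})" if "0 \<le> t" for t
    using tr(1)[OF that] by (rule has_vector_derivative_transform[rotated 2]) (use that clsx in auto)
  ultimately have "state_C1 x (\<lambda>t. beam_AB (x t) (u t))"
    using xsp sp tr(2) by (simp add: state_C1_iff state_continuous_iff cls)
  moreover have "beam_CD \<epsilon> (x t) (u t) = of_real \<epsilon> * u t - tip_velocity (X' t)" for t
    using dom[of t] beam_domain_state(2)[OF dom[of t]] by (simp add: beam_CD_def beam_domain_def cls)
  ultimately have "classical_solution \<epsilon> x u (\<lambda>t. of_real \<epsilon> * u t - tip_velocity (X' t))"
    using tr dom
    by (auto simp: classical_solution_def intro!: continuous_intros bounded_linear.continuous_on[OF bounded_linear_tip_velocity])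
  with clsx cls show ?thesis by blast
qed

text \<open>Along classical solutions w_t(1) = \<epsilon> u - y and the third derivative at 1 is u,
  so the convergence of inputs and outputs already contains that of both traces.\<close>

lemma classical_approximation_limits:
  assumes "classical_approximation \<epsilon> xk uk yk x u y" "state_continuous x"
  shows "weak_trajectory (\<lambda>t. state_class (x t)) u (\<lambda>t. of_real \<epsilon> * u t - y t)"
    and "L2_loc_limit (\<lambda>k t. (wderiv ^^ 3) (fst (xk k t)) 1) u"
    and "L2_loc_limit (\<lambda>k t. snd (xk k t) 1) (\<lambda>t. of_real \<epsilon> * u t - y t)"
proof -
  have cl: "\<And>k. classical_solution \<epsilon> (xk k) (uk k) (yk k)"
    and unif: "\<And>T. 0 < T \<Longrightarrow> uniform_limit {0..T} (\<lambda>k t. state_norm (state_diff (xk k t) (x t))) (\<lambda>t. 0) sequentially"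
    and u: "L2_loc_limit uk u" and y: "L2_loc_limit yk y"
    using assms(1) by (auto simp: classical_approximation_def)
  note C = classical_solution_trajectory[OF cl]
  have x: "\<And>t. 0 \<le> t \<Longrightarrow> x t \<in> state_space" "continuous_on {0..} (\<lambda>t. state_class (x t))"
    using assms(2) by (auto simp: state_continuous_iff)
  have "L2_loc_limit (\<lambda>k t. of_real \<epsilon> * uk k t - yk k t) (\<lambda>t. of_real \<epsilon> * u t - y t)"
    by (intro L2_loc_limit_diff L2_loc_limit_cmult u y)
  then have v: "L2_loc_limit (\<lambda>k t. tip_velocity (state_class (beam_AB (xk k t) (uk k t)))) (\<lambda>t. of_real \<epsilon> * u t - y t)"
    by (rule L2_loc_limit_cong[THEN iffD1, rotated 2]) (simp_all add: C(5))
  then show "L2_loc_limit (\<lambda>k t. snd (xk k t) 1) (\<lambda>t. of_real \<epsilon> * u t - y t)"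
    by (rule L2_loc_limit_cong[THEN iffD1, rotated 2]) (simp_all add: C(3))
  show "L2_loc_limit (\<lambda>k t. (wderiv ^^ 3) (fst (xk k t)) 1) u"
    using u by (rule L2_loc_limit_cong[THEN iffD1, rotated 2]) (simp_all add: C(4))
  have "uniform_limit {0..T} (\<lambda>k t. state_class (xk k t)) (\<lambda>t. state_class (x t)) sequentially" if "0 < T" for T
    using unif[OF that] x(1) C(2) by (simp add: uniform_limit_iff state_norm_diff dist_norm)
  then show "weak_trajectory (\<lambda>t. state_class (x t)) u (\<lambda>t. of_real \<epsilon> * u t - y t)"
    unfolding weak_trajectory_def
    by (intro conjI x(2) exI allI impI) (assumption | rule C(1) u v)+
qed

lemma solution_from_weak_trajectory:
  assumes "solution_from \<epsilon> x0 x u y" "x0 \<in> state_space"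
  shows "weak_trajectory (\<lambda>t. state_class (x t)) u (\<lambda>t. of_real \<epsilon> * u t - y t)"
    "state_class (x 0) = state_class x0" "L2_loc y"
proof -
  have gen: "generalized_solution \<epsilon> x u y" "state_eq (x 0) x0" using assms(1) by (auto simp: solution_from_def)
  then obtain xk uk yk where "classical_approximation \<epsilon> xk uk yk x u y" and cont: "state_continuous x"
    by (auto simp: generalized_solution_def)
  then show "weak_trajectory (\<lambda>t. state_class (x t)) u (\<lambda>t. of_real \<epsilon> * u t - y t)"
    by (rule classical_approximation_limits(1))
  have "x 0 \<in> state_space" using cont by (simp add: state_continuous_def)
  then show "state_class (x 0) = state_class x0"
    using gen(2) assms(2) by (simp add: state_eq_def state_norm_diff)
  show "L2_loc y" using gen(1) by (simp add: generalized_solution_def)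
qed

text \<open>Traces may stem from any approximating sequence; all of them have the limits u and
  \<epsilon> u - y, and L^2 limits are unique almost everywhere.\<close>

lemma boundary_traces_AE:
  assumes "boundary_traces \<epsilon> x u y q v" "state_continuous x"
  shows "AE t in lebesgue_on {0..}. q t = u t" "AE t in lebesgue_on {0..}. v t = of_real \<epsilon> * u t - y t"
proof -
  obtain xk uk yk where approx: "classical_approximation \<epsilon> xk uk yk x u y"
    and q: "L2_loc_limit (\<lambda>k t. (wderiv ^^ 3) (fst (xk k t)) 1) q"
    and v: "L2_loc_limit (\<lambda>k t. snd (xk k t) 1) v"
    using assms(1) unfolding boundary_traces_def by blast
  show "AE t in lebesgue_on {0..}. q t = u t"
    by (rule L2_loc_limit_unique[OF q classical_approximation_limits(2)[OF approx assms(2)]])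
  show "AE t in lebesgue_on {0..}. v t = of_real \<epsilon> * u t - y t"
    by (rule L2_loc_limit_unique[OF v classical_approximation_limits(3)[OF approx assms(2)]])
qed

lemma weak_trajectory_solution:
  fixes \<epsilon> :: real
  assumes "weak_trajectory X u v" "X 0 = state_class x0" "x0 \<in> state_space"
  defines "y \<equiv> \<lambda>t. of_real \<epsilon> * u t - v t"
  shows "\<exists>x. solution_from \<epsilon> x0 x u y \<and> boundary_traces \<epsilon> x u y u v"
proof -
  obtain Xk Xk' uk where traj: "\<And>k. trajectory (Xk k) (Xk' k) (uk k)"
      and unif: "\<And>T. 0 < T \<Longrightarrow> uniform_limit {0..T} Xk X sequentially"
      and u: "L2_loc_limit uk u" and v: "L2_loc_limit (\<lambda>k t. tip_velocity (Xk' k t)) v"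
    using assms(1) unfolding weak_trajectory_def by blast
  define yk where "yk k t = of_real \<epsilon> * uk k t - tip_velocity (Xk' k t)" for k t
  have "\<exists>x. classical_solution \<epsilon> x (uk k) (yk k) \<and>
    (\<forall>t\<ge>0. state_class (x t) = Xk k t \<and> state_class (beam_AB (x t) (uk k t)) = Xk' k t)" for k
    unfolding yk_def[abs_def] by (rule trajectory_classical_solution[OF traj])
  then obtain xk where cl: "\<And>k. classical_solution \<epsilon> (xk k) (uk k) (yk k)"
    and cls: "\<And>k t. 0 \<le> t \<Longrightarrow> state_class (xk k t) = Xk k t" by metis
  define x where "x t = state_of (X t)" for t
  have x: "x t \<in> state_space" "state_class (x t) = X t" for t by (simp_all add: x_def state_of)
  have cont: "state_continuous x"
    using assms(1) x by (simp add: state_continuous_iff weak_trajectory_def)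
  have y: "L2_loc_limit yk y"
    unfolding yk_def[abs_def] y_def by (intro L2_loc_limit_diff L2_loc_limit_cmult u v)
  have "uniform_limit {0..T} (\<lambda>k t. state_norm (state_diff (xk k t) (x t))) (\<lambda>t. 0) sequentially" if "0 < T" for T
    using unif[OF that] x classical_solution_trajectory(2)[OF cl] cls
    by (simp add: uniform_limit_iff state_norm_diff dist_norm)
  then have approx: "classical_approximation \<epsilon> xk uk yk x u y"
    using cl u y by (simp add: classical_approximation_def)
  have "L2_loc_limit (\<lambda>k t. snd (xk k t) 1) (\<lambda>t. of_real \<epsilon> * u t - y t)"
    by (rule classical_approximation_limits(3)[OF approx cont])
  then have "L2_loc_limit (\<lambda>k t. snd (xk k t) 1) v" by (simp add: y_def)
  then have "boundary_traces \<epsilon> x u y u v"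
    using approx classical_approximation_limits(2)[OF approx cont] by (auto simp: boundary_traces_def)
  moreover have "state_eq (x 0) x0"
    using x[of 0] assms(2,3) by (simp add: state_eq_def state_norm_diff)
  moreover have "generalized_solution \<epsilon> x u y"
    using cont u y approx by (auto simp: generalized_solution_def L2_loc_limit_def)
  ultimately show ?thesis by (auto simp: solution_from_def)
qed

section \<open>Characterization of optimal inputs\<close>

context output_weights
begin

lemma solution_cost:
  assumes "solution_from \<epsilon> x0 x u y" "x0 \<in> state_space"
  shows "cost u y = ennreal (\<nu> * (state_norm x0)\<^sup>2) \<longleftrightarrow> (AE t in lebesgue_on {0..}. of_real \<nu> * u t + y t = 0)"
    and "ennreal (\<nu> * (state_norm x0)\<^sup>2) \<le> cost u y"
  using cost_of_feedback[OF solution_from_weak_trajectory(1)[OF assms]]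
    solution_from_weak_trajectory(2)[OF assms] assms(2)
  by (simp_all add: state_norm_class)

lemma optimal_solution_exists:
  assumes "x0 \<in> state_space"
  shows "\<exists>x u v. solution_from \<epsilon> x0 x u (\<lambda>t. of_real \<epsilon> * u t - v t) \<and>
    boundary_traces \<epsilon> x u (\<lambda>t. of_real \<epsilon> * u t - v t) u v \<and>
    cost u (\<lambda>t. of_real \<epsilon> * u t - v t) = ennreal (\<nu> * (state_norm x0)\<^sup>2)"
proof -
  \<comment> \<open>With the damping \<epsilon> + \<nu> the output is \<epsilon> u - (\<epsilon> +
    \<nu>) u = - \<nu> u, so the square in the cost vanishes.\<close>
  interpret damped_beam "\<epsilon> + \<nu>" using eps lam_pos by (intro damped_beam.intro) simp
  obtain X u where X: "weak_trajectory X u (\<lambda>t. of_real (\<epsilon> + \<nu>) * u t)" "X 0 = state_class x0"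
    using closed_loop_exists by blast
  obtain x where x: "solution_from \<epsilon> x0 x u (\<lambda>t. of_real \<epsilon> * u t - of_real (\<epsilon> + \<nu>) * u t)"
    "boundary_traces \<epsilon> x u (\<lambda>t. of_real \<epsilon> * u t - of_real (\<epsilon> + \<nu>) * u t) u (\<lambda>t. of_real (\<epsilon> + \<nu>) * u t)"
    using weak_trajectory_solution[OF X assms] by blast
  have "cost u (\<lambda>t. of_real \<epsilon> * u t - of_real (\<epsilon> + \<nu>) * u t) = ennreal (\<nu> * (state_norm x0)\<^sup>2)"
    unfolding solution_cost(1)[OF x(1) assms] by (simp add: algebra_simps)
  with x show ?thesis
    by (intro exI[of _ x] exI[of _ u] exI[of _ "\<lambda>t. of_real (\<epsilon> + \<nu>) * u t"] conjI)
qed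

text \<open>The closed loop attains the lower bound for the cost, so optimality means attaining it,
  and this is equivalent to the feedback law.\<close>

lemma optimal_input_iff:
  assumes "x0 \<in> state_space"
  shows "optimal_input \<epsilon> x0 u \<longleftrightarrow>
    (\<exists>x y. solution_from \<epsilon> x0 x u y \<and> (AE t in lebesgue_on {0..}. of_real \<nu> * u t + y t = 0))"
proof
  assume "optimal_input \<epsilon> x0 u"
  then obtain x y where xy: "solution_from \<epsilon> x0 x u y"
    and opt: "\<And>x' u' y'. solution_from \<epsilon> x0 x' u' y' \<Longrightarrow> cost u y \<le> cost u' y'"
    unfolding optimal_input_def by blast
  have "cost u y = ennreal (\<nu> * (state_norm x0)\<^sup>2)"
    using optimal_solution_exists[OF assms] opt solution_cost(2)[OF xy assms] by (metis antisym)
  with xy show "\<exists>x y. solution_from \<epsilon> x0 x u y \<and> (AE t in lebesgue_on {0..}. of_real \<nu> * u t + y t = 0)"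
    using solution_cost(1)[OF xy assms] by blast
next
  assume "\<exists>x y. solution_from \<epsilon> x0 x u y \<and> (AE t in lebesgue_on {0..}. of_real \<nu> * u t + y t = 0)"
  then obtain x y where xy: "solution_from \<epsilon> x0 x u y"
    and "AE t in lebesgue_on {0..}. of_real \<nu> * u t + y t = 0" by blast
  then have "cost u y = ennreal (\<nu> * (state_norm x0)\<^sup>2)" using solution_cost(1)[OF xy assms] by simp
  then show "optimal_input \<epsilon> x0 u"
    unfolding optimal_input_def using xy solution_cost(2)[OF _ assms] by metis
qed

text \<open>Both inputs obey the same linear feedback, so the difference is a closed-loop trajectory
  from 0. Its energy at T plus 2 (\<epsilon> + \<nu>) times the square integral of the input
  difference is 0, and both terms are nonnegative.\<close>

lemma optimal_input_unique:
  assumes "x0 \<in> state_space" "optimal_input \<epsilon> x0 u" "optimal_input \<epsilon> x0 u'"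
  shows "AE t in lebesgue_on {0..}. u t = u' t"
proof -
  obtain x y where xy: "solution_from \<epsilon> x0 x u y" "AE t in lebesgue_on {0..}. of_real \<nu> * u t + y t = 0"
    using assms optimal_input_iff by blast
  obtain x' y' where xy': "solution_from \<epsilon> x0 x' u' y'" "AE t in lebesgue_on {0..}. of_real \<nu> * u' t + y' t = 0"
    using assms optimal_input_iff by blast
  define D d e where "D t = state_class (x t) - state_class (x' t)" and "d t = u t - u' t"
    and "e t = (of_real \<epsilon> * u t - y t) - (of_real \<epsilon> * u' t - y' t)" for t
  have D: "weak_trajectory D d e"
    unfolding D_def d_def e_def
    by (rule weak_trajectory_diff; rule solution_from_weak_trajectory(1)) (fact xy xy' assms)+
  have L: "L2_loc d" "L2_loc e" using weak_trajectory_L2_loc[OF D] by auto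
  have D0: "D 0 = 0"
    using solution_from_weak_trajectory(2)[OF xy(1) assms(1)] solution_from_weak_trajectory(2)[OF xy'(1) assms(1)]
    by (simp add: D_def)
  have e: "AE t in lebesgue_on {0..}. e t = of_real (\<epsilon> + \<nu>) * d t"
    using xy(2) xy'(2)
  proof eventually_elim
    case (elim t)
    then have "y t = - (of_real \<nu> * u t)" "y' t = - (of_real \<nu> * u' t)"
      by (simp_all add: eq_neg_iff_add_eq_0 add.commute)
    then show ?case by (simp add: e_def d_def algebra_simps)
  qed
  have "AE t in lebesgue_on {0..T}. d t = 0" if T: "0 < T" for T
  proof -
    have eT: "AE t in lebesgue_on {0..T}. e t = of_real (\<epsilon> + \<nu>) * d t"
      using e T by (simp add: AE_atLeast_0_iff)
    have 1: "sq_int T e = (\<epsilon> + \<nu>)\<^sup>2 * sq_int T d"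
      using sq_int_cong_AE[OF L(2) L2_loc_cmult[OF L(1)] T eT] unfolding sq_int_cmult norm_of_real by simp
    have "AE t in lebesgue_on {0..T}. d t - e t = of_real (1 - (\<epsilon> + \<nu>)) * d t"
      using eT by eventually_elim (simp add: algebra_simps)
    from sq_int_cong_AE[OF L2_loc_diff[OF L] L2_loc_cmult[OF L(1)] T this]
    have 2: "sq_int T (\<lambda>t. d t - e t) = (1 - (\<epsilon> + \<nu>))\<^sup>2 * sq_int T d"
      unfolding sq_int_cmult norm_of_real by simp
    have "(norm (D T))\<^sup>2 = (1 - (\<epsilon> + \<nu>))\<^sup>2 * sq_int T d - sq_int T d - (\<epsilon> + \<nu>)\<^sup>2 * sq_int T d"
      using weak_trajectory_energy[OF D T] 1 2 by (simp add: D0)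
    also have "\<dots> = - (2 * (\<epsilon> + \<nu>) * sq_int T d)" by (simp add: power2_eq_square algebra_simps)
    finally have "2 * (\<epsilon> + \<nu>) * sq_int T d \<le> 0" using zero_le_power2[of "norm (D T)"] by linarith
    then have "sq_int T d \<le> 0" using eps lam_pos by (simp add: mult_le_0_iff)
    then have "sq_int T d = 0" using sq_int_nonneg[of T d] by linarith
    then show ?thesis using sq_int_eq_zero_iff[OF L(1) T] by simp
  qed
  then show ?thesis unfolding AE_atLeast_0_iff by (simp add: d_def)
qed

text \<open>\<open>optimal_input\<close> asserts only that some state and output accompany u;
  \<open>weak_trajectory_unique\<close> identifies that output with the given one.\<close>

lemma optimal_input_iff_feedback:
  assumes "x0 \<in> state_space" "solution_from \<epsilon> x0 x u y"
  shows "optimal_input \<epsilon> x0 u \<longleftrightarrow> (AE t in lebesgue_on {0..}. of_real \<nu> * u t + y t = 0)"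
proof
  assume "optimal_input \<epsilon> x0 u"
  then obtain x' y' where xy': "solution_from \<epsilon> x0 x' u y'" and fb: "AE t in lebesgue_on {0..}. of_real \<nu> * u t + y' t = 0"
    using assms optimal_input_iff by blast
  note W = solution_from_weak_trajectory[OF assms(2,1)] and W' = solution_from_weak_trajectory[OF xy' assms(1)]
  have "AE t in lebesgue_on {0..}. of_real \<epsilon> * u t - y t = of_real \<epsilon> * u t - y' t"
    by (rule weak_trajectory_unique[OF W(1) W'(1)]) (simp_all add: W(2) W'(2))
  with fb show "AE t in lebesgue_on {0..}. of_real \<nu> * u t + y t = 0"
    by eventually_elim simp
qed (use assms optimal_input_iff in blast)

end

text \<open>Once the traces are replaced by q = u and v = \<epsilon> u - y, both feedback laws are
  forms of \<nu> u + y = 0, because \<mu> \<nu> = 1 and sqrt (1 + \<epsilon>^2) = \<epsilon> +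
  \<nu>.\<close>

theorem proposition1:
  fixes \<epsilon> \<mu> :: real and x\<^sub>0 :: state
  assumes "\<epsilon> > 0" and "\<mu> = inverse (sqrt (1 + \<epsilon>\<^sup>2) - \<epsilon>)" and "x\<^sub>0 \<in> state_space"
  shows
    "(\<exists>x u y q v. solution_from \<epsilon> x\<^sub>0 x u y \<and> boundary_traces \<epsilon> x u y q v \<and> optimal_input \<epsilon> x\<^sub>0 u) \<and>
     (\<forall>u u'. optimal_input \<epsilon> x\<^sub>0 u \<and> optimal_input \<epsilon> x\<^sub>0 u' \<longrightarrow>
        (AE t in lebesgue_on {0..}. u t = u' t)) \<and>
     (\<forall>x u y q v. solution_from \<epsilon> x\<^sub>0 x u y \<and> boundary_traces \<epsilon> x u y q v \<longrightarrow>
        (optimal_input \<epsilon> x\<^sub>0 u \<longleftrightarrow>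
           (AE t in lebesgue_on {0..}. u t = - of_real \<mu> * (of_real \<epsilon> * q t - v t)) \<and>
           (AE t in lebesgue_on {0..}. v t = of_real (sqrt (1 + \<epsilon>\<^sup>2)) * q t)) \<and>
        (optimal_input \<epsilon> x\<^sub>0 u \<longrightarrow>
           cost u y = ennreal (inverse \<mu> * (state_norm x\<^sub>0)\<^sup>2)))"
proof (intro conjI allI impI)
  define \<nu> where "\<nu> = sqrt (1 + \<epsilon>\<^sup>2) - \<epsilon>"
  interpret output_weights \<epsilon> \<nu> using assms(1) by (intro output_weights.intro) (simp_all add: \<nu>_def)
  have \<mu>: "inverse \<mu> = \<nu>" "\<mu> * \<nu> = 1" using assms(2) lam_pos by (auto simp: \<nu>_def)
  have \<kappa>: "sqrt (1 + \<epsilon>\<^sup>2) = \<epsilon> + \<nu>" by (simp add: \<nu>_def)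
  show "\<exists>x u y q v. solution_from \<epsilon> x\<^sub>0 x u y \<and> boundary_traces \<epsilon> x u y q v \<and> optimal_input \<epsilon> x\<^sub>0 u"
    using optimal_solution_exists[OF assms(3)] solution_cost(1)[OF _ assms(3)] optimal_input_iff[OF assms(3)] by metis
  show "AE t in lebesgue_on {0..}. u t = u' t"
    if "optimal_input \<epsilon> x\<^sub>0 u \<and> optimal_input \<epsilon> x\<^sub>0 u'" for u u'
    using optimal_input_unique[OF assms(3)] that by blast
  fix x u y q v assume "solution_from \<epsilon> x\<^sub>0 x u y \<and> boundary_traces \<epsilon> x u y q v"
  then have sol: "solution_from \<epsilon> x\<^sub>0 x u y" and tr: "boundary_traces \<epsilon> x u y q v" by auto
  have "state_continuous x" using sol by (simp add: solution_from_def generalized_solution_def)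
  note q = boundary_traces_AE(1)[OF tr this] and v = boundary_traces_AE(2)[OF tr this]
  note opt = optimal_input_iff_feedback[OF assms(3) sol]
  show "cost u y = ennreal (inverse \<mu> * (state_norm x\<^sub>0)\<^sup>2)" if "optimal_input \<epsilon> x\<^sub>0 u"
    using that opt solution_cost(1)[OF sol assms(3)] by (simp add: \<mu>)
  show "optimal_input \<epsilon> x\<^sub>0 u \<longleftrightarrow>
      (AE t in lebesgue_on {0..}. u t = - of_real \<mu> * (of_real \<epsilon> * q t - v t)) \<and>
      (AE t in lebesgue_on {0..}. v t = of_real (sqrt (1 + \<epsilon>\<^sup>2)) * q t)"
    unfolding opt
  proof (intro iffI conjI)
    assume fb: "AE t in lebesgue_on {0..}. of_real \<nu> * u t + y t = 0"
    have \<mu>\<nu>: "of_real \<mu> * (of_real \<nu> * z) = (z::complex)" for z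
      unfolding mult.assoc[symmetric] of_real_mult[symmetric] \<mu> by simp
    show "AE t in lebesgue_on {0..}. u t = - of_real \<mu> * (of_real \<epsilon> * q t - v t)"
      using fb q v
    proof eventually_elim
      case (elim t)
      then have "of_real \<epsilon> * q t - v t = - (of_real \<nu> * u t)"
        by (simp add: eq_neg_iff_add_eq_0 add.commute)
      then show ?case by (simp add: \<mu>\<nu>)
    qed
    show "AE t in lebesgue_on {0..}. v t = of_real (sqrt (1 + \<epsilon>\<^sup>2)) * q t"
      using fb q v
    proof eventually_elim
      case (elim t)
      then have "y t = - (of_real \<nu> * u t)" by (simp add: eq_neg_iff_add_eq_0 add.commute)
      with elim show ?case unfolding \<kappa> by (simp add: algebra_simps)
    qed
  next
    assume "(AE t in lebesgue_on {0..}. u t = - of_real \<mu> * (of_real \<epsilon> * q t - v t)) \<and>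
      (AE t in lebesgue_on {0..}. v t = of_real (sqrt (1 + \<epsilon>\<^sup>2)) * q t)"
    then have "AE t in lebesgue_on {0..}. v t = of_real (sqrt (1 + \<epsilon>\<^sup>2)) * q t" by simp
    with q v show "AE t in lebesgue_on {0..}. of_real \<nu> * u t + y t = 0"
    proof eventually_elim
      case (elim t)
      then have "of_real \<epsilon> * u t - y t = of_real (\<epsilon> + \<nu>) * u t" unfolding \<kappa> by simp
      then show ?case by (simp add: algebra_simps)
    qed
  qed
qed

end
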